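(* Let $n<0$ be an integer. Every T-link has infinitely many representations in the Lorenz-like template $\mathscr{L}(0,2n)$; that is, for every T-link $L$ there are infinitely many distinct links embedded in the template $\mathscr{L}(0,2n)$ that are ambient isotopic to $L$ in $S^3$.
   Context: Let $\sigma_1,\dots,\sigma_{m-1}$ denote the standard Artin generators of the braid group $B_m$ (words are read from top to bottom; $\sigma_i$ is the positive crossing in which the strand in position $i$ passes over the strand in position $i+1$). T-links: for integers $k\ge1$, $2\leq r_1<\cdots<r_k$ and $s_1,\dots,s_k>0$, the T-link $T((r_1,s_1),\dots,(r_k,s_k))$ is the closure of the braid $(\sigma_1\cdots\sigma_{r_1-1})^{s_1}\cdots(\sigma_1\cdots\sigma_{r_k-1})^{s_k}\in B_{r_k}$. Lorenz-like templates: the Lorenz template is the branched surface in $S^3$ with one branch line and two strips, the left strip leaving the left part and the right strip leaving the right part of the branch line; each strip returns stretched over the whole branch line, the left strip passing over the right one. For integers $u,v$, the Lorenz-like template $\mathscr{L}(u,v)$ is obtained by cutting the Lorenz template along its branch line and regluing the left strip with $u$ half twists and the right strip with $v$ half twists (positive half twists giving positive crossings). A link embedded in $\mathscr{L}(u,v)$ (a Lorenz-like link) is a nonempty link carried by the template along its semiflow, parallel components being allowed. Concretely, after cutting along the branch line, it is given by integers $N\geq 1$, $0\leq p\leq N$ and a strictly increasing map $f:\{1,\dots,p\}\to\{1,\dots,N\}$, and it is the closure of the $N$-strand braid $\Delta_L^{u}\Delta_R^{v}\lambda$. Here $\Delta_L$ is the positive half twist on the first $p$ strands, $\Delta_R$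 is the positive half twist on the last $N-p$ strands (a half twist on at most one strand is trivial), and $\lambda$ is the positive braid in which the strand starting in position $i\leq p$ ends in position $f(i)$, the strands starting in positions $p+1,\dots,N$ end in increasing order in the positions not in the image of $f$, any two strands cross at most once, and at every crossing a strand from the first $p$ passes over a strand from the last $N-p$. A representation of a link $L$ in a template is a link embedded in the template that is ambient isotopic to $L$ in $S^3$; two representations are distinct if their data $(N,p,f)$ are different. *)

theory Defs
  imports "HOL-Analysis.Analysis"
begin

section \<open>Ambient isotopy in the 3-sphere\<close>

definition S3 :: "(complex \<times> complex) set" where
  "S3 = sphere 0 1"

text \<open>Links are considered as unoriented subsets of the ambient space.\<close>

definition ambient_isotopic :: "'a::topological_space set \<Rightarrow> 'a set \<Rightarrow> 'a set \<Rightarrow> bool" where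
  "ambient_isotopic X A B \<longleftrightarrow>
     (\<exists>H :: real \<Rightarrow> 'a \<Rightarrow> 'a.
        continuous_on ({0..1} \<times> X) (\<lambda>(t, x). H t x) \<and>
        (\<forall>t\<in>{0..1}. \<exists>g. homeomorphism X X (H t) g) \<and>
        (\<forall>x\<in>X. H 0 x = x) \<and>
        H 1 ` A = B)"


section \<open>Braid words and their closures\<close>

datatype artin_gen = Sigma nat | SigmaInv nat

type_synonym braid_word = "artin_gen list"

fun gen_inv :: "artin_gen \<Rightarrow> artin_gen" where
  "gen_inv (Sigma i) = SigmaInv i"
| "gen_inv (SigmaInv i) = Sigma i"

definition word_inv :: "braid_word \<Rightarrow> braid_word" where
  "word_inv w = rev (map gen_inv w)"

definition word_pow :: "braid_word \<Rightarrow> int \<Rightarrow> braid_word" where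
  "word_pow w k =
     (if k \<ge> 0 then concat (replicate (nat k) w)
      else concat (replicate (nat (- k)) (word_inv w)))"

text \<open>
  A geometric braid on m strands is a loop of m-point subsets of the complex plane based at
  the positions 1, ..., m.  The real part is the horizontal position, the imaginary part is the
  height towards the viewer, and time runs downwards.  During \<open>Sigma i\<close> the points in positions
  i and i + 1 are exchanged by a half turn about their midpoint, the one starting in position i
  moving through the upper half plane, that is, in front.
\<close>

fun gen_slice :: "nat \<Rightarrow> artin_gen \<Rightarrow> real \<Rightarrow> complex set" where
  "gen_slice m (Sigma i) s =
     of_nat ` ({1..m} - {i, Suc i}) \<union>
     {of_nat i + 1/2 - cis (- (pi * s)) / 2, of_nat i + 1/2 + cis (- (pi * s)) / 2}"
| "gen_slice m (SigmaInv i) s =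
     of_nat ` ({1..m} - {i, Suc i}) \<union>
     {of_nat i + 1/2 - cis (pi * s) / 2, of_nat i + 1/2 + cis (pi * s) / 2}"

text \<open>
  The time interval [0, 1) is divided into equal parts, one for each letter of the word.
\<close>

definition braid_slice :: "nat \<Rightarrow> braid_word \<Rightarrow> real \<Rightarrow> complex set" where
  "braid_slice m w t =
     (if w = [] then of_nat ` {1..m}
      else gen_slice m (w ! nat \<lfloor>real (length w) * t\<rfloor>) (frac (real (length w) * t)))"

text \<open>
  The orientation-preserving standard embedding of the open solid torus (plane times circle)
  into the 3-sphere.  Its image is the complement of the braid axis w = 0, and the circle over
  each point of the plane is a 0-framed longitude, so no extra full twist is introduced.
\<close>

definition solid_torus_to_S3 :: "complex \<Rightarrow> real \<Rightarrow> complex \<times> complex" where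
  "solid_torus_to_S3 z t = (z, cis (2 * pi * t)) /\<^sub>R sqrt (1 + (cmod z)\<^sup>2)"

definition braid_closure :: "nat \<Rightarrow> braid_word \<Rightarrow> (complex \<times> complex) set" where
  "braid_closure m w = {solid_torus_to_S3 z t | z t. 0 \<le> t \<and> t < 1 \<and> z \<in> braid_slice m w t}"

lemma braid_closure_subset_S3: "braid_closure m w \<subseteq> S3"
proof -
  have "norm (solid_torus_to_S3 z t) = 1" for z t
  proof -
    have "norm (z, cis (2 * pi * t)) = sqrt (1 + (cmod z)\<^sup>2)"
      by (simp add: norm_Pair add.commute)
    moreover have "sqrt (1 + (cmod z)\<^sup>2) > 0"
      by (simp add: add_pos_nonneg)
    ultimately show ?thesis
      by (simp add: solid_torus_to_S3_def del: scaleR_Pair)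
  qed
  then show ?thesis
    by (auto simp: braid_closure_def S3_def)
qed


section \<open>T-links\<close>

text \<open>The list \<open>[(r\<^sub>1, s\<^sub>1), \<dots>, (r\<^sub>k, s\<^sub>k)]\<close> encodes the parameters of a T-link.\<close>

definition T_link_parameters :: "(nat \<times> nat) list \<Rightarrow> bool" where
  "T_link_parameters rs \<longleftrightarrow>
     rs \<noteq> [] \<and> sorted_wrt (<) (map fst rs) \<and> (\<forall>(r, s)\<in>set rs. 2 \<le> r \<and> 0 < s)"

definition T_link_word :: "(nat \<times> nat) list \<Rightarrow> braid_word" where
  "T_link_word rs = concat (map (\<lambda>(r, s). concat (replicate s (map Sigma [1..<r]))) rs)"

definition T_link :: "(nat \<times> nat) list \<Rightarrow> (complex \<times> complex) set" where
  "T_link rs = braid_closure (fst (last rs)) (T_link_word rs)"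


section \<open>Links embedded in Lorenz-like templates\<close>

text \<open>
  The positive half twist on the strands in positions a + 1, ..., a + m, as the Garside word
  \<open>(\<sigma>\<^bsub>a+1\<^esub> \<dots> \<sigma>\<^bsub>a+m-1\<^esub>) (\<sigma>\<^bsub>a+1\<^esub> \<dots> \<sigma>\<^bsub>a+m-2\<^esub>) \<dots> (\<sigma>\<^bsub>a+1\<^esub>)\<close>.
\<close>

definition half_twist :: "nat \<Rightarrow> nat \<Rightarrow> braid_word" where
  "half_twist a m = concat (map (\<lambda>k. map Sigma [a + 1..<a + k]) (rev [1..<Suc m]))"

text \<open>
  Move first the strand p to position f p, then the strand p - 1 to position f (p - 1), and so
  on, always passing over.  The lemmas at the end of this section show that this is the positive
  braid described by the template.
\<close>

definition lorenz_word :: "nat \<Rightarrow> (nat \<Rightarrow> nat) \<Rightarrow> braid_word" where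
  "lorenz_word p f = concat (map (\<lambda>i. map Sigma [i..<f i]) (rev [1..<Suc p]))"

text \<open>Extensionality of f makes distinct triples represent distinct data.\<close>

definition lorenz_data :: "(nat \<times> nat \<times> (nat \<Rightarrow> nat)) set" where
  "lorenz_data =
     {(N, p, f). 1 \<le> N \<and> p \<le> N \<and> f \<in> {1..p} \<rightarrow>\<^sub>E {1..N} \<and> strict_mono_on {1..p} f}"

definition lorenz_like_link ::
    "int \<Rightarrow> int \<Rightarrow> nat \<times> nat \<times> (nat \<Rightarrow> nat) \<Rightarrow> (complex \<times> complex) set" where
  "lorenz_like_link u v = (\<lambda>(N, p, f).
     braid_closure N
       (word_pow (half_twist 0 p) u @ word_pow (half_twist p (N - p)) v @ lorenz_word p f))"

definition representations ::
    "int \<Rightarrow> int \<Rightarrow> (complex \<times> complex) set \<Rightarrow> (nat \<times> nat \<times> (nat \<Rightarrow> nat)) set" where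
  "representations u v L =
     {d \<in> lorenz_data. ambient_isotopic S3 (lorenz_like_link u v d) L}"


subsection \<open>The braid of the Lorenz template\<close>

text \<open>
  Given a labelling a of the positions by strands, \<open>final_labels w a\<close> is the labelling after
  the braid w, and \<open>crossings w a\<close> lists the pairs (over strand, under strand) of its crossings.
\<close>

fun gen_index :: "artin_gen \<Rightarrow> nat" where
  "gen_index (Sigma i) = i"
| "gen_index (SigmaInv i) = i"

definition swap_labels :: "artin_gen \<Rightarrow> (nat \<Rightarrow> nat) \<Rightarrow> nat \<Rightarrow> nat" where
  "swap_labels g a = a(gen_index g := a (Suc (gen_index g)), Suc (gen_index g) := a (gen_index g))"

fun gen_crossing :: "artin_gen \<Rightarrow> (nat \<Rightarrow> nat) \<Rightarrow> nat \<times> nat" where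
  "gen_crossing (Sigma i) a = (a i, a (Suc i))"
| "gen_crossing (SigmaInv i) a = (a (Suc i), a i)"

fun final_labels :: "braid_word \<Rightarrow> (nat \<Rightarrow> nat) \<Rightarrow> nat \<Rightarrow> nat" where
  "final_labels [] a = a"
| "final_labels (g # w) a = final_labels w (swap_labels g a)"

fun crossings :: "braid_word \<Rightarrow> (nat \<Rightarrow> nat) \<Rightarrow> (nat \<times> nat) list" where
  "crossings [] a = []"
| "crossings (g # w) a = gen_crossing g a # crossings w (swap_labels g a)"

lemma final_labels_append: "final_labels (v @ w) a = final_labels w (final_labels v a)"
  by (induction v arbitrary: a) auto

lemma crossings_append: "crossings (v @ w) a = crossings v a @ crossings w (final_labels v a)"
  by (induction v arbitrary: a) auto

lemma block_labels:
  assumes "i \<le> k"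
  shows "final_labels (map Sigma [i..<k]) a =
      (\<lambda>x. if i \<le> x \<and> x < k then a (Suc x) else if x = k then a i else a x)"
  using assms
  by (induction k rule: dec_induct) (auto simp: final_labels_append swap_labels_def fun_eq_iff)

lemma block_crossings:
  assumes "i \<le> k"
  shows "crossings (map Sigma [i..<k]) a = map (\<lambda>x. (a i, a (Suc x))) [i..<k]"
  using assms
  by (induction k rule: dec_induct) (auto simp: crossings_append block_labels)

definition lorenz_tail :: "nat \<Rightarrow> nat \<Rightarrow> (nat \<Rightarrow> nat) \<Rightarrow> braid_word" where
  "lorenz_tail i p f = concat (map (\<lambda>i. map Sigma [i..<f i]) (rev [Suc i..<Suc p]))"

lemma strict_mono_on_ge_self:
  fixes f :: "nat \<Rightarrow> nat"
  assumes "strict_mono_on {1..p} f" "f \<in> {1..p} \<rightarrow> {1..N}" "i \<in> {1..p}"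
  shows "i \<le> f i"
  using assms(3)
proof (induction i)
  case (Suc i)
  show ?case
  proof (cases "i = 0")
    case True
    then show ?thesis using assms(2) Suc.prems by (auto simp: Pi_iff)
  next
    case False
    with Suc have "i \<le> f i" by auto
    moreover have "f i < f (Suc i)"
      using False Suc.prems by (intro strict_mono_onD[OF assms(1)]) auto
    ultimately show ?thesis by simp
  qed
qed simp

lemma lorenz_tail_invariant:
  fixes f :: "nat \<Rightarrow> nat"
  assumes f: "strict_mono_on {1..p} f" "f \<in> {1..p} \<rightarrow> {1..N}" and "p \<le> N" "i \<le> p"
  defines "a \<equiv> final_labels (lorenz_tail i p f) id"
    and "c \<equiv> crossings (lorenz_tail i p f) id"
  shows "\<forall>x\<le>i. a x = x" "\<forall>j\<in>{Suc i..p}. a (f j) = j"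
    "\<forall>x\<in>{Suc i..N} - f ` {Suc i..p}. a x \<in> {Suc p..N}"
    "strict_mono_on ({Suc i..N} - f ` {Suc i..p}) a"
    "set c \<subseteq> {Suc i..p} \<times> {Suc p..N}" "distinct c"
  using \<open>i \<le> p\<close> unfolding a_def c_def
proof (induction i rule: inc_induct)
  case base
  {
    case 1 show ?case by (simp add: lorenz_tail_def)
  next
    case 2 show ?case by (simp add: lorenz_tail_def)
  next
    case 3 show ?case by (simp add: lorenz_tail_def)
  next
    case 4 show ?case by (simp add: lorenz_tail_def strict_mono_on_def)
  next
    case 5 show ?case by (simp add: lorenz_tail_def)
  next
    case 6 show ?case by (simp add: lorenz_tail_def)
  }
next
  case (step i)
  let ?i = "Suc i" and ?k = "f (Suc i)"
  define b where "b = final_labels (lorenz_tail ?i p f) id"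
  define d where "d = crossings (lorenz_tail ?i p f) id"
  have IH: "\<forall>x\<le>?i. b x = x" "\<forall>j\<in>{Suc ?i..p}. b (f j) = j"
    "\<forall>x\<in>{Suc ?i..N} - f ` {Suc ?i..p}. b x \<in> {Suc p..N}"
    "strict_mono_on ({Suc ?i..N} - f ` {Suc ?i..p}) b"
    "set d \<subseteq> {Suc ?i..p} \<times> {Suc p..N}" "distinct d"
    using step.IH unfolding b_def d_def by blast+
  have split: "lorenz_tail i p f = lorenz_tail ?i p f @ map Sigma [?i..<?k]"
    using step.hyps by (simp add: lorenz_tail_def upt_conv_Cons del: upt_Suc)
  have k: "?i \<le> ?k" "?k \<le> N"
    using strict_mono_on_ge_self[OF f, of ?i] f(2) step.hyps by (auto simp: Pi_iff)
  have fgt: "?k < f j" if "j \<in> {Suc ?i..p}" for j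
    using that by (intro strict_mono_onD[OF f(1)]) auto
  have lab: "final_labels (lorenz_tail i p f) id =
      (\<lambda>x. if ?i \<le> x \<and> x < ?k then b (Suc x) else if x = ?k then b ?i else b x)"
    unfolding split final_labels_append block_labels[OF k(1)] b_def ..
  have cro: "crossings (lorenz_tail i p f) id = d @ map (\<lambda>x. (?i, b (Suc x))) [?i..<?k]"
    unfolding split crossings_append block_crossings[OF k(1)] b_def[symmetric] d_def
    using IH(1) by simp
  have under: "Suc x \<in> {Suc ?i..N} - f ` {Suc ?i..p}" if "?i \<le> x" "x < ?k" for x
    using that k fgt by force
  have ins: "f ` {Suc i..p} = insert ?k (f ` {Suc ?i..p})"
  proof -
    have "{Suc i..p} = insert ?i {Suc ?i..p}" using step.hyps by auto
    then show ?thesis by simp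
  qed
  have old: "x \<in> {Suc ?i..N} - f ` {Suc ?i..p}"
    if "x \<in> {Suc i..N} - f ` {Suc i..p}" "?k < x" for x
    using that k unfolding ins by auto
  {
    case 1 show ?case unfolding lab using IH(1) k by auto
  next
    case 2 show ?case
    proof
      fix j assume "j \<in> {Suc i..p}"
      then consider "j = ?i" | "j \<in> {Suc ?i..p}" by force
      then show "final_labels (lorenz_tail i p f) id (f j) = j"
        using IH(1,2) fgt[of j] unfolding lab by cases auto
    qed
  next
    case 3 show ?case
    proof
      fix x assume x: "x \<in> {Suc i..N} - f ` {Suc i..p}"
      then have "x \<noteq> ?k" using ins by auto
      then consider "x < ?k" | "?k < x" by linarith
      then show "final_labels (lorenz_tail i p f) id x \<in> {Suc p..N}"
      proof cases
        case 1
        then have "Suc x \<in> {Suc ?i..N} - f ` {Suc ?i..p}" using x by (intro under) auto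
        then have "b (Suc x) \<in> {Suc p..N}" using IH(3) by blast
        then show ?thesis using 1 x unfolding lab by auto
      next
        case 2
        then have "b x \<in> {Suc p..N}" using IH(3) old[OF x] by blast
        then show ?thesis using 2 unfolding lab by auto
      qed
    qed
  next
    case 4 show ?case
    proof (rule strict_mono_onI)
      fix x y assume x: "x \<in> {Suc i..N} - f ` {Suc i..p}"
        and y: "y \<in> {Suc i..N} - f ` {Suc i..p}" and "x < y"
      define h where "h z = (if z < ?k then Suc z else z)" for z
      have h: "h z \<in> {Suc ?i..N} - f ` {Suc ?i..p} \<and>
          final_labels (lorenz_tail i p f) id z = b (h z)"
        if z: "z \<in> {Suc i..N} - f ` {Suc i..p}" for z
      proof -
        have "z \<noteq> ?k" using z ins by auto
        then consider "z < ?k" | "?k < z" by linarith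
        then show ?thesis
        proof cases
          case 1
          then show ?thesis using under[of z] z unfolding lab h_def by auto
        next
          case 2
          then show ?thesis using old[OF z] unfolding lab h_def by auto
        qed
      qed
      have "y \<noteq> ?k" using y ins by auto
      then have "h x < h y" using \<open>x < y\<close> by (auto simp: h_def)
      then show "final_labels (lorenz_tail i p f) id x < final_labels (lorenz_tail i p f) id y"
        using h[OF x] h[OF y] strict_mono_onD[OF IH(4)] by metis
    qed
  next
    case 5 
    have "b (Suc x) \<in> {Suc p..N}" if "?i \<le> x" "x < ?k" for x
      using IH(3) under[OF that] by blast
    then show ?case unfolding cro using IH(5) step.hyps by fastforce
  next
    case 6
    have "inj_on (\<lambda>x. (?i, b (Suc x))) {?i..<?k}"
    proof (rule inj_onI)
      fix x y assume "x \<in> {?i..<?k}" "y \<in> {?i..<?k}" "(?i, b (Suc x)) = (?i, b (Suc y))"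
      then show "x = y"
        using inj_onD[OF strict_mono_on_imp_inj_on[OF IH(4)], of "Suc x" "Suc y"]
          under[of x] under[of y] by auto
    qed
    then show ?case unfolding cro using IH(5,6) by (auto simp: distinct_map)
  }
qed

lemma lorenz_word_correct:
  assumes "(N, p, f) \<in> lorenz_data"
  defines "a \<equiv> final_labels (lorenz_word p f) id"
    and "c \<equiv> crossings (lorenz_word p f) id"
  shows "\<forall>i\<in>{1..p}. a (f i) = i"
    "\<forall>x\<in>{1..N} - f ` {1..p}. a x \<in> {p + 1..N}"
    "strict_mono_on ({1..N} - f ` {1..p}) a"
    "set c \<subseteq> {1..p} \<times> {p + 1..N}"
    "distinct c"
  using lorenz_tail_invariant[of p f N 0] assms
  by (auto simp: lorenz_data_def PiE_iff lorenz_tail_def lorenz_word_def)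

end

theory Submission
  imports Defs
begin

text \<open>
  Let \<open>q = r\<^sub>k\<close>.  Take a left strands, each crossing over exactly one right strand, followed by \<open>s\<^sub>i\<close> left
  strands crossing over \<open>r\<^sub>i\<close> right strands for each \<open>i\<close>, and \<open>\<bar>n\<bar> q\<close> left strands crossing over all \<open>q\<close>
  right strands.  Destabilising the left strands one after the other leaves the braid on \<open>q\<close> strands
  \<open>\<Delta>\<^bsup>2n\<^esup>\<close> times the word of the T-link times \<open>(\<sigma>\<^sub>1 \<dots> \<sigma>\<^bsub>q-1\<^esub>)\<^bsup>\<bar>n\<bar>q\<^esup> = \<Delta>\<^bsup>2\<bar>n\<bar>\<^esup>\<close>, whose closure is the T-link.
  The number \<open>a\<close> is arbitrary, since the first strands contribute only empty words.

  On the geometric side, the 3-sphere is \<open>\<complex>\<^sup>2 - {0}\<close> modulo positive scaling, so fibrewise maps of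
  bounded displacement in one of the two solid tori are isotopic to the identity.  In the torus of the braid
  axis this yields isotopy extension for closed braids.  A left destabilisation is a translation depending
  on the angle \<open>arg z\<close> in the complementary solid torus: after a braid isotopy the strand to be removed is
  a graph over this angle and is alone in the sector in which it moves across the axis.
\<close>

section \<open>Isotopies of the 3-sphere\<close>

text \<open>The definition of isotopy asks for homeomorphisms of the whole sphere, so every move has
  to be realised by a global map. Maps fibred over the braid time preserve \<open>w\<close> up to
  scaling and cannot carry a strand across the axis \<open>w = 0\<close>; changing the number of
  strands therefore uses maps fibred over the direction of \<open>z\<close>, under which
  \<open>w\<close> may pass through 0. The braid groups are not constructed: words count as equal if
  their labelled motions are homotopic relative to the end points. The braid relations follow
  because a positive motion in which only strands in their original order cross is determined by its
  permutation. Left strands contribute positive words only, which is why they can compensate a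
  negative twist on the right. A left strand crossing over nothing would close up to a split unknot,
  so one crossing is the least that can be added for free. The increasing order of the numbers r
  serves twice: it makes the map f strictly increasing, and it keeps the letters left behind by
  removed strands small enough to slide under the next strand.\<close>

lemma ambient_isotopic_refl: "ambient_isotopic X A A"
  unfolding ambient_isotopic_def
  by (rule exI[of _ "\<lambda>t x. x"])
    (auto intro!: continuous_intros exI[of _ "\<lambda>x. x"] homeomorphismI simp: case_prod_unfold)

lemma ambient_isotopic_trans [trans]:
  assumes "ambient_isotopic X A B" "ambient_isotopic X B C"
  shows "ambient_isotopic X A C"
proof -
  obtain H where H: "continuous_on ({0..1} \<times> X) (\<lambda>(t, x). H t x)"
      "\<forall>t\<in>{0..1::real}. \<exists>g. homeomorphism X X (H t) g" "\<forall>x\<in>X. H 0 x = x" "H 1 ` A = B"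
    using assms(1) unfolding ambient_isotopic_def by blast
  obtain K where K: "continuous_on ({0..1} \<times> X) (\<lambda>(t, x). K t x)"
      "\<forall>t\<in>{0..1::real}. \<exists>g. homeomorphism X X (K t) g" "\<forall>x\<in>X. K 0 x = x" "K 1 ` B = C"
    using assms(2) unfolding ambient_isotopic_def by blast
  have into: "H t x \<in> X" if "t \<in> {0..1}" "x \<in> X" for t x
    using H(2) that unfolding homeomorphism_def by blast
  show ?thesis
    unfolding ambient_isotopic_def
  proof (intro exI[of _ "\<lambda>t. K t \<circ> H t"] conjI ballI)
    have "continuous_on ({0..1} \<times> X) (\<lambda>p. (\<lambda>(t, x). K t x) (fst p, (\<lambda>(t, x). H t x) p))"
      by (rule continuous_on_compose2[OF K(1)])
        (use into in \<open>auto intro!: continuous_intros H(1)\<close>)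
    then show "continuous_on ({0..1} \<times> X) (\<lambda>(t, x). (K t \<circ> H t) x)"
      by (simp add: case_prod_unfold)
  next
    fix t :: real assume "t \<in> {0..1}"
    then show "\<exists>g. homeomorphism X X (K t \<circ> H t) g"
      using H(2) K(2) homeomorphism_compose by blast
  next
    fix x assume "x \<in> X"
    then show "(K 0 \<circ> H 0) x = x" using H(3) K(3) by simp
  next
    show "(K 1 \<circ> H 1) ` A = C" using H(4) K(4) by (auto simp: image_comp)
  qed
qed

text \<open>The reversed isotopy is \<open>H (1 - t)\<close> preceded by the inverse of the final
  homeomorphism, so that it starts at the identity; \<open>A \<subseteq> X\<close> lets this inverse
  undo \<open>H 1\<close> on \<open>A\<close>.\<close>

lemma ambient_isotopic_sym:
  assumes "ambient_isotopic X A B" "A \<subseteq> X"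
  shows "ambient_isotopic X B A"
proof -
  obtain H where H: "continuous_on ({0..1} \<times> X) (\<lambda>(t, x). H t x)"
      "\<forall>t\<in>{0..1::real}. \<exists>g. homeomorphism X X (H t) g" "\<forall>x\<in>X. H 0 x = x" "H 1 ` A = B"
    using assms(1) unfolding ambient_isotopic_def by blast
  obtain g where g: "homeomorphism X X (H 1) g" using bspec[OF H(2), of 1] by auto
  have into: "g x \<in> X" if "x \<in> X" for x
    using g that unfolding homeomorphism_def by blast
  show ?thesis
    unfolding ambient_isotopic_def
  proof (intro exI[of _ "\<lambda>t. H (1 - t) \<circ> g"] conjI ballI)
    have cg: "continuous_on ({0..1::real} \<times> X) (\<lambda>p. g (snd p))"
      by (rule continuous_on_compose2[OF homeomorphism_cont2[OF g]]) (auto intro!: continuous_intros)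
    have "continuous_on ({0..1} \<times> X) (\<lambda>p. (\<lambda>(t, x). H t x) (1 - fst p, g (snd p)))"
      by (rule continuous_on_compose2[OF H(1)])
        (use into in \<open>auto intro!: continuous_intros cg\<close>)
    then show "continuous_on ({0..1} \<times> X) (\<lambda>(t, x). (H (1 - t) \<circ> g) x)"
      by (simp add: case_prod_unfold)
  next
    fix t :: real assume "t \<in> {0..1}"
    then have "1 - t \<in> {0..1}" by auto
    then show "\<exists>h. homeomorphism X X (H (1 - t) \<circ> g) h"
      using H(2) g homeomorphism_compose homeomorphism_sym by blast
  next
    fix x assume "x \<in> X"
    then show "(H (1 - 0) \<circ> g) x = x" using g by (simp add: homeomorphism_apply2)
  next
    have "H 0 (g (H 1 x)) = x" if "x \<in> A" for x
      using that g assms(2) H(3) by (auto simp: homeomorphism_apply1 subset_iff)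
    then show "(H (1 - 1) \<circ> g) ` B = A" using H(4) by force
  qed
qed

section \<open>Isotopies of the sphere from homogeneous maps of the ambient space\<close>

text \<open>The unit sphere is the set of rays from the origin. A positively homogeneous bijection
  permutes the rays, and normalising its values gives a continuous bijection of the sphere, whose
  inverse is continuous by compactness. Working with rays keeps normalising factors out of the later
  formulas.\<close>

lemma homogeneous_isotopy:
  fixes F :: "real \<Rightarrow> 'a::euclidean_space \<Rightarrow> 'a"
  assumes cont: "continuous_on ({0..1} \<times> (- {0})) (\<lambda>(s, x). F s x)"
    and hom: "\<And>s c x. s \<in> {0..1} \<Longrightarrow> c > 0 \<Longrightarrow> F s (c *\<^sub>R x) = c *\<^sub>R F s x"
    and bij: "\<And>s. s \<in> {0..1} \<Longrightarrow> bij (F s)"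
    and zero: "\<And>s. s \<in> {0..1} \<Longrightarrow> F s 0 = 0"
    and id: "\<And>x. F 0 x = x"
  shows "ambient_isotopic (sphere 0 1) A ((\<lambda>x. sgn (F 1 x)) ` A)"
proof -
  have nz: "F s x \<noteq> 0" if "s \<in> {0..1}" "x \<noteq> 0" for s x
    using bij_is_inj[OF bij[OF that(1)]] zero[OF that(1)] that(2) by (metis injD)
  have nz': "F s x \<noteq> 0" if "s \<in> {0..1}" "norm x = 1" for s x
    using that nz[of s x] by (metis norm_zero zero_neq_one)
  have c: "continuous_on ({0..1} \<times> sphere 0 1) (\<lambda>(s, x). sgn (F s x))"
  proof -
    have "continuous_on ({0..1} \<times> sphere 0 1) (\<lambda>p. sgn ((\<lambda>(s, x). F s x) p))"
      by (intro continuous_intros continuous_on_subset[OF cont]) (use nz' in auto)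
    then show ?thesis by (simp add: case_prod_unfold)
  qed
  have hm: "\<exists>g. homeomorphism (sphere 0 1) (sphere 0 1) (\<lambda>x. sgn (F s x)) g"
    if s: "s \<in> {0..1}" for s
  proof (rule homeomorphism_compact)
    show "compact (sphere (0::'a) 1)" by simp
    have "continuous_on (sphere 0 1) (\<lambda>x. (\<lambda>(s, x). sgn (F s x)) (s, x))"
      by (rule continuous_on_compose2[OF c]) (use s in \<open>auto intro!: continuous_intros\<close>)
    then show "continuous_on (sphere 0 1) (\<lambda>x. sgn (F s x))" by simp
    show "inj_on (\<lambda>x. sgn (F s x)) (sphere 0 1)"
    proof (rule inj_onI)
      fix x y :: 'a assume x: "x \<in> sphere 0 1" and y: "y \<in> sphere 0 1"
        and eq: "sgn (F s x) = sgn (F s y)"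
      \<comment> \<open>Images with equal directions differ by the factor \<open>c\<close>.
        Homogeneity moves it to the argument, injectivity makes \<open>x\<close> the
        \<open>c\<close>-fold of \<open>y\<close>, and unit length forces
        \<open>c = 1\<close>.\<close>
      define c where "c = norm (F s x) / norm (F s y)"
      have "F s x \<noteq> 0" "F s y \<noteq> 0" using nz' s x y by auto
      then have c: "c > 0" and "F s x = c *\<^sub>R F s y"
        using arg_cong[OF eq, of "\<lambda>v. norm (F s x) *\<^sub>R v"]
        by (auto simp: c_def sgn_div_norm divide_inverse)
      then have "F s x = F s (c *\<^sub>R y)" using hom s by simp
      then have "x = c *\<^sub>R y" using bij_is_inj[OF bij[OF s]] by (metis injD)
      then show "x = y" using x y c by auto
    qed
    show "(\<lambda>x. sgn (F s x)) ` sphere 0 1 = sphere 0 1"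
    proof (intro equalityI subsetI)
      fix y :: 'a assume "y \<in> (\<lambda>x. sgn (F s x)) ` sphere 0 1"
      then show "y \<in> sphere 0 1" using nz' s by (auto simp: norm_sgn)
    next
      fix y :: 'a assume y: "y \<in> sphere 0 1"
      obtain x where x: "F s x = y" using bij_is_surj[OF bij[OF s]] by (metis surj_def)
      have x0: "x \<noteq> 0" using x y zero[OF s] by auto
      have "sgn (F s (sgn x)) = y"
        using hom[OF s, of "inverse (norm x)" x] x0 y
        by (simp add: sgn_div_norm[of x] x sgn_scaleR) (simp add: sgn_div_norm)
      moreover have "sgn x \<in> sphere 0 1" using x0 by (simp add: norm_sgn)
      ultimately show "y \<in> (\<lambda>x. sgn (F s x)) ` sphere 0 1" by (metis imageI)
    qed
  qed
  show ?thesis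
    unfolding ambient_isotopic_def
    by (rule exI[of _ "\<lambda>s x. sgn (F s x)"]) (use c hm in \<open>auto simp: id sgn_div_norm\<close>)
qed

text \<open>
  In the coordinates \<open>[z : w]\<close> modulo positive scaling, with \<open>w\<close> normalised to the unit circle, this is
  the fibrewise map \<open>g\<close> conjugated by the dilation by \<open>s\<close>.  If \<open>g\<close> has bounded displacement, then
  the conjugates tend to the identity for \<open>s \<rightarrow> 0\<close> (the Alexander trick).
\<close>

definition fibre_map :: "(complex \<Rightarrow> complex \<Rightarrow> complex) \<Rightarrow> real \<Rightarrow> complex \<times> complex \<Rightarrow> complex \<times> complex" where
  "fibre_map g s = (\<lambda>(z, w). (if s * cmod w = 0 then z
     else of_real (s * cmod w) * g (sgn w) (z / of_real (s * cmod w)), w))"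

lemma fibre_map_scale:
  assumes "c > 0"
  shows "fibre_map g s (c *\<^sub>R x) = c *\<^sub>R fibre_map g s x"
proof -
  have "sgn (complex_of_real c * w) = sgn w" for w
    using assms sgn_scaleR[of c w] by (simp add: scaleR_conv_of_real)
  then show ?thesis
    using assms by (cases x) (auto simp: fibre_map_def scaleR_conv_of_real norm_mult)
qed

lemma fibre_isotopy:
  fixes g :: "complex \<Rightarrow> complex \<Rightarrow> complex"
  assumes cont: "continuous_on (sphere 0 1 \<times> UNIV) (\<lambda>(u, z). g u z)"
    and bij: "\<And>u. u \<in> sphere 0 1 \<Longrightarrow> bij (g u)"
    and bound: "\<And>u z. u \<in> sphere 0 1 \<Longrightarrow> norm (g u z - z) \<le> C"
  shows "ambient_isotopic S3 A ((\<lambda>x. sgn (fibre_map g 1 x)) ` A)"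
  unfolding S3_def
proof (rule homogeneous_isotopy)
  define W where "W = {0..1::real} \<times> (- {0 :: complex \<times> complex})"
  define r :: "real \<times> complex \<times> complex \<Rightarrow> real" where "r p = fst p * cmod (snd (snd p))" for p
  \<comment> \<open>The displacement of the first coordinate. It is bounded by
    \<open>r p * C\<close> and hence tends to 0 where \<open>r p = 0\<close>; this covers both the
    start \<open>s = 0\<close> and the axis \<open>w = 0\<close>, on which \<open>sgn w\<close> is
    not a point of the circle.\<close>
  define D where "D p = (if r p = 0 then 0
      else of_real (r p) * (g (sgn (snd (snd p))) (fst (snd p) / of_real (r p)) - fst (snd p) / of_real (r p)))"
    for p
  have r0: "r p \<ge> 0" if "p \<in> W" for p using that by (auto simp: r_def W_def)
  have contr: "continuous_on S r" for S unfolding r_def by (intro continuous_intros)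
  have Db: "norm (D p) \<le> r p * C" if "p \<in> W" for p
  proof (cases "r p = 0")
    case False
    then have "snd (snd p) \<noteq> 0" by (auto simp: r_def)
    then have "norm (g (sgn (snd (snd p))) (fst (snd p) / of_real (r p)) - fst (snd p) / of_real (r p)) \<le> C"
      by (intro bound) (simp add: norm_sgn)
    then show ?thesis using r0[OF that] False
      by (simp add: D_def norm_mult mult_left_mono)
  qed (simp add: D_def)
  have "continuous_on W D"
    unfolding continuous_on_eq_continuous_within
  proof
    fix p assume p: "p \<in> W"
    show "continuous (at p within W) D"
    proof (cases "r p = 0")
      case True
      have "((\<lambda>p. r p * C) \<longlongrightarrow> r p * C) (at p within W)"
        using contr[of W] p by (intro tendsto_intros) (auto simp: continuous_on_def)
      then have "((\<lambda>p. r p * C) \<longlongrightarrow> 0) (at p within W)" using True by simp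
      then have "(D \<longlongrightarrow> 0) (at p within W)"
        by (rule Lim_null_comparison[rotated]) (use Db in \<open>auto simp: eventually_at_filter\<close>)
      then show ?thesis using True by (simp add: continuous_within D_def)
    next
      case False
      define V where "V = {p. r p \<noteq> 0}"
      have oV: "open V" unfolding V_def
        using contr by (intro open_Collect_neq continuous_intros) auto
      have "continuous_on (V \<inter> W) (\<lambda>p. (\<lambda>(u, z). g u z) (sgn (snd (snd p)), fst (snd p) / of_real (r p)))"
        by (rule continuous_on_compose2[OF cont])
          (auto intro!: continuous_intros contr simp: V_def norm_sgn r_def)
      then have "continuous_on (V \<inter> W) (\<lambda>p. of_real (r p) * (g (sgn (snd (snd p))) (fst (snd p) / of_real (r p)) - fst (snd p) / of_real (r p)))"
        by (intro continuous_intros contr) (auto simp: V_def)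
      then have "continuous_on (V \<inter> W) D"
        by (rule continuous_on_eq) (auto simp: D_def V_def)
      then have "continuous (at p within (V \<inter> W)) D"
        using p False by (auto simp: continuous_on_eq_continuous_within V_def)
      moreover have "at p within (V \<inter> W) = at p within W"
        using oV False by (intro at_within_nhd[of _ V]) (auto simp: V_def)
      ultimately show ?thesis by (simp add: continuous_within)
    qed
  qed
  then have "continuous_on W (\<lambda>p. (fst (snd p) + D p, snd (snd p)))"
    by (intro continuous_intros)
  then show "continuous_on ({0..1} \<times> (- {0})) (\<lambda>(s, x). fibre_map g s x)"
    unfolding W_def[symmetric]
    by (rule continuous_on_eq) (auto simp: D_def r_def fibre_map_def algebra_simps)
next
  show "fibre_map g s (c *\<^sub>R x) = c *\<^sub>R fibre_map g s x" if "c > 0" for s c x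
    using that by (rule fibre_map_scale)
next
  fix s :: real assume "s \<in> {0..1}"
  show "bij (fibre_map g s)"
  proof (rule bijI)
    show "inj (fibre_map g s)"
    proof (rule injI, clarify)
      fix z w z' w' assume "fibre_map g s (z, w) = fibre_map g s (z', w')"
      moreover have "g (sgn w) a = g (sgn w) b \<longleftrightarrow> a = b" if "w \<noteq> 0" for a b
        using bij_is_inj[OF bij[of "sgn w"]] that by (auto simp: norm_sgn inj_eq)
      ultimately show "z = z' \<and> w = w'"
        by (auto simp: fibre_map_def split: if_splits)
    qed
    show "surj (fibre_map g s)"
    proof (unfold surj_def, rule allI)
      fix y show "\<exists>x. y = fibre_map g s x"
      proof (cases "s * cmod (snd y) = 0")
        case True
        then have "y = fibre_map g s y" by (simp add: fibre_map_def case_prod_unfold)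
        then show ?thesis ..
      next
        case False
        define k where "k = complex_of_real (s * cmod (snd y))"
        have "snd y \<noteq> 0" using False by auto
        then obtain a where "g (sgn (snd y)) a = fst y / k"
          using bij_is_surj[OF bij[of "sgn (snd y)"]] by (metis mem_sphere_0 norm_sgn surjD)
        moreover have "k \<noteq> 0" using False by (simp add: k_def)
        ultimately have "y = fibre_map g s (k * a, snd y)"
          using False by (cases y) (simp add: fibre_map_def k_def)
        then show ?thesis ..
      qed
    qed
  qed
next
  show "fibre_map g s 0 = 0" for s by (simp add: fibre_map_def zero_prod_def)
  show "fibre_map g 0 x = x" for x by (cases x) (simp add: fibre_map_def)
qed

text \<open>Conjugating by the swap exchanges the two solid tori, so that fibrewise isotopies over
  the direction of \<open>w\<close> can also be used over the direction of \<open>z\<close>.\<close>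

lemma ambient_isotopic_swap:
  assumes "ambient_isotopic S3 (prod.swap ` A) (prod.swap ` B)"
  shows "ambient_isotopic S3 A B"
proof -
  obtain H where H: "continuous_on ({0..1} \<times> S3) (\<lambda>(t, x). H t x)"
      "\<forall>t\<in>{0..1::real}. \<exists>g. homeomorphism S3 S3 (H t) g" "\<forall>x\<in>S3. H 0 x = x"
      "H 1 ` prod.swap ` A = prod.swap ` B"
    using assms unfolding ambient_isotopic_def by blast
  have sw: "prod.swap x \<in> S3 \<longleftrightarrow> x \<in> S3" for x
    by (cases x) (simp add: S3_def norm_Pair add.commute)
  have sw2: "(b, a) \<in> S3" if "(a, b) \<in> S3" for a b
    using sw[of "(a, b)"] that by simp
  have sc: "continuous_on X prod.swap" for X :: "(complex \<times> complex) set"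
    by (rule continuous_on_swap)
  have hs: "homeomorphism S3 S3 prod.swap prod.swap"
    by (rule homeomorphismI) (use sw sc in auto)
  show ?thesis
    unfolding ambient_isotopic_def
  proof (intro exI[of _ "\<lambda>t. prod.swap \<circ> (H t \<circ> prod.swap)"] conjI ballI)
    have "continuous_on ({0..1} \<times> S3) (\<lambda>p. (\<lambda>(t, x). H t x) (fst p, prod.swap (snd p)))"
      by (rule continuous_on_compose2[OF H(1)])
        (auto intro!: continuous_intros continuous_on_compose2[OF sc] dest: sw2)
    then have "continuous_on ({0..1} \<times> S3) (\<lambda>p. prod.swap (H (fst p) (prod.swap (snd p))))"
      by (intro continuous_on_compose2[OF sc[of UNIV]]) (simp_all add: case_prod_unfold)
    then show "continuous_on ({0..1} \<times> S3) (\<lambda>(t, x). (prod.swap \<circ> (H t \<circ> prod.swap)) x)"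
      by (simp add: case_prod_unfold)
  next
    fix t :: real assume "t \<in> {0..1}"
    then show "\<exists>g. homeomorphism S3 S3 (prod.swap \<circ> (H t \<circ> prod.swap)) g"
      using H(2) hs homeomorphism_compose by blast
  next
    fix x assume "x \<in> S3"
    then show "(prod.swap \<circ> (H 0 \<circ> prod.swap)) x = x" using H(3) by (simp add: sw)
  next
    show "(prod.swap \<circ> (H 1 \<circ> prod.swap)) ` A = B"
      using arg_cong[OF H(4), of "image prod.swap"] by (simp add: image_comp o_assoc)
  qed
qed

section \<open>Closed braids and level-preserving isotopies\<close>

text \<open>\<open>Arg2pi\<close> is continuous on the closed upper half circle. On the lower one it
  is replaced by the continuous function \<open>2 * pi - Arg2pi (cnj u)\<close>, which differs from
  it only at \<open>u = 1\<close>; there the parameter is 1 instead of 0, and \<open>loop\<close>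
  makes the values agree.\<close>

lemma continuous_on_circle:
  fixes f :: "real \<Rightarrow> 'a::topological_space \<Rightarrow> 'b::topological_space"
  assumes cont: "continuous_on ({0..1} \<times> UNIV) (\<lambda>(t, x). f t x)" and loop: "f 1 = f 0"
  shows "continuous_on (sphere 0 1 \<times> UNIV) (\<lambda>(u, x). f (Arg2pi u / (2 * pi)) x)"
proof -
  define U where "U = {u \<in> sphere 0 1. Im u \<ge> 0} \<times> (UNIV :: 'a set)"
  define L where "L = {u \<in> sphere 0 1. Im u \<le> 0} \<times> (UNIV :: 'a set)"
  have UL: "sphere 0 1 \<times> UNIV = U \<union> L" by (auto simp: U_def L_def)
  have "closed {u \<in> sphere 0 1. Im u \<ge> 0}" "closed {u \<in> sphere 0 1. Im u \<le> 0}"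
    using closed_Int[OF closed_sphere closed_halfspace_Im_ge, of 0 1 0]
      closed_Int[OF closed_sphere closed_halfspace_Im_le, of 0 1 0]
    by (simp_all add: Int_def)
  then have "closed U" "closed L" by (auto simp: U_def L_def intro!: closed_Times)
  have arg: "0 \<le> Arg2pi u / (2 * pi)" "Arg2pi u / (2 * pi) \<le> 1" for u
    using Arg2pi_ge_0[of u] Arg2pi_lt_2pi[of u] by (simp_all add: divide_simps less_imp_le)
  have cU: "continuous_on U (\<lambda>(u, x). f (Arg2pi u / (2 * pi)) x)"
  proof -
    have "continuous_on U (\<lambda>p. Arg2pi (fst p))"
      by (rule continuous_on_compose2[OF continuous_on_upperhalf_Arg2pi])
        (auto simp: U_def intro!: continuous_intros)
    then have "continuous_on U (\<lambda>p. (\<lambda>(t, x). f t x) (Arg2pi (fst p) / (2 * pi), snd p))"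
      by (intro continuous_on_compose2[OF cont] continuous_intros) (auto simp: arg)
    then show ?thesis by (simp add: case_prod_unfold)
  qed
  have cL: "continuous_on L (\<lambda>(u, x). f (Arg2pi u / (2 * pi)) x)"
  proof -
    have "continuous_on L (\<lambda>p. Arg2pi (cnj (fst p)))"
      by (rule continuous_on_compose2[OF continuous_on_upperhalf_Arg2pi])
        (auto simp: L_def intro!: continuous_intros)
    then have "continuous_on L (\<lambda>p. (\<lambda>(t, x). f t x) (1 - Arg2pi (cnj (fst p)) / (2 * pi), snd p))"
      by (intro continuous_on_compose2[OF cont] continuous_intros) (auto simp: arg)
    moreover have "f (1 - Arg2pi (cnj u) / (2 * pi)) x = f (Arg2pi u / (2 * pi)) x"
      if "u \<in> sphere 0 1" for u x
    proof (cases "u \<in> \<real>")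
      case True
      then obtain a where "u = of_real a" by (auto elim: Reals_cases)
      then have "u = 1 \<or> u = -1" using that by (auto simp: abs_if split: if_splits)
      moreover have "Arg2pi (-1) = pi" "Arg2pi 1 = 0"
        using Arg2pi_of_real[of "-1"] Arg2pi_of_real[of 1] by simp_all
      ultimately show ?thesis using loop by auto
    next
      case False
      then show ?thesis by (simp add: Arg2pi_cnj field_simps)
    qed
    ultimately show ?thesis
      by (elim continuous_on_eq) (auto simp: L_def case_prod_unfold)
  qed
  show ?thesis unfolding UL
    by (rule continuous_on_closed_Un) (use \<open>closed U\<close> \<open>closed L\<close> cU cL in auto)
qed

text \<open>Arbitrary slices are allowed, because the isotopies pass through closed braids that do
  not come from a word.\<close>

definition slice_closure :: "(real \<Rightarrow> complex set) \<Rightarrow> (complex \<times> complex) set" where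
  "slice_closure P = {solid_torus_to_S3 z t | z t. 0 \<le> t \<and> t < 1 \<and> z \<in> P t}"

lemma solid_torus_to_S3_sgn: "solid_torus_to_S3 z t = sgn (z, cis (2 * pi * t))"
  by (simp add: solid_torus_to_S3_def sgn_div_norm norm_Pair add.commute)

lemma slice_closure_cong:
  "(\<And>t. 0 \<le> t \<Longrightarrow> t < 1 \<Longrightarrow> P t = Q t) \<Longrightarrow> slice_closure P = slice_closure Q"
  by (auto simp: slice_closure_def)

lemma braid_closure_eq: "braid_closure m w = slice_closure (braid_slice m w)"
  by (simp add: braid_closure_def slice_closure_def)

lemma sgn_fibre_map_sgn: "sgn (fibre_map g s (sgn x)) = sgn (fibre_map g s x)" if "x \<noteq> 0"
proof -
  have "fibre_map g s (sgn x) = inverse (norm x) *\<^sub>R fibre_map g s x"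
    unfolding sgn_div_norm[of x] using that by (intro fibre_map_scale) simp
  then show ?thesis using that by (simp add: sgn_scaleR)
qed

lemma Arg2pi_cis: "0 \<le> a \<Longrightarrow> a < 2 * pi \<Longrightarrow> Arg2pi (cis a) = a"
  by (rule Arg2pi_unique[of 1]) (auto simp: cis_conv_exp)

text \<open>The dilation conjugates in \<open>fibre_map\<close> supply the isotopy to the identity,
  so only the final homeomorphism of each level has to be given. The condition \<open>loop\<close>
  makes these fit together around the circle of levels.\<close>

lemma level_isotopy:
  fixes g :: "real \<Rightarrow> complex \<Rightarrow> complex"
  assumes cont: "continuous_on ({0..1} \<times> UNIV) (\<lambda>(t, z). g t z)" and loop: "g 1 = g 0"
    and bij: "\<And>t. t \<in> {0..1} \<Longrightarrow> bij (g t)"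
    and bound: "\<And>t z. t \<in> {0..1} \<Longrightarrow> norm (g t z - z) \<le> C"
  shows "ambient_isotopic S3 (slice_closure P) (slice_closure (\<lambda>t. g t ` P t))"
proof -
  define h where "h u = g (Arg2pi u / (2 * pi))" for u
  have arg: "Arg2pi u / (2 * pi) \<in> {0..1}" for u
    using Arg2pi_ge_0[of u] Arg2pi_lt_2pi[of u] by (simp_all add: divide_simps less_imp_le)
  have "ambient_isotopic S3 (slice_closure P) ((\<lambda>x. sgn (fibre_map h 1 x)) ` slice_closure P)"
    using continuous_on_circle[OF cont loop] bij[OF arg] bound[OF arg]
    by (intro fibre_isotopy[of h C]) (auto simp: h_def)
  also have "(\<lambda>x. sgn (fibre_map h 1 x)) ` slice_closure P = slice_closure (\<lambda>t. g t ` P t)"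
  proof -
    have step: "sgn (fibre_map h 1 (solid_torus_to_S3 z t)) = solid_torus_to_S3 (g t z) t"
      if "0 \<le> t" "t < 1" for z t
    proof -
      have "(z, cis (2 * pi * t)) \<noteq> 0" by (simp add: zero_prod_def)
      then have "sgn (fibre_map h 1 (solid_torus_to_S3 z t)) = sgn (fibre_map h 1 (z, cis (2 * pi * t)))"
        by (simp add: solid_torus_to_S3_sgn sgn_fibre_map_sgn)
      also have "fibre_map h 1 (z, cis (2 * pi * t)) = (g t z, cis (2 * pi * t))"
        using that by (simp add: fibre_map_def h_def Arg2pi_cis sgn_div_norm)
      finally show ?thesis by (simp add: solid_torus_to_S3_sgn)
    qed
    show ?thesis unfolding slice_closure_def
    proof (intro equalityI subsetI)
      fix x assume "x \<in> {solid_torus_to_S3 z t | z t. 0 \<le> t \<and> t < 1 \<and> z \<in> g t ` P t}"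
      then obtain z t where "x = solid_torus_to_S3 (g t z) t" "0 \<le> t" "t < 1" "z \<in> P t"
        by auto
      then show "x \<in> (\<lambda>x. sgn (fibre_map h 1 x)) ` {solid_torus_to_S3 z t | z t. 0 \<le> t \<and> t < 1 \<and> z \<in> P t}"
        using step[of t z] by (intro image_eqI[of _ _ "solid_torus_to_S3 z t"]) auto
    next
      fix x assume "x \<in> (\<lambda>x. sgn (fibre_map h 1 x)) ` {solid_torus_to_S3 z t | z t. 0 \<le> t \<and> t < 1 \<and> z \<in> P t}"
      then obtain z t where "x = solid_torus_to_S3 (g t z) t" "0 \<le> t" "t < 1" "z \<in> P t"
        using step by auto
      then show "x \<in> {solid_torus_to_S3 z t | z t. 0 \<le> t \<and> t < 1 \<and> z \<in> g t ` P t}" by blast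
    qed
  qed
  finally show ?thesis .
qed

section \<open>Isotopy extension by small pushes\<close>

text \<open>A preimage of \<open>y\<close> is a fixed point of the contraction sending
  \<open>x\<close> to \<open>y - v x\<close>.\<close>

lemma bij_add_contraction:
  fixes v :: "'a::banach \<Rightarrow> 'a"
  assumes "\<And>x y. norm (v x - v y) \<le> norm (x - y) / 2"
  shows "bij (\<lambda>x. x + v x)"
proof (rule bijI)
  show "inj (\<lambda>x. x + v x)"
  proof (rule injI)
    fix x y assume "x + v x = y + v y"
    then have "x - y = v y - v x" by (simp add: algebra_simps)
    then have "norm (x - y) \<le> norm (x - y) / 2" using assms[of y x] by (simp add: norm_minus_commute)
    then show "x = y" by simp
  qed
  show "surj (\<lambda>x. x + v x)"
  proof (unfold surj_def, rule allI)
    fix y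
    have "\<exists>!x. y - v x = x"
    proof (rule banach_fix_type[where c = "1/2"])
      show "\<forall>x z. dist (y - v x) (y - v z) \<le> 1/2 * dist x z"
        using assms by (simp add: dist_norm norm_minus_commute)
    qed auto
    then show "\<exists>x. y = x + v x" by (metis add.commute diff_add_cancel)
  qed
qed

text \<open>Each strand carries a tent function of radius \<open>d\<close> that transports its own
  displacement. The strands are at least \<open>d\<close> apart, so the tents of the others vanish
  at \<open>a t j\<close>, which is therefore moved exactly to \<open>b t j\<close>. The sum of the
  tents has Lipschitz constant at most \<open>card J * e / d\<close>, and the bound on
  \<open>e\<close> makes this at most 1/2.\<close>

lemma small_push:
  fixes a b :: "real \<Rightarrow> 'j \<Rightarrow> complex"
  assumes J: "finite J" and d: "d > 0"
    and ca: "\<And>j. j \<in> J \<Longrightarrow> continuous_on {0..1} (\<lambda>t. a t j)"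
    and cb: "\<And>j. j \<in> J \<Longrightarrow> continuous_on {0..1} (\<lambda>t. b t j)"
    and sep: "\<And>t i j. t \<in> {0..1} \<Longrightarrow> i \<in> J \<Longrightarrow> j \<in> J \<Longrightarrow> i \<noteq> j \<Longrightarrow> d \<le> norm (a t i - a t j)"
    and near: "\<And>t j. t \<in> {0..1} \<Longrightarrow> j \<in> J \<Longrightarrow> norm (b t j - a t j) \<le> e"
    and e: "real (card J) * e \<le> d / 2"
    and \<pi>: "bij_betw \<pi> J J" "\<And>j. j \<in> J \<Longrightarrow> a 1 j = a 0 (\<pi> j)" "\<And>j. j \<in> J \<Longrightarrow> b 1 j = b 0 (\<pi> j)"
  shows "ambient_isotopic S3 (slice_closure (\<lambda>t. a t ` J)) (slice_closure (\<lambda>t. b t ` J))"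
proof -
  define \<phi> where "\<phi> r = max 0 (1 - r / d)" for r :: real
  define v where "v t z = (\<Sum>j\<in>J. of_real (\<phi> (norm (z - a t j))) * (b t j - a t j))" for t z
  have \<phi>1: "0 \<le> \<phi> r" "r \<ge> 0 \<Longrightarrow> \<phi> r \<le> 1" for r using d by (auto simp: \<phi>_def)
  have \<phi>l: "\<bar>\<phi> r - \<phi> r'\<bar> \<le> \<bar>r - r'\<bar> / d" for r r'
  proof -
    have "\<bar>\<phi> r - \<phi> r'\<bar> \<le> \<bar>r / d - r' / d\<bar>" by (auto simp: \<phi>_def)
    then show ?thesis using d by (simp add: diff_divide_distrib[symmetric])
  qed
  have lip: "norm (v t x - v t y) \<le> norm (x - y) / 2" if t: "t \<in> {0..1}" for t x y
  proof -
    have "norm (v t x - v t y) = norm (\<Sum>j\<in>J. of_real (\<phi> (norm (x - a t j)) - \<phi> (norm (y - a t j))) * (b t j - a t j))"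
      by (simp add: v_def sum_subtractf[symmetric] algebra_simps)
    also have "\<dots> \<le> (\<Sum>j\<in>J. (norm (x - y) / d) * e)"
    proof (rule sum_norm_le)
      fix j assume j: "j \<in> J"
      have "\<bar>\<phi> (norm (x - a t j)) - \<phi> (norm (y - a t j))\<bar> \<le> \<bar>norm (x - a t j) - norm (y - a t j)\<bar> / d"
        by (rule \<phi>l)
      also have "\<dots> \<le> norm (x - y) / d"
        using norm_triangle_ineq3[of "x - a t j" "y - a t j"] d by (simp add: divide_right_mono)
      finally show "norm (of_real (\<phi> (norm (x - a t j)) - \<phi> (norm (y - a t j))) * (b t j - a t j)) \<le> (norm (x - y) / d) * e"
        unfolding norm_mult norm_of_real using near[OF t j] d by (intro mult_mono) auto
    qed
    also have "\<dots> = (norm (x - y) / d) * (real (card J) * e)" by simp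
    also have "\<dots> \<le> (norm (x - y) / d) * (d / 2)" using e d by (intro mult_left_mono) auto
    finally show ?thesis using d by simp
  qed
  have img: "a t j + v t (a t j) = b t j" if t: "t \<in> {0..1}" and j: "j \<in> J" for t j
  proof -
    have "v t (a t j) = (\<Sum>i\<in>J. if i = j then b t j - a t j else 0)"
      unfolding v_def
    proof (rule sum.cong)
      fix i assume "i \<in> J"
      then show "of_real (\<phi> (norm (a t j - a t i))) * (b t i - a t i) = (if i = j then b t j - a t j else 0)"
        using sep[OF t j, of i] d by (auto simp: \<phi>_def)
    qed simp
    then show ?thesis using J j by simp
  qed
  have "ambient_isotopic S3 (slice_closure (\<lambda>t. a t ` J)) (slice_closure (\<lambda>t. (\<lambda>z. z + v t z) ` a t ` J))"
  proof (rule level_isotopy[where C = "real (card J) * e"])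
    have "continuous_on ({0..1} \<times> UNIV) (\<lambda>p. a (fst p) j)" "continuous_on ({0..1} \<times> UNIV) (\<lambda>p. b (fst p) j)"
      if "j \<in> J" for j
      by (rule continuous_on_compose2[OF ca[OF that]] continuous_on_compose2[OF cb[OF that]];
          auto intro!: continuous_intros)+
    then have "continuous_on ({0..1} \<times> UNIV) (\<lambda>p. snd p + v (fst p) (snd p))"
      unfolding v_def \<phi>_def using d by (intro continuous_intros) auto
    then show "continuous_on ({0..1} \<times> UNIV) (\<lambda>(t, z). z + v t z)"
      by (simp add: case_prod_unfold)
    \<comment> \<open>The strands close up with the permutation \<open>\<pi>\<close>, so the
      summands at time 1 are those at time 0 in another order.\<close>
    show "(\<lambda>z. z + v 1 z) = (\<lambda>z. z + v 0 z)"
    proof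
      fix z
      have "v 1 z = (\<Sum>j\<in>J. of_real (\<phi> (norm (z - a 0 (\<pi> j)))) * (b 0 (\<pi> j) - a 0 (\<pi> j)))"
        unfolding v_def by (rule sum.cong) (auto simp: \<pi>)
      also have "\<dots> = v 0 z"
        unfolding v_def by (rule sum.reindex_bij_betw[OF \<pi>(1)])
      finally show "z + v 1 z = z + v 0 z" by simp
    qed
    show "bij (\<lambda>z. z + v t z)" if "t \<in> {0..1}" for t
      by (rule bij_add_contraction) (rule lip[OF that])
    show "norm (z + v t z - z) \<le> real (card J) * e" if t: "t \<in> {0..1}" for t z
    proof -
      have "norm (v t z) \<le> (\<Sum>j\<in>J. 1 * e)"
        unfolding v_def
      proof (rule sum_norm_le)
        fix j assume "j \<in> J"
        then show "norm (of_real (\<phi> (norm (z - a t j))) * (b t j - a t j)) \<le> 1 * e"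
          unfolding norm_mult norm_of_real using near[OF t] \<phi>1 by (intro mult_mono) auto
      qed
      then show ?thesis by simp
    qed
  qed
  also have "slice_closure (\<lambda>t. (\<lambda>z. z + v t z) ` a t ` J) = slice_closure (\<lambda>t. b t ` J)"
    by (rule slice_closure_cong) (auto simp: image_image img cong: image_cong)
  finally show ?thesis .
qed

lemma finite_uniform_bound:
  fixes P :: "'i \<Rightarrow> real \<Rightarrow> bool"
  assumes "finite I" "\<And>i. i \<in> I \<Longrightarrow> \<exists>d>0. P i d" "\<And>i d d'. P i d \<Longrightarrow> 0 < d' \<Longrightarrow> d' \<le> d \<Longrightarrow> P i d'"
  shows "\<exists>d>0. \<forall>i\<in>I. P i d"
  using assms(1,2)
proof (induction I rule: finite_induct)
  case empty
  then show ?case using zero_less_one by blast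
next
  case (insert i I)
  then obtain d where "d > 0" "\<forall>i\<in>I. P i d" by auto
  moreover obtain e where "e > 0" "P i e" using insert.prems by auto
  ultimately have "min d e > 0 \<and> (\<forall>j\<in>insert i I. P j (min d e))"
    using assms(3) by (metis insert_iff min.cobounded1 min.cobounded2 min_less_iff_conj)
  then show ?case by blast
qed

text \<open>By compactness the strands have a uniform distance \<open>d\<close> throughout the
  family and move uniformly continuously. Finitely many equal steps in \<open>s\<close> are then so
  short that each of them is a small push.\<close>

lemma braid_isotopy:
  fixes K :: "real \<Rightarrow> real \<Rightarrow> 'j \<Rightarrow> complex"
  assumes J: "finite J"
    and cont: "\<And>j. j \<in> J \<Longrightarrow> continuous_on ({0..1} \<times> {0..1}) (\<lambda>(s, t). K s t j)"
    and inj: "\<And>s t. s \<in> {0..1} \<Longrightarrow> t \<in> {0..1} \<Longrightarrow> inj_on (K s t) J"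
    and \<pi>: "bij_betw \<pi> J J" "\<And>s j. s \<in> {0..1} \<Longrightarrow> j \<in> J \<Longrightarrow> K s 1 j = K s 0 (\<pi> j)"
  shows "ambient_isotopic S3 (slice_closure (\<lambda>t. K 0 t ` J)) (slice_closure (\<lambda>t. K 1 t ` J))"
proof -
  define Q where "Q = {0..1::real} \<times> {0..1::real}"
  have Q: "compact Q" "Q \<noteq> {}" unfolding Q_def by (auto intro: compact_Times)
  have cQ: "continuous_on Q (\<lambda>p. K (fst p) (snd p) j)" if "j \<in> J" for j
    using cont[OF that] by (simp add: Q_def case_prod_unfold)
  define I where "I = {(i, j). i \<in> J \<and> j \<in> J \<and> i \<noteq> j}"
  have "finite I" by (rule finite_subset[of _ "J \<times> J"]) (auto simp: I_def J)
  have "\<exists>d>0. \<forall>x\<in>I. \<forall>p\<in>Q. d \<le> norm (K (fst p) (snd p) (fst x) - K (fst p) (snd p) (snd x))"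
  proof (rule finite_uniform_bound[OF \<open>finite I\<close>])
    fix x assume "x \<in> I"
    then have x: "fst x \<in> J" "snd x \<in> J" "fst x \<noteq> snd x" by (auto simp: I_def)
    let ?h = "\<lambda>p. norm (K (fst p) (snd p) (fst x) - K (fst p) (snd p) (snd x))"
    have "continuous_on Q ?h" by (intro continuous_intros cQ x)
    then obtain q where q: "q \<in> Q" "\<forall>p\<in>Q. ?h q \<le> ?h p"
      using continuous_attains_inf[OF Q] by blast
    have "?h q > 0"
      using inj[of "fst q" "snd q"] q(1) x by (auto simp: Q_def inj_on_def)
    then show "\<exists>d>0. \<forall>p\<in>Q. d \<le> ?h p" using q(2) by blast
  qed force
  then obtain d where d: "d > 0"
    and sep: "\<And>i j s t. i \<in> J \<Longrightarrow> j \<in> J \<Longrightarrow> i \<noteq> j \<Longrightarrow> s \<in> {0..1} \<Longrightarrow> t \<in> {0..1} \<Longrightarrow> d \<le> norm (K s t i - K s t j)"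
    unfolding I_def Q_def by force
  \<comment> \<open>The added 1 keeps \<open>e\<close> positive also for empty
    \<open>J\<close>.\<close>
  define e where "e = d / (2 * (real (card J) + 1))"
  have e: "e > 0" "real (card J) * e \<le> d / 2" using d by (auto simp: e_def field_simps)
  have "\<exists>\<eta>>0. \<forall>j\<in>J. \<forall>p\<in>Q. \<forall>q\<in>Q. dist q p < \<eta> \<longrightarrow> dist (K (fst q) (snd q) j) (K (fst p) (snd p) j) < e"
  proof (rule finite_uniform_bound[OF J])
    fix j assume "j \<in> J"
    then have "uniformly_continuous_on Q (\<lambda>p. K (fst p) (snd p) j)"
      by (intro compact_uniformly_continuous cQ Q)
    then show "\<exists>\<eta>>0. \<forall>p\<in>Q. \<forall>q\<in>Q. dist q p < \<eta> \<longrightarrow> dist (K (fst q) (snd q) j) (K (fst p) (snd p) j) < e"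
      using e(1) unfolding uniformly_continuous_on_def by blast
  qed force
  then obtain \<eta> where \<eta>: "\<eta> > 0"
    and near: "\<And>j p q. j \<in> J \<Longrightarrow> p \<in> Q \<Longrightarrow> q \<in> Q \<Longrightarrow> dist q p < \<eta> \<Longrightarrow> dist (K (fst q) (snd q) j) (K (fst p) (snd p) j) < e"
    by blast
  obtain n where n: "n > 0" "1 / real n < \<eta>"
    using \<eta> by (metis gr0I inverse_eq_divide reals_Archimedean of_nat_Suc zero_less_Suc)
  have ct: "continuous_on {0..1} (\<lambda>t. K s t j)" if "j \<in> J" "s \<in> {0..1}" for s j
  proof -
    have "continuous_on {0..1} (\<lambda>t. (\<lambda>(s, t). K s t j) (s, t))"
      by (rule continuous_on_compose2[OF cont[OF that(1)]]) (use that(2) in \<open>auto intro!: continuous_intros\<close>)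
    then show ?thesis by simp
  qed
  have "ambient_isotopic S3 (slice_closure (\<lambda>t. K 0 t ` J)) (slice_closure (\<lambda>t. K (real k / real n) t ` J))"
    if "k \<le> n" for k
    using that
  proof (induction k)
    case 0
    then show ?case by (simp add: ambient_isotopic_refl)
  next
    case (Suc k)
    let ?s = "real k / real n" and ?s' = "real (Suc k) / real n"
    have s: "?s \<in> {0..1}" "?s' \<in> {0..1}" using Suc.prems n by (auto simp: divide_simps)
    have "\<bar>?s' - ?s\<bar> < \<eta>" using n by (simp add: diff_divide_distrib[symmetric])
    then have "dist (?s', t) (?s, t) < \<eta>" for t :: real by (simp add: dist_Pair_Pair dist_real_def)
    then have "norm (K ?s' t j - K ?s t j) \<le> e" if "t \<in> {0..1}" "j \<in> J" for t j
      using near[OF that(2), of "(?s, t)" "(?s', t)"] s that(1)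
      by (simp add: Q_def dist_norm less_imp_le)
    then have "ambient_isotopic S3 (slice_closure (\<lambda>t. K ?s t ` J)) (slice_closure (\<lambda>t. K ?s' t ` J))"
      using s by (intro small_push[OF J d _ _ _ _ e(2) \<pi>(1)] ct sep \<pi>(2)) auto
    then show ?case using Suc ambient_isotopic_trans by (meson Suc_leD)
  qed
  from this[of n] n show ?thesis by simp
qed

lemma slice_closure_translate:
  "ambient_isotopic S3 (slice_closure P) (slice_closure (\<lambda>t. (\<lambda>z. z + c) ` P t))"
  by (rule level_isotopy[where C = "norm c"])
    (auto intro!: continuous_intros bij_plus_right simp: case_prod_unfold)

section \<open>Braid words and homotopies of configurations\<close>

declare One_nat_def [simp del]

text \<open>Points are labelled by their strands, so the end point of a path records the permutation
  of the braid. The topology is the product topology on all functions; only the labels in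
  \<open>J\<close> have to be separated.\<close>

definition conf :: "nat set \<Rightarrow> (nat \<Rightarrow> complex) set" where
  "conf J = {c. inj_on c J}"

lemma continuous_on_relabel: "continuous_on S (\<lambda>c :: nat \<Rightarrow> complex. c \<circ> \<sigma>)"
proof (rule continuous_on_coordinatewise_then_product)
  show "continuous_on S (\<lambda>c :: nat \<Rightarrow> complex. (c \<circ> \<sigma>) j)" for j
    using continuous_on_product_then_coordinatewise[OF continuous_on_id[of S], of "\<sigma> j"] by simp
qed

lemma conf_relabel: "c \<in> conf J \<Longrightarrow> bij_betw \<sigma> J J \<Longrightarrow> c \<circ> \<sigma> \<in> conf J"
  unfolding conf_def bij_betw_def by (auto intro: comp_inj_on)

lemma homotopic_paths_relabel:
  assumes "homotopic_paths (conf J) p q" "bij_betw \<sigma> J J"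
  shows "homotopic_paths (conf J) (\<lambda>t. p t \<circ> \<sigma>) (\<lambda>t. q t \<circ> \<sigma>)"
  using homotopic_paths_continuous_image[OF assms(1) continuous_on_relabel[of _ \<sigma>], of "conf J"]
    conf_relabel[OF _ assms(2)]
  by (auto simp: o_def)

text \<open>A homotopy of paths fixes both end points, so all its stages close up with the same
  permutation \<open>\<pi>\<close> and form an isotopy of closed braids.\<close>

lemma homotopic_closure:
  assumes hom: "homotopic_paths (conf J) p q" and J: "finite J"
    and \<pi>: "bij_betw \<pi> J J" "\<And>j. j \<in> J \<Longrightarrow> p 1 j = p 0 (\<pi> j)"
  shows "ambient_isotopic S3 (slice_closure (\<lambda>t. p t ` J)) (slice_closure (\<lambda>t. q t ` J))"
proof -
  obtain h where h: "continuous_on ({0..1} \<times> {0..1}) h" "h \<in> ({0..1} \<times> {0..1}) \<rightarrow> conf J"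
    "\<forall>x \<in> {0..1}. h (0, x) = p x" "\<forall>x \<in> {0..1}. h (1, x) = q x"
    "\<forall>t \<in> {0..1::real}. pathstart (h \<circ> Pair t) = pathstart p \<and> pathfinish (h \<circ> Pair t) = pathfinish p"
    using hom unfolding homotopic_paths by blast
  have "ambient_isotopic S3 (slice_closure (\<lambda>t. h (0, t) ` J)) (slice_closure (\<lambda>t. h (1, t) ` J))"
  proof (rule braid_isotopy[OF J _ _ \<pi>(1)])
    show "continuous_on ({0..1} \<times> {0..1}) (\<lambda>(s, t). h (s, t) j)" for j
      using continuous_on_product_then_coordinatewise[OF h(1), of j] by (simp add: case_prod_unfold)
    show "inj_on (h (s, t)) J" if "s \<in> {0..1}" "t \<in> {0..1}" for s t
      using h(2) that by (auto simp: conf_def)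
    show "h (s, 1) j = h (s, 0) (\<pi> j)" if "s \<in> {0..1}" "j \<in> J" for s j
      using h(5) that \<pi>(2) by (auto simp: pathstart_def pathfinish_def)
  qed
  moreover have "slice_closure (\<lambda>t. h (0, t) ` J) = slice_closure (\<lambda>t. p t ` J)"
    "slice_closure (\<lambda>t. h (1, t) ` J) = slice_closure (\<lambda>t. q t ` J)"
    using h(3,4) by (auto intro!: slice_closure_cong)
  ultimately show ?thesis by simp
qed

section \<open>Motions described by braid words\<close>

fun gen_path :: "artin_gen \<Rightarrow> real \<Rightarrow> nat \<Rightarrow> complex" where
  "gen_path (Sigma i) s x =
     (if x = i then of_nat i + 1/2 - cis (- (pi * s)) / 2
      else if x = Suc i then of_nat i + 1/2 + cis (- (pi * s)) / 2 else of_nat x)"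
| "gen_path (SigmaInv i) s x =
     (if x = i then of_nat i + 1/2 - cis (pi * s) / 2
      else if x = Suc i then of_nat i + 1/2 + cis (pi * s) / 2 else of_nat x)"

definition gen_swap :: "artin_gen \<Rightarrow> nat \<Rightarrow> nat" where
  "gen_swap g x = (if x = gen_index g then Suc (gen_index g) else if x = Suc (gen_index g) then gen_index g else x)"

definition valid :: "nat \<Rightarrow> braid_word \<Rightarrow> bool" where
  "valid m w \<longleftrightarrow> (\<forall>g\<in>set w. 1 \<le> gen_index g \<and> gen_index g < m)"

lemma valid_simps [simp]:
  "valid m []" "valid m (g # w) \<longleftrightarrow> 1 \<le> gen_index g \<and> gen_index g < m \<and> valid m w"
  "valid m (v @ w) \<longleftrightarrow> valid m v \<and> valid m w"
  by (auto simp: valid_def)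

text \<open>Strands are named by their initial positions. After the letter \<open>g\<close> the
  strand \<open>x\<close> is in position \<open>gen_swap g x\<close> and follows the rest of the
  word from there, whence the precomposition. Each letter takes half of the remaining time;
  \<open>braid_slice\<close> uses equal parts instead, which changes the closure only by a
  reparametrisation.\<close>

fun word_path :: "braid_word \<Rightarrow> real \<Rightarrow> nat \<Rightarrow> complex" where
  "word_path [] = (\<lambda>t. of_nat)"
| "word_path (g # w) = gen_path g +++ (\<lambda>t. word_path w t \<circ> gen_swap g)"

fun word_perm :: "braid_word \<Rightarrow> nat \<Rightarrow> nat" where
  "word_perm [] = id"
| "word_perm (g # w) = word_perm w \<circ> gen_swap g"

lemma gen_swap_bij:
  assumes "1 \<le> gen_index g" "gen_index g < m"
  shows "bij_betw (gen_swap g) {1..m} {1..m}"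
  using assms by (intro bij_betw_byWitness[where f' = "gen_swap g"]) (auto simp: gen_swap_def)

lemma word_perm_bij: "valid m w \<Longrightarrow> bij_betw (word_perm w) {1..m} {1..m}"
  by (induction w) (auto intro: bij_betw_trans gen_swap_bij)

lemma gen_path_0: "gen_path g 0 = of_nat"
  by (cases g) (auto simp: fun_eq_iff)

lemma gen_path_1: "gen_path g 1 = of_nat \<circ> gen_swap g"
  by (cases g) (auto simp: fun_eq_iff gen_swap_def cis.ctr complex_eq_iff)

lemma continuous_on_gen_path: "continuous_on S (gen_path g)"
proof (rule continuous_on_coordinatewise_then_product)
  have c: "continuous_on S (\<lambda>s. cis (f s))" if "continuous_on S f" for f :: "real \<Rightarrow> real"
    using that by (simp add: cis_conv_exp continuous_intros)
  show "continuous_on S (\<lambda>s. gen_path g s x)" for x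
    by (cases g; cases "x = gen_index g"; cases "x = Suc (gen_index g)") (auto intro!: continuous_intros c)
qed

lemma gen_path_conf: "gen_path g s \<in> conf J"
proof -
  define i where "i = gen_index g"
  define a where "a = (case g of Sigma _ \<Rightarrow> cis (- (pi * s)) | SigmaInv _ \<Rightarrow> cis (pi * s))"
  have g: "gen_path g s x = (if x = i then of_nat i + 1/2 - a / 2
      else if x = Suc i then of_nat i + 1/2 + a / 2 else of_nat x)" for x
    by (cases g) (auto simp: i_def a_def)
  have a: "norm a = 1" by (cases g) (auto simp: a_def)
  \<comment> \<open>The moving points stay on the circle with centre i + 1/2 and radius 1/2, whose
    only integer points are i and i + 1.\<close>
  have far: "of_nat x \<noteq> of_nat i + 1/2 + b / 2" if "x \<noteq> i" "x \<noteq> Suc i" "norm b = 1" for x and b :: complex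
  proof
    assume "of_nat x = of_nat i + 1/2 + b / 2"
    then have "b = of_real (2 * real x - 2 * real i - 1)" by (simp add: field_simps)
    then have "\<bar>2 * real x - 2 * real i - 1\<bar> = 1" using that(3) by (metis norm_of_real)
    then show False using that by (auto simp: abs_if split: if_splits)
  qed
  have far': "of_nat x \<noteq> of_nat i + 1/2 - b / 2" if "x \<noteq> i" "x \<noteq> Suc i" "norm b = 1" for x and b :: complex
    using far[of x "- b"] that by simp
  have "a \<noteq> 0" using a by auto
  then have "inj (gen_path g s)"
    unfolding inj_def g using far[OF _ _ a] far'[OF _ _ a] far[OF _ _ a, symmetric] far'[OF _ _ a, symmetric]
    by (auto simp: eq_neg_iff_add_eq_0)
  then show ?thesis by (auto simp: conf_def intro: inj_on_subset)
qed

lemma of_nat_conf: "of_nat \<in> conf J"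
  by (auto simp: conf_def inj_on_def)

lemma word_path:
  assumes "valid m w"
  shows "path (word_path w)" "path_image (word_path w) \<subseteq> conf {1..m}"
    "pathstart (word_path w) = of_nat" "pathfinish (word_path w) = of_nat \<circ> word_perm w"
proof -
  have "path (word_path w) \<and> path_image (word_path w) \<subseteq> conf {1..m} \<and>
    pathstart (word_path w) = of_nat \<and> pathfinish (word_path w) = of_nat \<circ> word_perm w"
    using assms
  proof (induction w)
    case Nil
    then show ?case
      by (auto simp: path_def path_image_def of_nat_conf pathstart_def pathfinish_def)
  next
    case (Cons g w)
    let ?q = "\<lambda>t. word_path w t \<circ> gen_swap g"
    have q: "path ?q"
      unfolding path_def
      by (rule continuous_on_compose2[OF continuous_on_relabel[of UNIV]])
        (use Cons in \<open>auto simp: path_def\<close>)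
    have qi: "path_image ?q \<subseteq> conf {1..m}"
      using Cons conf_relabel[OF _ gen_swap_bij[of g m]] by (auto simp: path_image_def)
    have g: "path (gen_path g)" "path_image (gen_path g) \<subseteq> conf {1..m}"
      "pathstart (gen_path g) = of_nat" "pathfinish (gen_path g) = of_nat \<circ> gen_swap g"
      using continuous_on_gen_path gen_path_conf
      by (auto simp: path_def path_image_def pathstart_def pathfinish_def gen_path_0 gen_path_1)
    have "pathstart ?q = of_nat \<circ> gen_swap g" "pathfinish ?q = of_nat \<circ> word_perm w \<circ> gen_swap g"
      using Cons by (auto simp: pathstart_def pathfinish_def)
    then show ?case using q qi g
      by (simp add: path_image_join o_assoc)
  qed
  then show "path (word_path w)" "path_image (word_path w) \<subseteq> conf {1..m}"
    "pathstart (word_path w) = of_nat" "pathfinish (word_path w) = of_nat \<circ> word_perm w" by auto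
qed

lemma word_path_relabel:
  assumes "valid m w" "bij_betw \<sigma> {1..m} {1..m}"
  shows "path (\<lambda>t. word_path w t \<circ> \<sigma>)" "path_image (\<lambda>t. word_path w t \<circ> \<sigma>) \<subseteq> conf {1..m}"
    "pathstart (\<lambda>t. word_path w t \<circ> \<sigma>) = of_nat \<circ> \<sigma>"
    "pathfinish (\<lambda>t. word_path w t \<circ> \<sigma>) = of_nat \<circ> word_perm w \<circ> \<sigma>"
proof -
  have "homotopic_paths (conf {1..m}) (word_path w) (word_path w)"
    using word_path[OF assms(1)] by simp
  from homotopic_paths_relabel[OF this assms(2)]
  show "path (\<lambda>t. word_path w t \<circ> \<sigma>)" "path_image (\<lambda>t. word_path w t \<circ> \<sigma>) \<subseteq> conf {1..m}"
    by auto
  show "pathstart (\<lambda>t. word_path w t \<circ> \<sigma>) = of_nat \<circ> \<sigma>"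
    "pathfinish (\<lambda>t. word_path w t \<circ> \<sigma>) = of_nat \<circ> word_perm w \<circ> \<sigma>"
    using word_path(3,4)[OF assms(1)] by (auto simp: pathstart_def pathfinish_def)
qed

lemma gen_path_conf_path:
  "path (gen_path g)" "path_image (gen_path g) \<subseteq> conf J"
  "pathstart (gen_path g) = of_nat" "pathfinish (gen_path g) = of_nat \<circ> gen_swap g"
  using continuous_on_gen_path gen_path_conf
  by (auto simp: path_def path_image_def pathstart_def pathfinish_def gen_path_0 gen_path_1)

lemma homotopic_paths_lid_const:
  fixes p :: "real \<Rightarrow> 'a::topological_space"
  assumes "path p" "path_image p \<subseteq> S"
  shows "homotopic_paths S p ((\<lambda>t. pathstart p) +++ p)"
  by (rule homotopic_paths_reparametrize[OF assms, where f = "\<lambda>t. max 0 (2 * t - 1)"])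
    (auto intro!: continuous_intros simp: joinpaths_def pathstart_def)

lemma homotopic_paths_rid_const:
  fixes p :: "real \<Rightarrow> 'a::topological_space"
  assumes "path p" "path_image p \<subseteq> S"
  shows "homotopic_paths S p (p +++ (\<lambda>t. pathfinish p))"
  by (rule homotopic_paths_reparametrize[OF assms, where f = "\<lambda>t. min 1 (2 * t)"])
    (auto intro!: continuous_intros simp: joinpaths_def pathfinish_def)

text \<open>Both sides describe the same motion with different schedules, as each letter halves the
  remaining time; the induction only reassociates the joins.\<close>

lemma word_path_append:
  assumes "valid m v" "valid m w"
  shows "homotopic_paths (conf {1..m}) (word_path (v @ w))
    (word_path v +++ (\<lambda>t. word_path w t \<circ> word_perm v))"
  using assms(1)
proof (induction v)
  case Nil
  show ?case using homotopic_paths_lid_const[OF word_path(1,2)[OF assms(2)]] word_path(3)[OF assms(2)]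
    by simp
next
  case (Cons g v)
  have b: "bij_betw (gen_swap g) {1..m} {1..m}" and v: "valid m v"
    using Cons.prems by (auto intro: gen_swap_bij)
  have bv: "bij_betw (word_perm v \<circ> gen_swap g) {1..m} {1..m}"
    using b word_perm_bij[OF v] by (rule bij_betw_trans)
  let ?C = "conf {1..m}"
  have "homotopic_paths ?C (\<lambda>t. word_path (v @ w) t \<circ> gen_swap g)
      (\<lambda>t. (word_path v +++ (\<lambda>t. word_path w t \<circ> word_perm v)) t \<circ> gen_swap g)"
    by (rule homotopic_paths_relabel[OF Cons.IH[OF v] b])
  also have "(\<lambda>t. (word_path v +++ (\<lambda>t. word_path w t \<circ> word_perm v)) t \<circ> gen_swap g) =
      (\<lambda>t. word_path v t \<circ> gen_swap g) +++ (\<lambda>t. word_path w t \<circ> (word_perm v \<circ> gen_swap g))"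
    by (auto simp: joinpaths_def fun_eq_iff)
  finally have rest: "homotopic_paths ?C (\<lambda>t. word_path (v @ w) t \<circ> gen_swap g)
      ((\<lambda>t. word_path v t \<circ> gen_swap g) +++ (\<lambda>t. word_path w t \<circ> (word_perm v \<circ> gen_swap g)))" .
  have "homotopic_paths ?C (word_path ((g # v) @ w))
      (gen_path g +++ ((\<lambda>t. word_path v t \<circ> gen_swap g) +++ (\<lambda>t. word_path w t \<circ> (word_perm v \<circ> gen_swap g))))"
    unfolding append_Cons word_path.simps
    by (rule homotopic_paths_join[OF _ rest])
      (use gen_path_conf_path[of g] word_path_relabel(3)[OF _ b, of "v @ w"] v assms(2) in simp_all)
  also have "homotopic_paths ?C \<dots>
      ((gen_path g +++ (\<lambda>t. word_path v t \<circ> gen_swap g)) +++ (\<lambda>t. word_path w t \<circ> (word_perm v \<circ> gen_swap g)))"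
    using gen_path_conf_path[of g] word_path_relabel[OF v b] word_path_relabel[OF assms(2) bv]
    by (intro homotopic_paths_assoc) (auto simp: o_assoc)
  finally show ?case unfolding append_Cons word_path.simps word_perm.simps .
qed

section \<open>Equality of braids\<close>

text \<open>Equality in the braid group: a homotopy relative to the end points, so in particular
  equal permutations.\<close>

definition braid_eq :: "nat \<Rightarrow> braid_word \<Rightarrow> braid_word \<Rightarrow> bool" where
  "braid_eq m x y \<longleftrightarrow> valid m x \<and> valid m y \<and> homotopic_paths (conf {1..m}) (word_path x) (word_path y)"

lemma braid_eq_refl: "valid m x \<Longrightarrow> braid_eq m x x"
  by (simp add: braid_eq_def word_path)

lemma braid_eq_sym: "braid_eq m x y \<Longrightarrow> braid_eq m y x"
  by (simp add: braid_eq_def homotopic_paths_sym)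

lemma braid_eq_trans [trans]: "braid_eq m x y \<Longrightarrow> braid_eq m y z \<Longrightarrow> braid_eq m x z"
  unfolding braid_eq_def by (blast intro: homotopic_paths_trans)

lemma braid_eq_perm:
  assumes "braid_eq m x y"
  shows "word_perm x = word_perm y"
proof
  fix j
  have "(of_nat \<circ> word_perm x :: nat \<Rightarrow> complex) = of_nat \<circ> word_perm y"
    using assms word_path(4) homotopic_paths_imp_pathfinish unfolding braid_eq_def by metis
  then show "word_perm x j = word_perm y j" by (metis comp_apply of_nat_eq_iff)
qed

lemma braid_eq_append:
  assumes "braid_eq m x x'" "braid_eq m y y'"
  shows "braid_eq m (x @ y) (x' @ y')"
proof -
  have v: "valid m x" "valid m x'" "valid m y" "valid m y'" using assms by (auto simp: braid_eq_def)
  let ?C = "conf {1..m}"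
  have b: "bij_betw (word_perm x) {1..m} {1..m}" by (rule word_perm_bij[OF v(1)])
  have "homotopic_paths ?C (word_path (x @ y)) (word_path x +++ (\<lambda>t. word_path y t \<circ> word_perm x))"
    by (rule word_path_append[OF v(1,3)])
  also have "homotopic_paths ?C \<dots> (word_path x' +++ (\<lambda>t. word_path y' t \<circ> word_perm x))"
    using assms word_path(4)[OF v(1)] word_path_relabel(3)[OF v(3) b]
    by (intro homotopic_paths_join homotopic_paths_relabel b) (auto simp: braid_eq_def)
  also have "homotopic_paths ?C \<dots> (word_path (x' @ y'))"
    using word_path_append[OF v(2,4)] braid_eq_perm[OF assms(1)] by (simp add: homotopic_paths_sym)
  finally show ?thesis using v by (simp add: braid_eq_def)
qed

lemma braid_eq_cancel:
  assumes g: "1 \<le> gen_index g" "gen_index g < m"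
  shows "braid_eq m [g, gen_inv g] []"
proof -
  \<comment> \<open>The first letter occupies the times up to 1/2, the second one those up to 3/4,
    and the empty word the rest. Since the second letter is the first one run backwards, the whole
    motion is \<open>gen_path g\<close> after \<open>f\<close>, which climbs to 1, returns to 0 and
    stays there. Contracting \<open>f\<close> in the unit interval contracts the motion.\<close>
  define f where "f t = max 0 (min (2 * t) (3 - 4 * t))" for t :: real
  let ?g = "gen_path g"
  have ix: "gen_index (gen_inv g) = gen_index g" by (cases g) auto
  have rev_half: "gen_path (gen_inv g) s \<circ> gen_swap g = ?g (1 - s)" for s
  proof -
    have "cis (pi * (1 - s)) = - cis (- (pi * s))" "cis (- (pi * (1 - s))) = - cis (pi * s)"
      by (simp_all add: complex_eq_iff right_diff_distrib)
    then show ?thesis by (cases g) (auto simp: fun_eq_iff gen_swap_def)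
  qed
  have start: "of_nat \<circ> gen_swap (gen_inv g) \<circ> gen_swap g = (of_nat :: nat \<Rightarrow> complex)"
    by (auto simp: fun_eq_iff gen_swap_def ix)
  have eq: "word_path [g, gen_inv g] t = (?g \<circ> f) t" if "t \<in> {0..1}" for t
  proof -
    consider "t \<le> 1/2" | "1/2 < t" "t \<le> 3/4" | "3/4 < t" by linarith
    then show ?thesis
    proof cases
      case 1
      then show ?thesis using that by (simp add: joinpaths_def f_def max_def min_def)
    next
      case 2
      then have "word_path [g, gen_inv g] t = gen_path (gen_inv g) (2 * (2 * t - 1)) \<circ> gen_swap g"
        by (simp add: joinpaths_def)
      also have "\<dots> = ?g (3 - 4 * t)" unfolding rev_half by (simp add: algebra_simps)
      also have "3 - 4 * t = f t" using 2 by (simp add: f_def max_def min_def)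
      finally show ?thesis by (simp only: o_apply)
    next
      case 3
      then have "word_path [g, gen_inv g] t = of_nat"
        using start by (simp add: joinpaths_def)
      moreover have "f t = 0" using 3 by (simp add: f_def max_def min_def)
      ultimately show ?thesis by (simp add: gen_path_0)
    qed
  qed
  have "homotopic_paths {0..1} f (\<lambda>t. 0)"
  proof (rule homotopic_paths_linear)
    show "closed_segment (f t) 0 \<subseteq> {0..1}" if "t \<in> {0..1}" for t
      by (rule closed_segment_subset) (auto simp: f_def)
  qed (auto simp: path_def pathstart_def pathfinish_def f_def intro!: continuous_intros)
  then have "homotopic_paths (conf {1..m}) (?g \<circ> f) (?g \<circ> (\<lambda>t. 0))"
    by (rule homotopic_paths_continuous_image) (auto intro: continuous_on_gen_path gen_path_conf)
  moreover have "?g \<circ> (\<lambda>t. 0) = word_path []" by (auto simp: gen_path_0 o_def)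
  ultimately have back_forth: "homotopic_paths (conf {1..m}) (?g \<circ> f) (word_path [])" by (simp only:)
  have v: "valid m [g, gen_inv g]" using g by (simp add: ix)
  have "homotopic_paths (conf {1..m}) (word_path [g, gen_inv g]) (?g \<circ> f)"
    by (rule homotopic_paths_eq[OF word_path(1,2)[OF v] eq])
  from homotopic_paths_trans[OF this back_forth] show ?thesis using v unfolding braid_eq_def by simp
qed

section \<open>Positive permutation braids and the braid relations\<close>

text \<open>
  Configurations in which no point lies vertically below a point with a larger label form a star
  with centre \<open>j \<mapsto> - \<i> j\<close>, so paths in this set are determined by their end points up to homotopy.
\<close>

definition layered :: "nat set \<Rightarrow> (nat \<Rightarrow> complex) set" where
  "layered J = {c. \<forall>p\<in>J. \<forall>q\<in>J. p < q \<longrightarrow> Re (c p) = Re (c q) \<longrightarrow> Im (c q) < Im (c p)}"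

lemma layered_conf: "layered J \<subseteq> conf J"
  unfolding layered_def conf_def inj_on_def by (auto, metis less_irrefl linorder_neqE_nat)

text \<open>For \<open>r < 1\<close> two contracted points are vertically aligned only if the
  original points are. Their height difference then keeps its sign, and the added term lowers the
  larger label further. For \<open>r = 1\<close> only this added term is left.\<close>

lemma layered_star:
  assumes "c \<in> layered J" "0 \<le> r" "r \<le> 1"
  shows "(\<lambda>j. of_real (1 - r) * c j - of_real r * \<i> * of_nat j) \<in> layered J"
  unfolding layered_def
proof (intro CollectI ballI impI)
  fix p q assume pq: "p \<in> J" "q \<in> J" "p < q"
    and eq: "Re (of_real (1 - r) * c p - of_real r * \<i> * of_nat p) = Re (of_real (1 - r) * c q - of_real r * \<i> * of_nat q)"
  have "(1 - r) * Im (c q) - r * real q < (1 - r) * Im (c p) - r * real p"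
  proof (cases "r = 1")
    case True
    then show ?thesis using pq by simp
  next
    case False
    then have "(1 - r) * Im (c q) < (1 - r) * Im (c p)" using assms pq eq
      by (intro mult_strict_left_mono) (auto simp: layered_def)
    moreover have "r * real p \<le> r * real q" using assms pq by (intro mult_left_mono) auto
    ultimately show ?thesis by simp
  qed
  then show "Im (of_real (1 - r) * c q - of_real r * \<i> * of_nat q) < Im (of_real (1 - r) * c p - of_real r * \<i> * of_nat p)"
    by simp
qed

lemma layered_homotopic:
  assumes p: "path p" "path_image p \<subseteq> layered J" and q: "path q" "path_image q \<subseteq> layered J"
    and ends: "pathstart p = pathstart q" "pathfinish p = pathfinish q"
  shows "homotopic_paths (layered J) p q"
proof -
  define \<Phi> where "\<Phi> a = (\<lambda>x :: real \<times> real. \<lambda>j. of_real (1 - snd x) * a (fst x) j - of_real (snd x) * \<i> * of_nat j)"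
    for a :: "real \<Rightarrow> nat \<Rightarrow> complex"
  \<comment> \<open>A path in the square that follows three sides instead of the bottom side from
    (0, 0) to (1, 0). On the two vertical sides \<open>\<Phi> a\<close> depends only on an end point
    of \<open>a\<close>, and on the top side it is the centre of the star, so \<open>p\<close> and
    \<open>q\<close> yield the same path.\<close>
  define \<beta> where "\<beta> t = (max 0 (min 1 (3 * t - 1)), min 1 (min (3 * t) (3 - 3 * t)))" for t :: real
  have main: "homotopic_paths (layered J) a (\<Phi> a \<circ> \<beta>)" if a: "path a" "path_image a \<subseteq> layered J" for a
  proof -
    have "continuous_on ({0..1} \<times> {0..1}) (\<Phi> a)"
      unfolding \<Phi>_def
    proof (rule continuous_on_coordinatewise_then_product)
      fix j
      have "continuous_on ({0..1::real} \<times> {0..1::real}) (\<lambda>x. a (fst x) j)"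
        by (rule continuous_on_compose2[OF continuous_on_product_then_coordinatewise])
          (use a in \<open>auto simp: path_def intro!: continuous_intros\<close>)
      then show "continuous_on ({0..1} \<times> {0..1})
          (\<lambda>x. of_real (1 - snd x) * a (fst x) j - of_real (snd x) * \<i> * of_nat j)"
        by (intro continuous_intros)
    qed
    moreover have "\<Phi> a \<in> {0..1} \<times> {0..1} \<rightarrow> layered J"
      using a layered_star[of _ J] by (auto simp: \<Phi>_def path_image_def)
    moreover have "homotopic_paths ({0..1} \<times> {0..1}) (\<lambda>t. (t, 0)) \<beta>"
    proof (rule homotopic_paths_linear)
      show "closed_segment (t, 0) (\<beta> t) \<subseteq> {0..1} \<times> {0..1}" if "t \<in> {0..1}" for t
        by (rule closed_segment_subset) (use that in \<open>auto simp: \<beta>_def intro: convex_Times\<close>)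
    qed (auto simp: path_def pathstart_def pathfinish_def \<beta>_def intro!: continuous_intros)
    ultimately have "homotopic_paths (layered J) (\<Phi> a \<circ> (\<lambda>t. (t, 0))) (\<Phi> a \<circ> \<beta>)"
      by (intro homotopic_paths_continuous_image)
    moreover have "\<Phi> a \<circ> (\<lambda>t. (t, 0)) = a" by (auto simp: \<Phi>_def)
    ultimately show ?thesis by simp
  qed
  have eq: "(\<Phi> p \<circ> \<beta>) t = (\<Phi> q \<circ> \<beta>) t" if "t \<in> {0..1}" for t
  proof -
    consider "t \<le> 1/3" | "1/3 < t" "t < 2/3" | "t \<ge> 2/3" by linarith
    then show ?thesis
    proof cases
      case 1
      then have "fst (\<beta> t) = 0" by (simp add: \<beta>_def)
      then show ?thesis using ends by (simp add: \<Phi>_def pathstart_def)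
    next
      case 2
      then have "snd (\<beta> t) = 1" by (simp add: \<beta>_def)
      then show ?thesis by (simp add: \<Phi>_def)
    next
      case 3
      then have "fst (\<beta> t) = 1" by (simp add: \<beta>_def)
      then show ?thesis using ends by (simp add: \<Phi>_def pathfinish_def)
    qed
  qed
  have "homotopic_paths (layered J) p (\<Phi> p \<circ> \<beta>)" by (rule main[OF p])
  also have "homotopic_paths (layered J) \<dots> (\<Phi> q \<circ> \<beta>)"
    using main[OF p, THEN homotopic_paths_imp_path] main[OF p, THEN homotopic_paths_imp_subset] eq
    by (intro homotopic_paths_eq) auto
  also have "homotopic_paths (layered J) \<dots> q"
    using main[OF q] by (simp add: homotopic_paths_sym)
  finally show ?thesis .
qed

text \<open>Here \<open>\<sigma>\<close> sends a strand to its current position, so only strands in their original order may cross.\<close>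

fun crosses_once :: "nat \<Rightarrow> braid_word \<Rightarrow> (nat \<Rightarrow> nat) \<Rightarrow> bool" where
  "crosses_once m [] \<sigma> = True"
| "crosses_once m (SigmaInv i # w) \<sigma> = False"
| "crosses_once m (Sigma i # w) \<sigma> =
    ((\<forall>p\<in>{1..m}. \<forall>q\<in>{1..m}. \<sigma> p = Suc i \<longrightarrow> \<sigma> q = i \<longrightarrow> q < p) \<and> crosses_once m w (gen_swap (Sigma i) \<circ> \<sigma>))"

text \<open>All other points keep away from the horizontal range of the rotating pair, and the two
  points of the pair are vertically aligned only after a quarter turn. Then the one coming from
  position \<open>i\<close> is in front, and by assumption it has the smaller label.\<close>

lemma layered_gen_path:
  assumes inj: "inj_on \<sigma> {1..m}" and t: "t \<in> {0..1}"
    and \<sigma>: "\<forall>p\<in>{1..m}. \<forall>q\<in>{1..m}. \<sigma> p = Suc i \<longrightarrow> \<sigma> q = i \<longrightarrow> q < p"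
  shows "gen_path (Sigma i) t \<circ> \<sigma> \<in> layered {1..m}"
  unfolding layered_def
proof (clarify)
  fix p q assume pq: "p \<in> {1..m}" "q \<in> {1..m}" "p < q"
    and eq: "Re ((gen_path (Sigma i) t \<circ> \<sigma>) p) = Re ((gen_path (Sigma i) t \<circ> \<sigma>) q)"
  define c where "c = cos (pi * t)"
  have c: "-1 \<le> c" "c \<le> 1" by (simp_all add: c_def)
  have re: "Re (gen_path (Sigma i) t x) = (if x = i then i + 1/2 - c / 2 else if x = Suc i then i + 1/2 + c / 2 else x)" for x
    by (simp add: c_def)
  have ne: "\<sigma> p \<noteq> \<sigma> q" using inj_onD[OF inj, of p q] pq by fastforce
  have far: "real x \<le> real i - 1 \<or> real x \<ge> real i + 2" if "x \<noteq> i" "x \<noteq> Suc i" for x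
    using that by linarith
  have "\<not> (\<sigma> p = Suc i \<and> \<sigma> q = i)" using \<sigma> pq by force
  moreover have "\<sigma> p \<in> {i, Suc i}" "\<sigma> q \<in> {i, Suc i}"
    using eq ne c far[of "\<sigma> p"] far[of "\<sigma> q"]
    by (auto simp: re simp del: gen_path.simps split: if_splits)
  ultimately have 1: "\<sigma> p = i" "\<sigma> q = Suc i" using ne by auto
  then have "c = 0" using eq by (simp add: re del: gen_path.simps)
  then have "sin (pi * t) \<noteq> 0" using sin_cos_squared_add[of "pi * t"] by (auto simp: c_def)
  moreover have "sin (pi * t) \<ge> 0" using t by (intro sin_ge_zero) auto
  ultimately show "Im ((gen_path (Sigma i) t \<circ> \<sigma>) q) < Im ((gen_path (Sigma i) t \<circ> \<sigma>) p)"
    using 1 by simp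
qed

lemma layered_word_path:
  assumes "valid m w" "bij_betw \<sigma> {1..m} {1..m}" "crosses_once m w \<sigma>" "t \<in> {0..1}"
  shows "word_path w t \<circ> \<sigma> \<in> layered {1..m}"
  using assms
proof (induction w arbitrary: \<sigma> t)
  case Nil
  then have "inj_on \<sigma> {1..m}" by (simp add: bij_betw_def)
  then have "\<sigma> p \<noteq> \<sigma> q" if "p \<in> {1..m}" "q \<in> {1..m}" "p < q" for p q
    using that inj_onD[of \<sigma> "{1..m}" p q] by fastforce
  then show ?case by (simp add: layered_def)
next
  case (Cons g w)
  from Cons.prems obtain i where g: "g = Sigma i" by (cases g) auto
  show ?case
  proof (cases "t \<le> 1/2")
    case True
    then have "gen_path (Sigma i) (2 * t) \<circ> \<sigma> \<in> layered {1..m}"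
      using Cons.prems by (intro layered_gen_path) (auto simp: g bij_betw_def)
    moreover have "word_path (g # w) t = gen_path (Sigma i) (2 * t)"
      using True by (simp add: joinpaths_def g del: gen_path.simps)
    ultimately show ?thesis by (simp only:)
  next
    case False
    define \<tau> where "\<tau> = gen_swap g \<circ> \<sigma>"
    have "bij_betw \<tau> {1..m} {1..m}"
      unfolding \<tau>_def using Cons.prems gen_swap_bij[of g m] by (auto intro: bij_betw_trans)
    moreover have "crosses_once m w \<tau>" using Cons.prems by (simp add: g \<tau>_def)
    ultimately have "word_path w (2 * t - 1) \<circ> \<tau> \<in> layered {1..m}"
      using Cons.prems False by (intro Cons.IH) auto
    moreover have "word_path (g # w) t \<circ> \<sigma> = word_path w (2 * t - 1) \<circ> \<tau>"
      using False by (simp add: joinpaths_def \<tau>_def o_assoc)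
    ultimately show ?thesis by (simp only:)
  qed
qed

text \<open>Both motions stay in the star-shaped set \<open>layered {1..m}\<close> and have the same
  end points. The relations between generators thereby reduce to comparing permutations.\<close>

lemma braid_eq_positive:
  assumes x: "valid m x" "crosses_once m x id" and y: "valid m y" "crosses_once m y id"
    and perm: "word_perm x = word_perm y"
  shows "braid_eq m x y"
proof -
  have im: "path_image (word_path w) \<subseteq> layered {1..m}" if "valid m w" "crosses_once m w id" for w
    using layered_word_path[OF that(1) bij_betw_id that(2)] by (auto simp: path_image_def)
  have "homotopic_paths (layered {1..m}) (word_path x) (word_path y)"
    using word_path[OF x(1)] word_path[OF y(1)] perm
    by (intro layered_homotopic im x y) simp_all
  then show ?thesis
    using x(1) y(1) homotopic_paths_subset[OF _ layered_conf] by (auto simp: braid_eq_def)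
qed

lemma braid_eq_far:
  assumes "1 \<le> i" "i < m" "1 \<le> j" "j < m" "Suc i < j \<or> Suc j < i"
  shows "braid_eq m [Sigma i, Sigma j] [Sigma j, Sigma i]"
proof (rule braid_eq_positive)
  show "word_perm [Sigma i, Sigma j] = word_perm [Sigma j, Sigma i]"
    using assms by (auto simp: gen_swap_def fun_eq_iff)
qed (use assms in \<open>auto simp: gen_swap_def split: if_splits\<close>)

lemma braid_eq_braid:
  assumes "1 \<le> i" "Suc i < m"
  shows "braid_eq m [Sigma i, Sigma (Suc i), Sigma i] [Sigma (Suc i), Sigma i, Sigma (Suc i)]"
proof (rule braid_eq_positive)
  show "word_perm [Sigma i, Sigma (Suc i), Sigma i] = word_perm [Sigma (Suc i), Sigma i, Sigma (Suc i)]"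
    by (auto simp: gen_swap_def fun_eq_iff)
qed (use assms in \<open>auto simp: gen_swap_def split: if_splits\<close>)

section \<open>Comparison with the closure of a word\<close>

text \<open>A schedule with one unit of time per letter and rest afterwards. The equal parts in
  \<open>braid_slice\<close> and the halving in \<open>word_path\<close> are both changes of time of
  this one.\<close>

fun unit_path :: "braid_word \<Rightarrow> real \<Rightarrow> nat \<Rightarrow> complex" where
  "unit_path [] x = of_nat"
| "unit_path (g # w) x = (if x \<le> 1 then gen_path g x else unit_path w (x - 1) \<circ> gen_swap g)"

fun unit_time :: "braid_word \<Rightarrow> real \<Rightarrow> real" where
  "unit_time [] t = 0"
| "unit_time (g # w) t = (if t \<le> 1/2 then 2 * t else 1 + unit_time w (2 * t - 1))"

lemma unit_path_0: "unit_path w 0 = of_nat"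
  by (cases w) (auto simp: gen_path_0)

lemma unit_time_0: "unit_time w 0 = 0"
  by (cases w) auto

lemma unit_time_1: "unit_time w 1 = length w"
  by (induction w) auto

lemma unit_time_bounds: "t \<in> {0..1} \<Longrightarrow> 0 \<le> unit_time w t \<and> unit_time w t \<le> length w"
proof (induction w arbitrary: t)
  case (Cons g w)
  then show ?case using Cons.IH[of "2 * t - 1"] by (cases "t \<le> 1/2") auto
qed simp

lemma continuous_on_unit_time: "continuous_on {0..1} (unit_time w)"
proof (induction w)
  case (Cons g w)
  have meet: "2 * t = 1 + unit_time w (2 * t - 1)" if "t * 2 = 1" for t
  proof -
    have 1: "2 * t = 1" and 0: "2 * t - 1 = 0" using that by simp_all
    show ?thesis unfolding 0 unit_time_0 using 1 by simp
  qed
  have "{0..1} = {0..1/2} \<union> {1/2..1::real}" by auto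
  moreover have "continuous_on {1/2..1} (\<lambda>t. unit_time w (2 * t - 1))"
    by (rule continuous_on_compose2[OF Cons]) (auto intro!: continuous_intros)
  then have "continuous_on ({0..1/2} \<union> {1/2..1}) (\<lambda>t. if t \<le> 1/2 then 2 * t else 1 + unit_time w (2 * t - 1))"
    by (intro continuous_on_cases continuous_intros) (auto intro: meet)
  ultimately show ?case by simp
qed simp

lemma continuous_on_unit_path: "continuous_on {0..} (unit_path w)"
proof (induction w)
  case (Cons g w)
  have "{0..} = {0..1} \<union> {1::real..}" by auto
  moreover have "continuous_on {1..} (\<lambda>x. unit_path w (x - 1) \<circ> gen_swap g)"
    by (rule continuous_on_compose2[OF continuous_on_relabel[of UNIV]],
        rule continuous_on_compose2[OF Cons]) (auto intro!: continuous_intros)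
  then have "continuous_on ({0..1} \<union> {1..}) (\<lambda>x. if x \<le> 1 then gen_path g x else unit_path w (x - 1) \<circ> gen_swap g)"
    by (intro continuous_on_cases continuous_on_gen_path) (auto simp: unit_path_0 gen_path_1)
  ultimately show ?case by simp
qed simp

lemma unit_path_conf: "valid m w \<Longrightarrow> unit_path w x \<in> conf {1..m}"
  by (induction w arbitrary: x) (auto simp: of_nat_conf gen_path_conf intro!: conf_relabel gen_swap_bij)

lemma word_path_unit_path: "t \<in> {0..1} \<Longrightarrow> word_path w t = unit_path w (unit_time w t)"
proof (induction w arbitrary: t)
  case (Cons g w)
  show ?case
  proof (cases "t \<le> 1/2")
    case False
    then have t: "2 * t - 1 \<in> {0..1}" using Cons.prems by auto
    show ?thesis
    proof (cases "unit_time w (2 * t - 1) = 0")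
      case True
      then show ?thesis using False Cons.IH[OF t] by (simp add: joinpaths_def unit_path_0 gen_path_1)
    next
      case ne: False
      then have "unit_time w (2 * t - 1) > 0" using unit_time_bounds[OF t, of w] by simp
      then show ?thesis using False Cons.IH[OF t] by (simp add: joinpaths_def)
    qed
  qed (simp add: joinpaths_def)
qed simp

lemma gen_slice_path: "1 \<le> gen_index g \<Longrightarrow> gen_index g < m \<Longrightarrow> gen_slice m g s = gen_path g s ` {1..m}"
proof -
  assume g: "1 \<le> gen_index g" "gen_index g < m"
  have "{1..m} = ({1..m} - {gen_index g, Suc (gen_index g)}) \<union> {gen_index g, Suc (gen_index g)}"
    using g by auto
  then have "gen_path g s ` {1..m} = gen_path g s ` ({1..m} - {gen_index g, Suc (gen_index g)}) \<union>
      gen_path g s ` {gen_index g, Suc (gen_index g)}" by (metis image_Un)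
  also have "gen_path g s ` ({1..m} - {gen_index g, Suc (gen_index g)}) = of_nat ` ({1..m} - {gen_index g, Suc (gen_index g)})"
    by (cases g) (auto intro!: image_cong)
  finally show ?thesis by (cases g) auto
qed

lemma gen_slice_unit_path:
  "valid m w \<Longrightarrow> 0 \<le> x \<Longrightarrow> x < real (length w) \<Longrightarrow>
    gen_slice m (w ! nat \<lfloor>x\<rfloor>) (frac x) = unit_path w x ` {1..m}"
proof (induction w arbitrary: x)
  case (Cons g w)
  show ?case
  proof (cases "x < 1")
    case True
    then have "\<lfloor>x\<rfloor> = 0" using Cons.prems by linarith
    then show ?thesis using True Cons.prems gen_slice_path[of g m x] by (simp add: frac_def)
  next
    case False
    have "\<lfloor>x\<rfloor> = 1 + \<lfloor>x - 1\<rfloor>" "0 \<le> \<lfloor>x - 1\<rfloor>" using False by auto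
    then have "nat \<lfloor>x\<rfloor> = Suc (nat \<lfloor>x - 1\<rfloor>)" "frac x = frac (x - 1)"
      by (simp_all only: nat_add_distrib Suc_nat_eq_nat_zadd1) (simp add: frac_def)
    then have "gen_slice m ((g # w) ! nat \<lfloor>x\<rfloor>) (frac x) = unit_path w (x - 1) ` {1..m}"
      using Cons.IH[of "x - 1"] Cons.prems False by simp
    also have "\<dots> = unit_path w (x - 1) ` gen_swap g ` {1..m}"
      using gen_swap_bij[of g m] Cons.prems by (simp add: bij_betw_def)
    \<comment> \<open>At \<open>x = 1\<close> the rounding already selects the second letter while
      \<open>unit_path\<close> still uses the first; both give the integer positions.\<close>
    also have "\<dots> = unit_path (g # w) x ` {1..m}"
      using False by (cases "x = 1") (auto simp: unit_path_0 gen_path_1 image_comp)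
    finally show ?thesis .
  qed
qed simp

lemma braid_slice_unit_path:
  assumes "valid m w" "0 \<le> t" "t < 1"
  shows "braid_slice m w t = unit_path w (real (length w) * t) ` {1..m}"
  using assms gen_slice_unit_path[OF assms(1), of "real (length w) * t"]
  by (cases "w = []") (auto simp: braid_slice_def)

lemma word_path_closure:
  assumes w: "valid m w"
  shows "ambient_isotopic S3 (braid_closure m w) (slice_closure (\<lambda>t. word_path w t ` {1..m}))"
proof -
  define u where "u t = unit_path w (real (length w) * t)" for t
  have u: "path u" unfolding path_def u_def
    by (rule continuous_on_compose2[OF continuous_on_unit_path]) (auto intro!: continuous_intros)
  have ui: "path_image u \<subseteq> conf {1..m}" using unit_path_conf[OF w] by (auto simp: path_image_def u_def)
  have "homotopic_paths (conf {1..m}) u (word_path w)"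
  proof (cases "w = []")
    case True
    then have "u = word_path w" by (auto simp: u_def)
    then show ?thesis using u ui by (metis homotopic_paths_refl)
  next
    case False
    show ?thesis
    proof (rule homotopic_paths_reparametrize[OF u ui, where f = "\<lambda>t. unit_time w t / length w"])
      show "(\<lambda>t. unit_time w t / length w) \<in> {0..1} \<rightarrow> {0..1}"
        using unit_time_bounds[of _ w] False by (auto simp: divide_simps)
    qed (use False in \<open>auto intro!: continuous_intros continuous_on_unit_time
          simp: unit_time_0 unit_time_1 u_def word_path_unit_path\<close>)
  qed
  moreover have "u 1 j = u 0 (word_perm w j)" for j
    using word_path[OF w] homotopic_paths_imp_pathfinish[OF calculation] homotopic_paths_imp_pathstart[OF calculation]
    by (simp add: pathstart_def pathfinish_def)
  ultimately have "ambient_isotopic S3 (slice_closure (\<lambda>t. u t ` {1..m})) (slice_closure (\<lambda>t. word_path w t ` {1..m}))"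
    by (intro homotopic_closure[where \<pi> = "word_perm w"] word_perm_bij w) auto
  moreover have "slice_closure (\<lambda>t. u t ` {1..m}) = braid_closure m w"
    unfolding braid_closure_eq by (rule slice_closure_cong) (simp add: u_def braid_slice_unit_path w)
  ultimately show ?thesis by simp
qed

lemma braid_eq_closure:
  assumes "braid_eq m x y"
  shows "ambient_isotopic S3 (braid_closure m x) (braid_closure m y)"
proof -
  have v: "valid m x" "valid m y" using assms by (auto simp: braid_eq_def)
  have "word_path x 1 j = word_path x 0 (word_perm x j)" for j
    using word_path(3,4)[OF v(1)] by (simp add: pathstart_def pathfinish_def)
  then have "ambient_isotopic S3 (slice_closure (\<lambda>t. word_path x t ` {1..m})) (slice_closure (\<lambda>t. word_path y t ` {1..m}))"
    using assms by (intro homotopic_closure[where \<pi> = "word_perm x"] word_perm_bij v) (auto simp: braid_eq_def)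
  then show ?thesis
    using word_path_closure[OF v(1)] word_path_closure[OF v(2)]
    by (meson ambient_isotopic_trans ambient_isotopic_sym braid_closure_subset_S3)
qed

section \<open>Markov moves\<close>

lemma solid_torus_to_S3_periodic: "solid_torus_to_S3 z (t + of_int k) = solid_torus_to_S3 z t"
proof -
  have "cis (2 * pi * (t + of_int k)) = cis (2 * pi * t) * cis (2 * pi * of_int k)"
    by (simp add: cis_mult algebra_simps)
  also have "cis (2 * pi * of_int k) = 1" by (rule cis_multiple_2pi) simp
  finally show ?thesis by (simp add: solid_torus_to_S3_def)
qed

text \<open>Rotating the coordinate \<open>w\<close> is a linear isotopy of the sphere. It takes
  level \<open>t\<close> to level \<open>t - \<tau>\<close>, so the new slice at \<open>t\<close> is
  the old one at \<open>t + \<tau>\<close>.\<close>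

lemma slice_closure_rotate:
  "ambient_isotopic S3 (slice_closure P) (slice_closure (\<lambda>t. P (frac (t + \<tau>))))"
proof -
  define F where "F s = (\<lambda>(z :: complex, w). (z, w * cis (- (2 * pi * s * \<tau>))))" for s
  have F: "F s (z, w) = (z, w * cis (- (2 * pi * s * \<tau>)))" for s z w by (simp add: F_def)
  have "ambient_isotopic S3 (slice_closure P) ((\<lambda>x. sgn (F 1 x)) ` slice_closure P)"
    unfolding S3_def
  proof (rule homogeneous_isotopy)
    have "continuous_on S (\<lambda>p. cis (- (2 * pi * fst p * \<tau>)))" for S :: "(real \<times> complex \<times> complex) set"
      by (simp add: cis_conv_exp) (intro continuous_intros)
    then show "continuous_on ({0..1} \<times> (- {0})) (\<lambda>(s, x). F s x)"
      by (auto simp: F_def case_prod_unfold intro!: continuous_intros)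
    show "F s (c *\<^sub>R x) = c *\<^sub>R F s x" for s c x by (cases x) (simp add: F)
    have inv: "a * cis (- b) * cis b = a" "a * cis b * cis (- b) = a" for a b
      by (simp_all add: mult.assoc cis_mult)
    show "bij (F s)" for s
      by (rule o_bij[where g = "\<lambda>(z, w). (z, w * cis (2 * pi * s * \<tau>))"])
        (auto simp: F inv fun_eq_iff)
    show "F s 0 = 0" for s by (simp add: F zero_prod_def)
    show "F 0 x = x" for x by (cases x) (simp add: F)
  qed
  also have "(\<lambda>x. sgn (F 1 x)) ` slice_closure P = slice_closure (\<lambda>t. P (frac (t + \<tau>)))"
  proof -
    have rot: "sgn (F 1 (solid_torus_to_S3 z t)) = solid_torus_to_S3 z (t - \<tau>)" for z t
    proof -
      have nz: "(z, cis (2 * pi * t)) \<noteq> 0" by (simp add: zero_prod_def)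
      have "F 1 (solid_torus_to_S3 z t) = (1 / norm (z, cis (2 * pi * t))) *\<^sub>R (z, cis (2 * pi * (t - \<tau>)))"
        by (simp add: solid_torus_to_S3_sgn sgn_div_norm F cis_mult algebra_simps divide_inverse)
      then have "sgn (F 1 (solid_torus_to_S3 z t)) = sgn (z, cis (2 * pi * (t - \<tau>)))"
        using nz by (simp add: sgn_scaleR del: scaleR_Pair)
      then show ?thesis by (simp add: solid_torus_to_S3_sgn)
    qed
    have per: "solid_torus_to_S3 z (frac t) = solid_torus_to_S3 z t" for z t
      using solid_torus_to_S3_periodic[of z "frac t" "\<lfloor>t\<rfloor>"] by (simp add: frac_def)
    have fr: "frac (frac a + b) = frac (a + b)" for a b :: real
      by (metis add.commute frac_add_simps(2))
    show ?thesis
    proof (intro equalityI subsetI)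
      fix x assume "x \<in> (\<lambda>x. sgn (F 1 x)) ` slice_closure P"
      then obtain z t where "x = solid_torus_to_S3 z (t - \<tau>)" "0 \<le> t" "t < 1" "z \<in> P t"
        by (auto simp: slice_closure_def rot)
      moreover have "frac (frac (t - \<tau>) + \<tau>) = t" using calculation by (simp add: fr frac_eq)
      ultimately show "x \<in> slice_closure (\<lambda>t. P (frac (t + \<tau>)))"
        unfolding slice_closure_def using per[of z "t - \<tau>"] frac_lt_1[of "t - \<tau>"]
        by (auto intro!: exI[of _ z] exI[of _ "frac (t - \<tau>)"])
    next
      fix x assume "x \<in> slice_closure (\<lambda>t. P (frac (t + \<tau>)))"
      then obtain z t where x: "x = solid_torus_to_S3 z t" "0 \<le> t" "t < 1" "z \<in> P (frac (t + \<tau>))"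
        by (auto simp: slice_closure_def)
      have "solid_torus_to_S3 z (frac (t + \<tau>) - \<tau>) = x"
        using solid_torus_to_S3_periodic[of z t "- \<lfloor>t + \<tau>\<rfloor>"] x by (simp add: frac_def)
      then have img: "x = sgn (F 1 (solid_torus_to_S3 z (frac (t + \<tau>))))" by (simp add: rot)
      have "solid_torus_to_S3 z (frac (t + \<tau>)) \<in> slice_closure P"
        unfolding slice_closure_def
        by (rule CollectI, rule exI[of _ z], rule exI[of _ "frac (t + \<tau>)"])
          (use x frac_lt_1[of "t + \<tau>"] in auto)
      with img show "x \<in> (\<lambda>x. sgn (F 1 x)) ` slice_closure P" by (rule image_eqI)
    qed
  qed
  finally show ?thesis .
qed

text \<open>All letters take equal time, so starting after \<open>u\<close> amounts to a rotation by
  the fraction \<open>length u / n\<close> of the circle. The letters of \<open>v\<close> are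
  reached without wrapping around, those of \<open>u\<close> after one full circle.\<close>

lemma braid_closure_cyclic:
  "ambient_isotopic S3 (braid_closure m (u @ v)) (braid_closure m (v @ u))"
proof (cases "u @ v = []")
  case True
  then show ?thesis by (simp add: ambient_isotopic_refl)
next
  case False
  define n where "n = length u + length v"
  have n: "real n > 0" using False unfolding n_def by (cases u; cases v) auto
  have "braid_slice m (v @ u) t = braid_slice m (u @ v) (frac (t + real (length u) / n))"
    if t: "0 \<le> t" "t < 1" for t
  proof -
    define x where "x = real n * t"
    have x: "0 \<le> x" "x < n" using t n by (auto simp: x_def)
    define y where "y = real n * frac (t + real (length u) / n)"
    have tx: "t = x / n" using n by (simp add: x_def)
    have fl: "0 \<le> \<lfloor>x\<rfloor>" using x by simp
    have key: "(v @ u) ! nat \<lfloor>x\<rfloor> = (u @ v) ! nat \<lfloor>y\<rfloor> \<and> frac x = frac y"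
    proof (cases "x < length v")
      case True
      have "frac (t + real (length u) / n) = t + real (length u) / n"
      proof -
        have "x + real (length u) < real n" using True by (simp add: n_def)
        then have "t + real (length u) / n < 1"
          unfolding tx add_divide_distrib[symmetric] using n by (simp add: divide_less_eq)
        then show ?thesis using t by (simp add: frac_eq)
      qed
      then have y: "y = x + real (length u)" using n by (simp add: y_def x_def field_simps)
      then have "nat \<lfloor>y\<rfloor> = nat \<lfloor>x\<rfloor> + length u" "frac y = frac x" using fl by (simp_all add: frac_def nat_add_distrib)
      moreover have "nat \<lfloor>x\<rfloor> < length v" using True x by linarith
      ultimately show ?thesis by (simp add: nth_append)
    next
      case False
      have "\<lfloor>t + real (length u) / n\<rfloor> = 1"
      proof (rule floor_unique)
        have "real n \<le> x + real (length u)" "x + real (length u) < 2 * real n"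
          using False x by (simp_all add: n_def)
        then show "of_int 1 \<le> t + real (length u) / n" "t + real (length u) / n < of_int 1 + 1"
          unfolding tx add_divide_distrib[symmetric] using n by (simp_all add: le_divide_eq divide_less_eq)
      qed
      then have "y = x + real (length u) - real n"
        using n by (simp add: y_def x_def frac_def field_simps)
      then have y: "y = x - real (length v)" by (simp add: n_def)
      then have fy: "\<lfloor>y\<rfloor> = \<lfloor>x\<rfloor> - int (length v)"
        using floor_diff_of_int[of x "int (length v)"] by simp
      then have "frac y = frac x" using y by (simp add: frac_def)
      moreover have "int (length v) \<le> \<lfloor>x\<rfloor>" using False by (simp add: le_floor_iff)
      then have "nat \<lfloor>x\<rfloor> = nat \<lfloor>y\<rfloor> + length v" using fy by linarith
      ultimately have "nat \<lfloor>x\<rfloor> = nat \<lfloor>y\<rfloor> + length v" "frac y = frac x" by simp_all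
      moreover have "nat \<lfloor>y\<rfloor> < length u" using False x y n_def by linarith
      ultimately show ?thesis by (simp add: nth_append)
    qed
    have "u @ v \<noteq> []" "v @ u \<noteq> []" "length (u @ v) = n" "length (v @ u) = n"
      using False by (auto simp: n_def)
    then show ?thesis using key unfolding braid_slice_def x_def y_def by (simp only: if_False)
  qed
  then have "braid_closure m (v @ u) = slice_closure (\<lambda>t. braid_slice m (u @ v) (frac (t + real (length u) / n)))"
    unfolding braid_closure_eq by (intro slice_closure_cong) auto
  then show ?thesis
    using slice_closure_rotate[of "braid_slice m (u @ v)"] by (simp add: braid_closure_eq)
qed

section \<open>Shears in the complementary solid torus\<close>

text \<open>With \<open>z\<close> normalised to modulus 1 this is the translation of
  \<open>w\<close> by a vector depending on the direction of \<open>z\<close>; the factor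
  \<open>cmod z\<close> makes it homogeneous. The translation vectors are bounded because the circle
  is compact.\<close>

lemma shear_isotopy:
  assumes D: "continuous_on (sphere 0 1) D"
  shows "ambient_isotopic S3 A ((\<lambda>(z, w). sgn (z, w + of_real (cmod z) * D (sgn z))) ` A)"
proof (rule ambient_isotopic_swap)
  have "compact (D ` sphere 0 1)" by (intro compact_continuous_image D compact_sphere)
  then obtain C where C: "\<And>u. u \<in> sphere 0 1 \<Longrightarrow> norm (D u) \<le> C"
    by (meson bounded_iff compact_imp_bounded imageI)
  define g where "g u z = z + D u" for u z
  have "ambient_isotopic S3 (prod.swap ` A) ((\<lambda>x. sgn (fibre_map g 1 x)) ` prod.swap ` A)"
  proof (rule fibre_isotopy[of g C])
    have "continuous_on (sphere 0 1 \<times> UNIV) (\<lambda>p :: complex \<times> complex. D (fst p))"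
      by (rule continuous_on_compose2[OF D]) (auto intro!: continuous_intros)
    then show "continuous_on (sphere 0 1 \<times> UNIV) (\<lambda>(u, z). g u z)"
      by (auto simp: g_def case_prod_unfold intro!: continuous_intros)
    show "bij (g u)" for u unfolding g_def by (rule bij_plus_right)
  qed (simp add: g_def C)
  also have "(\<lambda>x. sgn (fibre_map g 1 x)) ` prod.swap ` A =
      prod.swap ` (\<lambda>(z, w). sgn (z, w + of_real (cmod z) * D (sgn z))) ` A"
  proof -
    have "sgn (fibre_map g 1 (prod.swap (z, w))) = prod.swap (sgn (z, w + of_real (cmod z) * D (sgn z)))" for z w
      by (simp add: fibre_map_def g_def sgn_div_norm norm_Pair add.commute distrib_left)
    then have "sgn (fibre_map g 1 (prod.swap x)) = prod.swap ((\<lambda>(z, w). sgn (z, w + of_real (cmod z) * D (sgn z))) x)" for x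
      by (cases x) simp
    then show ?thesis unfolding image_image by simp
  qed
  finally show "ambient_isotopic S3 (prod.swap ` A)
      (prod.swap ` (\<lambda>(z, w). sgn (z, w + of_real (cmod z) * D (sgn z))) ` A)" .
qed

fun shift_gen :: "nat \<Rightarrow> artin_gen \<Rightarrow> artin_gen" where
  "shift_gen k (Sigma i) = Sigma (i + k)"
| "shift_gen k (SigmaInv i) = SigmaInv (i + k)"

abbreviation shift_word :: "nat \<Rightarrow> braid_word \<Rightarrow> braid_word" where
  "shift_word k \<equiv> map (shift_gen k)"

lemma gen_index_shift [simp]: "gen_index (shift_gen k g) = gen_index g + k"
  by (cases g) auto

lemma valid_shift: "valid m w \<Longrightarrow> valid (m + k) (shift_word k w)"
  by (auto simp: valid_def)

lemma word_perm_shift: "word_perm (shift_word 1 w) (Suc x) = Suc (word_perm w x)"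
proof (induction w arbitrary: x)
  case (Cons g w)
  have "gen_swap (shift_gen 1 g) (Suc x) = Suc (gen_swap g x)" by (simp add: gen_swap_def)
  then show ?case using Cons by simp
qed simp

lemma word_path_shift: "word_path (shift_word 1 w) t (Suc x) = word_path w t x + 1"
proof (induction w arbitrary: x t)
  case (Cons g w)
  have "gen_swap (shift_gen 1 g) (Suc x) = Suc (gen_swap g x)" by (simp add: gen_swap_def)
  moreover have "gen_path (shift_gen 1 g) s (Suc x) = gen_path g s x + 1" for s
    by (cases g) auto
  ultimately show ?case using Cons by (simp add: joinpaths_def)
qed simp

lemma word_perm_0: "valid m w \<Longrightarrow> word_perm w 0 = 0"
  by (induction w) (auto simp: gen_swap_def)

lemma word_path_0: "valid m w \<Longrightarrow> word_path w t 0 = 0"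
proof (induction w arbitrary: t)
  case (Cons g w)
  then have "gen_swap g 0 = 0" by (simp add: gen_swap_def)
  moreover have "gen_path g s 0 = 0" for s
    using Cons.prems by (cases g) auto
  ultimately show ?case using Cons by (simp add: joinpaths_def)
qed simp

text \<open>Relative to the point 1/2 the real part is at least 1/2 and so dominates the imaginary
  part. All strands of \<open>w\<close> thus lie in the sector where the later shear is
  trivial.\<close>

lemma word_path_sector:
  assumes "valid m w" "1 \<le> x"
  shows "1 \<le> Re (word_path w t x) \<and> \<bar>Im (word_path w t x)\<bar> \<le> 1/2"
  using assms
proof (induction w arbitrary: x t)
  case (Cons g w)
  have "1 \<le> Re (gen_path g s x) \<and> \<bar>Im (gen_path g s x)\<bar> \<le> 1/2" for s
  proof -
    define c where "c = cos (pi * s)"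
    have "-1 \<le> c" "c \<le> 1" by (simp_all add: c_def)
    then show ?thesis using Cons.prems by (cases g) (auto simp: c_def[symmetric])
  qed
  moreover have "1 \<le> gen_swap g x" using Cons.prems by (simp add: gen_swap_def)
  ultimately show ?case using Cons by (simp add: joinpaths_def)
qed simp

lemma continuous_on_half_cases:
  fixes f g :: "real \<Rightarrow> real \<Rightarrow> 'a::topological_space"
  assumes "continuous_on ({0..1} \<times> {0..1/2}) (\<lambda>(r, t). f r t)"
    and "continuous_on ({0..1} \<times> {1/2..1}) (\<lambda>(r, t). g r t)"
    and meet: "\<And>r. r \<in> {0..1} \<Longrightarrow> f r (1/2) = g r (1/2)"
  shows "continuous_on ({0..1} \<times> {0..1}) (\<lambda>(r, t). if t \<le> 1/2 then f r t else g r t)"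
proof -
  have eq: "{0..1} \<times> {0..1} = {0..1::real} \<times> {0..1/2::real} \<union> {0..1} \<times> {1/2..1}" by auto
  have "continuous_on ({0..1} \<times> {0..1/2} \<union> {0..1} \<times> {1/2..1})
      (\<lambda>p. if snd p \<le> 1/2 then f (fst p) (snd p) else g (fst p) (snd p))"
  proof (rule continuous_on_cases)
    have "p \<in> {0..1} \<times> {0..1/2} \<and> \<not> snd p \<le> 1/2 \<or> p \<in> {0..1} \<times> {1/2..1} \<and> snd p \<le> 1/2 \<Longrightarrow>
        snd p = 1/2 \<and> fst p \<in> {0..1}" for p :: "real \<times> real" by auto
    then show "\<forall>p. p \<in> {0..1} \<times> {0..1/2} \<and> \<not> snd p \<le> 1/2 \<or> p \<in> {0..1} \<times> {1/2..1} \<and> snd p \<le> 1/2 \<longrightarrow>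
        f (fst p) (snd p) = g (fst p) (snd p)"
      using meet by metis
  qed (use assms in \<open>auto simp: case_prod_unfold intro!: closed_Times\<close>)
  then show ?thesis by (simp add: eq case_prod_unfold)
qed

section \<open>Left destabilisation\<close>

text \<open>The parameter counts clockwise full turns, so a positive crossing advances both of its
  strands by 1/2.\<close>

definition turn :: "real \<Rightarrow> complex" where "turn u = cis (- (2 * pi * u)) / 2"

lemma norm_turn [simp]: "norm (turn u) = 1/2" by (simp add: turn_def norm_divide)

lemma turn_values: "turn 0 = 1/2" "turn 1 = 1/2" "turn (1/2) = -1/2"
  by (simp_all add: turn_def complex_eq_iff)

lemma continuous_on_turn [continuous_intros]:
  "continuous_on S f \<Longrightarrow> continuous_on S (\<lambda>x. turn (f x))"
  unfolding turn_def cis_conv_exp by (intro continuous_intros) auto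

lemma turn_eq: 
  assumes "turn a = turn b" "0 < b - a" "b - a < 1" shows False
proof -
  have "cis (- (2 * pi * a)) = cis (- (2 * pi * b))" using assms by (simp add: turn_def)
  then have "cis (- (2 * pi * a)) * cis (2 * pi * b) = cis (- (2 * pi * b)) * cis (2 * pi * b)" by simp
  then have "cis (2 * pi * (b - a)) = 1" by (simp add: cis_mult algebra_simps)
  then have "cos (2 * pi * (b - a)) = 1" by (simp add: complex_eq_iff)
  then obtain k :: int where k: "2 * pi * (b - a) = of_int k * 2 * pi" using cos_one_2pi_int by auto
  then have "b - a = of_int k" by simp
  then show False using assms(2,3) by simp
qed

lemma Re_turn_neg: "1/4 < u \<Longrightarrow> u < 3/4 \<Longrightarrow> Re (turn u) < 0"
proof -
  assume u: "1/4 < u" "u < 3/4"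
  have "0 < cos (2 * pi * u - pi)"
    by (rule cos_gt_zero_pi) (use u in \<open>auto simp: field_simps\<close>)
  then show ?thesis by (simp add: turn_def cos_diff)
qed

context
  fixes m :: nat and w :: braid_word
  assumes w: "valid m w" and m: "1 \<le> m"
begin

text \<open>
  All positions are relative to the centre of the last crossing.  At \<open>r = 0\<close> the first strand waits
  at \<open>turn (1/2)\<close> for half of the time; at \<open>r = 1\<close> its rotation is spread uniformly over the time.
\<close>

definition stab_path :: "real \<Rightarrow> real \<Rightarrow> nat \<Rightarrow> complex" where
  "stab_path r t x =
    (if x = 0 then turn ((1 - r) * max (1/2) t + r * (1/3 + 2 * t / 3))
     else if t \<le> 1/2 then word_path w (2 * t) x - 1/2
     else if word_perm w x = 1 then turn ((1 - r) * (t - 1/2) + r * (2 * t - 1) / 3)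
     else of_nat (word_perm w x) - 1/2)"

lemma word_perm_pos: "1 \<le> x \<Longrightarrow> 1 \<le> word_perm w x"
  using w
proof (induction w arbitrary: x)
  case (Cons g w)
  then have "1 \<le> gen_swap g x" by (simp add: gen_swap_def)
  then show ?case using Cons by simp
qed simp

lemma word_path_ends: "word_path w 0 x = of_nat x" "word_path w 1 x = of_nat (word_perm w x)"
  using word_path(3,4)[OF w] by (simp_all add: pathstart_def pathfinish_def)

lemma continuous_on_word_path_coord:
  assumes "continuous_on S f" "f ` S \<subseteq> {0..1}"
  shows "continuous_on S (\<lambda>p. word_path w (f p) x)"
proof -
  have "continuous_on {0..1} (\<lambda>t. word_path w t x)"
    using word_path(1)[OF w] by (auto simp: path_def intro: continuous_on_product_then_coordinatewise)
  from continuous_on_compose2[OF this assms] show ?thesis by simp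
qed

lemma inj_word_path:
  assumes "t \<in> {0..1}" shows "inj_on (word_path w t) {1..m}"
  using subsetD[OF word_path(2)[OF w], of "word_path w t"] assms by (simp add: path_image_def conf_def)

text \<open>In the first half of the time strand 0 has a parameter between 1/3 and 2/3 and lies in
  the left half plane, all others in the right one. In the second half the two strands on the circle
  are \<open>1/2 + r / 6\<close> turns apart, and the others lie outside the circle. At
  \<open>r = 1\<close> the two strands together make one turn within 3/2 units of time, which
  explains the speed 2/3 and the value 1/3.\<close>

lemma stab_isotopy:
  "ambient_isotopic S3 (slice_closure (\<lambda>t. stab_path 0 t ` {0..m})) (slice_closure (\<lambda>t. stab_path 1 t ` {0..m}))"
proof (rule braid_isotopy)
  \<comment> \<open>Here \<open>Sigma 0\<close> is only the transposition of the labels 0 and 1: the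
    added strand gets the label 0, so that the others keep their labels from
    \<open>w\<close>.\<close>
  define \<pi> where "\<pi> = gen_swap (Sigma 0) \<circ> word_perm w"
  have "bij_betw (word_perm w) {0..m} {0..m}"
  proof -
    have "bij_betw (word_perm w) (insert 0 {1..m}) (insert 0 {1..m})"
      using bij_betw_combine[OF _ word_perm_bij[OF w], of "{0}" "{0}"] word_perm_0[OF w]
      by (simp add: bij_betw_def)
    moreover have "insert 0 {1..m} = {0..m}" by auto
    ultimately show ?thesis by simp
  qed
  moreover have "bij_betw (gen_swap (Sigma 0)) {0..m} {0..m}"
    using m by (intro bij_betw_byWitness[where f' = "gen_swap (Sigma 0)"]) (auto simp: gen_swap_def)
  ultimately show "bij_betw \<pi> {0..m} {0..m}" unfolding \<pi>_def by (rule bij_betw_trans)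
  show "stab_path r 1 x = stab_path r 0 (\<pi> x)" if "r \<in> {0..1}" "x \<in> {0..m}" for r x
  proof -
    have half: "(1 - r) * max (1/2) 1 + r * (1/3 + 2 * 1 / 3) = 1" by (simp add: max_def)
    show ?thesis
    proof (cases "x = 0")
      case True
      then have "\<pi> x = 1" using word_perm_0[OF w] by (simp add: \<pi>_def gen_swap_def)
      then show ?thesis using True half by (simp add: stab_path_def word_path_ends turn_values)
    next
      case False
      then have "word_perm w x \<noteq> 0" using word_perm_pos[of x] by simp
      then show ?thesis using False
        by (auto simp: \<pi>_def gen_swap_def stab_path_def word_path_ends turn_values One_nat_def)
    qed
  qed
next
  fix x assume "x \<in> {0..m}"
  show "continuous_on ({0..1} \<times> {0..1}) (\<lambda>(r, t). stab_path r t x)"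
  proof (cases "x = 0")
    case True
    then show ?thesis
      by (auto simp: stab_path_def case_prod_unfold intro!: continuous_intros)
  next
    case x: False
    have 1: "continuous_on ({0..1} \<times> {0..1/2}) (\<lambda>(r :: real, t). word_path w (2 * t) x - 1/2)"
      by (auto simp: case_prod_unfold intro!: continuous_intros continuous_on_word_path_coord)
    show ?thesis
    proof (cases "word_perm w x = 1")
      case True
      have "continuous_on ({0..1} \<times> {0..1}) (\<lambda>(r, t). if t \<le> 1/2 then word_path w (2 * t) x - 1/2
          else turn ((1 - r) * (t - 1/2) + r * (2 * t - 1) / 3))"
        by (rule continuous_on_half_cases[OF 1])
          (auto simp: case_prod_unfold True word_path_ends turn_values intro!: continuous_intros)
      then show ?thesis using x True by (simp add: stab_path_def cong: if_cong)
    next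
      case False
      have "continuous_on ({0..1} \<times> {0..1}) (\<lambda>(r :: real, t). if t \<le> 1/2 then word_path w (2 * t) x - 1/2
          else of_nat (word_perm w x) - 1/2)"
        by (rule continuous_on_half_cases[OF 1])
          (auto simp: case_prod_unfold word_path_ends intro!: continuous_intros)
      then show ?thesis using x False by (simp add: stab_path_def cong: if_cong)
    qed
  qed
next
  fix r t :: real assume r: "r \<in> {0..1}" and t: "t \<in> {0..1}"
  have inj: "inj_on (stab_path r t) {1..m}"
  proof (cases "t \<le> 1/2")
    case True
    have "inj_on (\<lambda>x. word_path w (2 * t) x - 1/2) {1..m}"
    proof (rule inj_onI)
      fix x y assume "x \<in> {1..m}" "y \<in> {1..m}" "word_path w (2 * t) x - 1/2 = word_path w (2 * t) y - 1/2"
      then show "x = y" using inj_onD[OF inj_word_path[of "2 * t"], of x y] True t by simp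
    qed
    moreover have "stab_path r t x = word_path w (2 * t) x - 1/2" if "x \<in> {1..m}" for x
      using that True by (auto simp: stab_path_def)
    ultimately show ?thesis by (subst inj_on_cong) auto
  next
    case False
    define c where "c = turn ((1 - r) * (t - 1/2) + r * (2 * t - 1) / 3)"
    define h where "h k = (if k = 1 then c else of_nat k - 1/2)" for k :: nat
    \<comment> \<open>From \<open>k = 2\<close> on these points have modulus at least 3/2, while
      \<open>c\<close> lies on the circle of radius 1/2.\<close>
    have "of_nat k - 1/2 \<noteq> c" if "k \<ge> 2" for k
    proof
      assume "of_nat k - 1/2 = c"
      then have "norm (of_real (real k - 1/2) :: complex) = 1/2" by (simp add: c_def)
      then show False using that unfolding norm_of_real by simp
    qed
    then have ck: "of_nat k - 1/2 \<noteq> c" "c \<noteq> of_nat k - 1/2" if "1 \<le> k" "k \<noteq> 1" for k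
      using that by (metis One_nat_def Suc_1 Suc_leI le_neq_implies_less)+
    have "inj_on h {1..m}"
      by (rule inj_onI) (use ck in \<open>auto simp: h_def split: if_splits\<close>)
    then have "inj_on (h \<circ> word_perm w) {1..m}"
      using word_perm_bij[OF w] by (auto simp: bij_betw_def intro: comp_inj_on)
    moreover have "stab_path r t x = (h \<circ> word_perm w) x" if "x \<in> {1..m}" for x
      using that False by (auto simp: stab_path_def h_def c_def)
    ultimately show ?thesis by (subst inj_on_cong) auto
  qed
  have ne: "stab_path r t 0 \<noteq> stab_path r t x" if x: "x \<in> {1..m}" for x
  proof (cases "t \<le> 1/2")
    case True
    have "stab_path r t 0 = turn ((1 - r) * (1/2) + r * (1/3 + 2 * t / 3))"
      using True by (simp add: stab_path_def)
    moreover have "Re \<dots> < 0"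
    proof (rule Re_turn_neg)
      have r01: "0 \<le> r" "r \<le> 1" using r by auto
      define v where "v = r * (1/3 + 2 * t / 3)"
      have "r * (1/3) \<le> v" "v \<le> r * (2/3)"
        unfolding v_def using r t True by (intro mult_left_mono; simp)+
      moreover have e: "(1 - r) * (1/2) + v = 1/2 - r / 2 + v" by (simp add: field_simps)
      ultimately show "1/4 < (1 - r) * (1/2) + r * (1/3 + 2 * t / 3)" "(1 - r) * (1/2) + r * (1/3 + 2 * t / 3) < 3/4"
        unfolding v_def[symmetric] e using r01 by - linarith+
    qed
    moreover have "0 < Re (stab_path r t x)"
      using word_path_sector[OF w, of x "2 * t"] x True by (simp add: stab_path_def)
    ultimately show ?thesis by auto
  next
    case False
    show ?thesis
    proof (cases "word_perm w x = 1")
      case True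
      define a b where "a = (1 - r) * (t - 1/2) + r * (2 * t - 1) / 3" and "b = (1 - r) * t + r * (1/3 + 2 * t / 3)"
      have "b - a = 1/2 + r / 6" by (simp add: a_def b_def field_simps)
      then have "turn a \<noteq> turn b" using turn_eq[of a b] r by auto
      then show ?thesis using x False True by (simp add: stab_path_def a_def b_def)
    next
      case ne: False
      then have "2 \<le> word_perm w x" using word_perm_pos[of x] x by simp
      then have "norm (of_real (real (word_perm w x) - 1/2) :: complex) \<noteq> 1/2"
        unfolding norm_of_real by simp
      then have "norm (stab_path r t x) \<noteq> norm (stab_path r t 0)"
        using x False ne by (simp add: stab_path_def)
      then show ?thesis by metis
    qed
  qed
  have "inj_on (stab_path r t) (insert 0 {1..m})"
    using inj ne by (auto simp: inj_on_insert) metis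
  moreover have "insert 0 {1..m} = {0..m}" by auto
  ultimately show "inj_on (stab_path r t) {0..m}" by simp
qed simp

lemma stab_closure:
  "ambient_isotopic S3 (braid_closure (Suc m) (shift_word 1 w @ [Sigma 1])) (slice_closure (\<lambda>t. stab_path 0 t ` {0..m}))"
proof -
  define W where "W = shift_word 1 w"
  have W: "valid (Suc m) W" using valid_shift[OF w, of 1] by (simp add: W_def Suc_eq_plus1)
  have s: "valid (Suc m) [Sigma 1]" using m by simp
  have WS: "valid (Suc m) (W @ [Sigma 1])" using W s by simp
  define p where "p = word_path W +++ (\<lambda>t. gen_path (Sigma 1) t \<circ> word_perm W)"
  have b: "bij_betw (word_perm W) {1..Suc m} {1..Suc m}" by (rule word_perm_bij[OF W])
  have "homotopic_paths (conf {1..Suc m}) (gen_path (Sigma 1)) (word_path [Sigma 1])"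
    using homotopic_paths_rid_const[of "gen_path (Sigma 1)" "conf {1..Suc m}"] gen_path_conf_path[of "Sigma 1"]
    by simp
  then have "homotopic_paths (conf {1..Suc m}) (word_path (W @ [Sigma 1])) p"
    unfolding p_def using word_path_append[OF W s] word_path[OF W] word_path_relabel[OF s b]
    by (elim homotopic_paths_trans)
      (intro homotopic_paths_join homotopic_paths_relabel[OF _ b], auto simp: homotopic_paths_sym)
  then have "ambient_isotopic S3 (slice_closure (\<lambda>t. word_path (W @ [Sigma 1]) t ` {1..Suc m})) (slice_closure (\<lambda>t. p t ` {1..Suc m}))"
    using word_path(3,4)[OF WS]
    by (intro homotopic_closure[OF _ _ word_perm_bij[OF WS]]) (auto simp: pathstart_def pathfinish_def)
  \<comment> \<open>The crossing \<open>Sigma 1\<close> has its centre at 3/2. In the coordinates of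
    \<open>w\<close>, which are smaller by one, this is the point 1/2.\<close>
  also have "ambient_isotopic S3 \<dots> (slice_closure (\<lambda>t. (\<lambda>z. z + - (3/2)) ` p t ` {1..Suc m}))"
    by (rule slice_closure_translate)
  also have "\<dots> = slice_closure (\<lambda>t. stab_path 0 t ` {0..m})"
  proof (rule slice_closure_cong)
    fix t :: real assume t: "0 \<le> t" "t < 1"
    have "p t (Suc x) - 3/2 = stab_path 0 t x" if "x \<in> {0..m}" for x
    proof (cases "t \<le> 1/2")
      case True
      then have "p t (Suc x) - 3/2 = word_path w (2 * t) x - 1/2"
        using word_path_shift[of w "2 * t" x] by (simp add: p_def W_def joinpaths_def)
      then show ?thesis using True word_path_0[OF w] by (auto simp: stab_path_def turn_values)
    next
      case False
      have half: "2 * pi * t = pi * (2 * t - 1) + pi" "2 * pi * (t - 1/2) = pi * (2 * t - 1)"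
        by (simp_all add: algebra_simps)
      have "p t (Suc x) - 3/2 = gen_path (Sigma 1) (2 * t - 1) (Suc (word_perm w x)) - 3/2"
        using False word_perm_shift[of w x] by (simp add: p_def W_def joinpaths_def)
      then show ?thesis
        using False word_perm_0[OF w] word_perm_pos[of x] 
        by (auto simp: stab_path_def turn_def half complex_eq_iff)
    qed
    then have "(\<lambda>x. p t (Suc x) + - (3/2)) ` {0..m} = stab_path 0 t ` {0..m}" by (intro image_cong) auto
    moreover have "{1..Suc m} = Suc ` {0..m}" by (simp add: image_Suc_atLeastAtMost One_nat_def)
    ultimately show "(\<lambda>z. z + - (3/2)) ` p t ` {1..Suc m} = stab_path 0 t ` {0..m}"
      by (simp only: image_image)
  qed
  finally have "ambient_isotopic S3 (slice_closure (\<lambda>t. word_path (W @ [Sigma 1]) t ` {1..Suc m}))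
    (slice_closure (\<lambda>t. stab_path 0 t ` {0..m}))" .
  with word_path_closure[OF WS] show ?thesis unfolding W_def by (rule ambient_isotopic_trans)
qed

section \<open>The arc that is pulled across the axis\<close>

text \<open>
  On the circle the stabilised strand is at \<open>turn u\<close> at time \<open>1/2 + 3u/2\<close>, thus winding once more
  around the braid axis than the strand which is at \<open>turn u\<close> at time \<open>1/2 + new_time u\<close>.  Both times
  agree modulo 1 in the sector \<open>\<bar>arg\<bar> \<le> pi/4\<close>, which contains all other strands.
\<close>

definition new_time :: "real \<Rightarrow> real" where
  "new_time u = max (3 * u / 2 - 1) (min (3 * u / 2) (u / 6 + 1 / 6))"

definition new_turn :: "real \<Rightarrow> real" where
  "new_turn y = min ((y + 1) * 2 / 3) (max (2 * y / 3) (6 * y - 1))"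

text \<open>One eighth of a turn is the angle \<pi>/4. At \<open>u = 1/8\<close> and
  \<open>u = 7/8\<close> the values of \<open>new_time\<close> are 3/16 and 5/16, and a piece of
  slope 1/6 joins them; hence the inverse breaks at 3/16 and 5/16 and has slope 6 in
  between.\<close>

lemma new_time_turn: "new_time (new_turn y) = y" "new_turn (new_time u) = u"
proof -
  consider "y \<le> 3/16" | "3/16 < y" "y < 5/16" | "5/16 \<le> y" by linarith
  then show "new_time (new_turn y) = y"
  proof cases
    case 1
    then have "new_turn y = 2 * y / 3" by (auto simp: new_turn_def max_def min_def)
    then show ?thesis using 1 by (auto simp: new_time_def max_def min_def)
  next
    case 2
    then have "new_turn y = 6 * y - 1" by (auto simp: new_turn_def max_def min_def)
    then show ?thesis using 2 by (auto simp: new_time_def max_def min_def field_simps)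
  next
    case 3
    then have "new_turn y = (y + 1) * 2 / 3" by (auto simp: new_turn_def max_def min_def)
    then show ?thesis using 3 by (auto simp: new_time_def max_def min_def field_simps)
  qed
  consider "u \<le> 1/8" | "1/8 < u" "u < 7/8" | "7/8 \<le> u" by linarith
  then show "new_turn (new_time u) = u"
  proof cases
    case 1
    then have "new_time u = 3 * u / 2" by (auto simp: new_time_def max_def min_def)
    then show ?thesis using 1 by (auto simp: new_turn_def max_def min_def)
  next
    case 2
    then have "new_time u = u / 6 + 1 / 6" by (auto simp: new_time_def max_def min_def)
    then show ?thesis using 2 by (auto simp: new_turn_def max_def min_def field_simps)
  next
    case 3
    then have "new_time u = 3 * u / 2 - 1" by (auto simp: new_time_def max_def min_def)
    then show ?thesis using 3 by (auto simp: new_turn_def max_def min_def field_simps)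
  qed
qed

lemma new_time_bounds: "0 \<le> u \<Longrightarrow> u \<le> 1 \<Longrightarrow> 0 \<le> new_time u \<and> new_time u \<le> 1/2"
  by (auto simp: new_time_def max_def min_def)

lemma new_turn_bounds: "0 \<le> y \<Longrightarrow> y \<le> 1/2 \<Longrightarrow> 0 \<le> new_turn y \<and> new_turn y \<le> 1"
  by (auto simp: new_turn_def max_def min_def)

definition destab_path :: "real \<Rightarrow> real \<Rightarrow> nat \<Rightarrow> complex" where
  "destab_path r t x =
    (if t \<le> 1/2 then word_path w (2 * t) x - 1/2
     else if word_perm w x = 1 then of_real (1 - r) * turn (new_turn (t - 1/2)) + of_real r / 2
     else of_nat (word_perm w x) - 1/2)"

text \<open>The part shared by the links before and after the shear. What remains of either link is
  a single arc in which every direction of the circle occurs once, except that both ends have the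
  same direction.\<close>

definition other_strands :: "(complex \<times> complex) set" where
  "other_strands =
    {solid_torus_to_S3 (word_path w (2 * t) x - 1/2) t | t x. 0 \<le> t \<and> t \<le> 1/2 \<and> x \<in> {1..m}} \<union>
    {solid_torus_to_S3 (of_nat k - 1/2) t | t k. 1/2 \<le> t \<and> t \<le> 1 \<and> k \<in> {2..m}}"

lemma word_perm_onto:
  assumes "k \<in> {1..m}"
  shows "\<exists>x\<in>{1..m}. word_perm w x = k"
proof -
  have "k \<in> word_perm w ` {1..m}" using word_perm_bij[OF w] assms by (simp add: bij_betw_def)
  then show ?thesis by auto
qed

lemma word_perm_range: "x \<in> {1..m} \<Longrightarrow> word_perm w x \<in> {1..m}"
  using word_perm_bij[OF w] by (auto simp: bij_betw_def)

lemma other_strands_closure: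
  assumes Z: "\<And>t x. 0 \<le> t \<Longrightarrow> t \<le> 1/2 \<Longrightarrow> x \<in> {1..m} \<Longrightarrow> word_path w (2 * t) x - 1/2 \<in> Z t"
    and Z': "\<And>t x. 1/2 < t \<Longrightarrow> t < 1 \<Longrightarrow> x \<in> {1..m} \<Longrightarrow> word_perm w x \<noteq> 1 \<Longrightarrow> of_nat (word_perm w x) - 1/2 \<in> Z t"
  shows "other_strands \<subseteq> slice_closure Z"
  unfolding other_strands_def
proof (intro Un_least subsetI)
  fix p assume "p \<in> {solid_torus_to_S3 (word_path w (2 * t) x - 1/2) t | t x. 0 \<le> t \<and> t \<le> 1/2 \<and> x \<in> {1..m}}"
  then show "p \<in> slice_closure Z" using Z by (fastforce simp: slice_closure_def)
next
  fix p assume "p \<in> {solid_torus_to_S3 (of_nat k - 1/2) t | t k. 1/2 \<le> t \<and> t \<le> 1 \<and> k \<in> {2..m}}"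
  then obtain t k where p: "p = solid_torus_to_S3 (of_nat k - 1/2) t" and t: "1/2 \<le> t" "t \<le> 1" and k: "k \<in> {2..m}"
    by auto
  then obtain x where x: "x \<in> {1..m}" "word_perm w x = k" using word_perm_onto[of k] by auto
  consider "t = 1/2" | "t = 1" | "1/2 < t" "t < 1" using t by linarith
  then show "p \<in> slice_closure Z"
  proof cases
    case 1
    have "of_nat k - 1/2 \<in> Z (1/2)" using Z[of "1/2" x] x by (simp add: word_path_ends)
    then show ?thesis unfolding slice_closure_def p 1 by fastforce
  next
    case 2
    have "of_nat k - 1/2 \<in> Z 0" using Z[of 0 k] k by (simp add: word_path_ends)
    moreover have "p = solid_torus_to_S3 (of_nat k - 1/2) 0"
      using solid_torus_to_S3_periodic[of _ 0 1] by (simp add: p 2)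
    ultimately show ?thesis unfolding slice_closure_def by fastforce
  next
    case 3
    have "of_nat k - 1/2 \<in> Z t" using Z'[of t x] 3 x k by auto
    then show ?thesis unfolding slice_closure_def p using 3 by fastforce
  qed
qed

lemma other_strandsI:
  "0 \<le> t \<Longrightarrow> t \<le> 1/2 \<Longrightarrow> x \<in> {1..m} \<Longrightarrow> solid_torus_to_S3 (word_path w (2 * t) x - 1/2) t \<in> other_strands"
  "1/2 \<le> t \<Longrightarrow> t \<le> 1 \<Longrightarrow> k \<in> {2..m} \<Longrightarrow> solid_torus_to_S3 (of_nat k - 1/2) t \<in> other_strands"
  unfolding other_strands_def by blast+

text \<open>The strand arriving in position 1 supplies the parameters from 0 to 1/3, and strand 0,
  which continues it, those from 1/3 to 1. The times run from 1/2 to 2 and count modulo 1; the arc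
  ends where the strand starting in position 1 begins.\<close>

lemma stab_path_closure:
  "slice_closure (\<lambda>t. stab_path 1 t ` {0..m}) =
    other_strands \<union> {solid_torus_to_S3 (turn u) (1/2 + 3 * u / 2) | u. 0 \<le> u \<and> u \<le> 1}" (is "?L = _ \<union> ?A")
proof (intro equalityI Un_least)
  show "?L \<subseteq> other_strands \<union> ?A"
  proof (rule subsetI)
    fix p assume "p \<in> ?L"
    then obtain t x where p: "p = solid_torus_to_S3 (stab_path 1 t x) t" and t: "0 \<le> t" "t < 1" and x: "x \<le> m"
      by (auto simp: slice_closure_def)
    consider "x = 0" | "x \<noteq> 0" "t \<le> 1/2" | "x \<noteq> 0" "t > 1/2" "word_perm w x = 1" | "x \<noteq> 0" "t > 1/2" "word_perm w x \<noteq> 1"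
      by linarith
    then show "p \<in> other_strands \<union> ?A"
    proof cases
      case 1
      define u where "u = 1/3 + 2 * t / 3"
      have "1/2 + 3 * u / 2 = t + of_int 1" by (simp add: u_def field_simps)
      then have "p = solid_torus_to_S3 (turn u) (1/2 + 3 * u / 2)"
        using solid_torus_to_S3_periodic[of "turn u" t 1] 1 by (simp add: p stab_path_def u_def)
      moreover have "0 \<le> u" "u \<le> 1" using t by (simp_all add: u_def)
      ultimately show ?thesis by blast
    next
      case 2
      then show ?thesis using other_strandsI(1)[of t x] t x by (simp add: p stab_path_def)
    next
      case 3
      define u where "u = (2 * t - 1) / 3"
      have "1/2 + 3 * u / 2 = t" by (simp add: u_def field_simps)
      then have "p = solid_torus_to_S3 (turn u) (1/2 + 3 * u / 2)" using 3 by (simp add: p stab_path_def u_def)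
      moreover have "0 \<le> u" "u \<le> 1" using t 3 by (simp_all add: u_def)
      ultimately show ?thesis by blast
    next
      case 4
      then show ?thesis
        using other_strandsI(2)[of t "word_perm w x"] word_perm_range[of x] t x by (simp add: p stab_path_def)
    qed
  qed
next
  show "other_strands \<subseteq> ?L"
  proof (rule other_strands_closure)
    show "word_path w (2 * t) x - 1/2 \<in> stab_path 1 t ` {0..m}" if "0 \<le> t" "t \<le> 1/2" "x \<in> {1..m}" for t x
      using that by (intro image_eqI[of _ _ x]) (auto simp: stab_path_def)
    show "of_nat (word_perm w x) - 1/2 \<in> stab_path 1 t ` {0..m}"
      if "1/2 < t" "t < 1" "x \<in> {1..m}" "word_perm w x \<noteq> 1" for t x
      using that by (intro image_eqI[of _ _ x]) (auto simp: stab_path_def)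
  qed
next
  show "?A \<subseteq> ?L"
  proof (rule subsetI)
    fix p assume "p \<in> ?A"
    then obtain u where p: "p = solid_torus_to_S3 (turn u) (1/2 + 3 * u / 2)" and u: "0 \<le> u" "u \<le> 1" by auto
    obtain x where x: "x \<in> {1..m}" "word_perm w x = 1" using word_perm_onto[of 1] m by auto
    have "\<exists>t k. 0 \<le> t \<and> t < 1 \<and> k \<in> {0..m} \<and> p = solid_torus_to_S3 (stab_path 1 t k) t"
    proof -
      consider "u < 1/3" | "1/3 \<le> u" "u < 1" | "u = 1" using u by linarith
      then show ?thesis
      proof cases
        case 1
        define t where "t = 1/2 + 3 * u / 2"
        have "stab_path 1 t x = turn u"
        proof (cases "u = 0")
          case True
          then show ?thesis using x by (simp add: stab_path_def t_def word_path_ends turn_values)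
        next
          case False
          then show ?thesis using x u by (simp add: stab_path_def t_def)
        qed
        then show ?thesis using 1 u x by (intro exI[of _ t] exI[of _ x]) (auto simp: p t_def)
      next
        case 2
        define t where "t = 3 * u / 2 - 1/2"
        have tu: "1/2 + 3 * u / 2 = t + of_int 1" by (simp add: t_def)
        have "p = solid_torus_to_S3 (turn u) t" unfolding p tu by (rule solid_torus_to_S3_periodic)
        moreover have "1/3 + 2 * t / 3 = u" by (simp add: t_def field_simps)
        then have "stab_path 1 t 0 = turn u" by (simp add: stab_path_def)
        ultimately show ?thesis using 2 by (intro exI[of _ t] exI[of _ 0]) (auto simp: t_def)
      next
        case 3
        have "p = solid_torus_to_S3 (1/2) 0"
          using solid_torus_to_S3_periodic[of "1/2" 0 2] 3 by (simp add: p turn_values)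
        moreover have "stab_path 1 0 1 = 1/2" by (simp add: stab_path_def word_path_ends)
        ultimately have "p = solid_torus_to_S3 (stab_path 1 0 1) 0" by (simp only:)
        then show ?thesis using m by (intro exI[of _ "0 :: real"] exI[of _ "1 :: nat"]) auto
      qed
    qed
    then show "p \<in> ?L" unfolding slice_closure_def by blast
  qed
qed

lemma destab_path_closure:
  "slice_closure (\<lambda>t. destab_path 0 t ` {1..m}) =
    other_strands \<union> {solid_torus_to_S3 (turn u) (1/2 + new_time u) | u. 0 \<le> u \<and> u \<le> 1}" (is "?L = _ \<union> ?A")
proof (intro equalityI Un_least)
  show "?L \<subseteq> other_strands \<union> ?A"
  proof (rule subsetI)
    fix p assume "p \<in> ?L"
    then obtain t x where p: "p = solid_torus_to_S3 (destab_path 0 t x) t" and t: "0 \<le> t" "t < 1" and x: "x \<in> {1..m}"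
      by (auto simp: slice_closure_def)
    consider "t \<le> 1/2" | "t > 1/2" "word_perm w x = 1" | "t > 1/2" "word_perm w x \<noteq> 1"
      by linarith
    then show "p \<in> other_strands \<union> ?A"
    proof cases
      case 1
      then show ?thesis using other_strandsI(1)[of t x] t x by (simp add: p destab_path_def)
    next
      case 2
      define u where "u = new_turn (t - 1/2)"
      have "p = solid_torus_to_S3 (turn u) (1/2 + new_time u)"
        using 2 by (simp add: p destab_path_def u_def new_time_turn)
      moreover have "0 \<le> u \<and> u \<le> 1" unfolding u_def using t 2 by (intro new_turn_bounds) auto
      ultimately show ?thesis by blast
    next
      case 3
      then show ?thesis
        using other_strandsI(2)[of t "word_perm w x"] word_perm_range[of x] t x by (simp add: p destab_path_def)
    qed
  qed
next
  show "other_strands \<subseteq> ?L"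
  proof (rule other_strands_closure)
    show "word_path w (2 * t) x - 1/2 \<in> destab_path 0 t ` {1..m}" if "0 \<le> t" "t \<le> 1/2" "x \<in> {1..m}" for t x
      using that by (intro image_eqI[of _ _ x]) (auto simp: destab_path_def)
    show "of_nat (word_perm w x) - 1/2 \<in> destab_path 0 t ` {1..m}"
      if "1/2 < t" "t < 1" "x \<in> {1..m}" "word_perm w x \<noteq> 1" for t x
      using that by (intro image_eqI[of _ _ x]) (auto simp: destab_path_def)
  qed
next
  show "?A \<subseteq> ?L"
  proof (rule subsetI)
    fix p assume "p \<in> ?A"
    then obtain u where p: "p = solid_torus_to_S3 (turn u) (1/2 + new_time u)" and u: "0 \<le> u" "u \<le> 1" by auto
    obtain x where x: "x \<in> {1..m}" "word_perm w x = 1" using word_perm_onto[of 1] m by auto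
    define t where "t = 1/2 + new_time u"
    have pt: "p = solid_torus_to_S3 (turn u) t" by (simp add: p t_def)
    have ut: "u = new_turn (t - 1/2)" by (simp add: t_def new_time_turn)
    have "1/2 \<le> t" "t \<le> 1" using new_time_bounds[OF u] by (simp_all add: t_def)
    then consider "t = 1/2" | "1/2 < t" "t < 1" | "t = 1" by linarith
    then have "\<exists>t k. 0 \<le> t \<and> t < 1 \<and> k \<in> {1..m} \<and> p = solid_torus_to_S3 (destab_path 0 t k) t"
    proof cases
      case 1
      then have "u = 0" using ut by (simp add: new_turn_def)
      then have "p = solid_torus_to_S3 (1/2) (1/2)" using pt 1 by (simp only: turn_values)
      then show ?thesis using x
        by (intro exI[of _ "1/2 :: real"] exI[of _ x]) (auto simp: destab_path_def word_path_ends turn_values)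
    next
      case 2
      then show ?thesis using x
        by (intro exI[of _ t] exI[of _ x]) (auto simp: pt ut[symmetric] destab_path_def)
    next
      case 3
      then have "u = 1" using ut by (simp add: new_turn_def)
      then have "p = solid_torus_to_S3 (1/2) 0"
        using solid_torus_to_S3_periodic[of "1/2" 0 1] 3 by (simp add: pt turn_values)
        moreover have "destab_path 0 0 1 = 1/2" by (simp add: destab_path_def word_path_ends)
        ultimately have "p = solid_torus_to_S3 (destab_path 0 0 1) 0" by (simp only:)
        then show ?thesis using m by (intro exI[of _ "0 :: real"] exI[of _ "1 :: nat"]) auto
    qed
    then show "p \<in> ?L" unfolding slice_closure_def by blast
  qed
qed

text \<open>The shear multiplies its translation vector by \<open>cmod z\<close>, which is 1/2 on
  the arc; the factor 2 compensates this.\<close>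

definition time_change :: "real \<Rightarrow> complex" where
  "time_change u = 2 * (cis (2 * pi * (1/2 + new_time u)) - cis (2 * pi * (1/2 + 3 * u / 2)))"

lemma time_change_0: "0 \<le> u \<and> u \<le> 1/8 \<or> 7/8 \<le> u \<and> u \<le> 1 \<Longrightarrow> time_change u = 0"
proof (elim disjE conjE)
  assume "0 \<le> u" "u \<le> 1/8"
  then have "new_time u = 3 * u / 2" by (auto simp: new_time_def max_def min_def)
  then show ?thesis unfolding time_change_def by (simp only: diff_self mult_zero_right)
next
  assume "7/8 \<le> u" "u \<le> 1"
  then have "3 * u / 2 = new_time u + 1" by (auto simp: new_time_def max_def min_def)
  then have "2 * pi * (1/2 + 3 * u / 2) = 2 * pi * (1/2 + new_time u) + 2 * pi"
    by (simp only:) (simp add: algebra_simps)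
  then show ?thesis by (simp add: time_change_def complex_eq_iff)
qed

text \<open>\<open>turn\<close> runs clockwise and \<open>Arg2pi\<close> counterclockwise, whence
  the difference from 1.\<close>

definition shear :: "complex \<Rightarrow> complex" where
  "shear \<xi> = time_change (1 - Arg2pi \<xi> / (2 * pi))"

lemma continuous_on_shear: "continuous_on (sphere 0 1) shear"
proof -
  have "continuous_on ({0..1} \<times> UNIV) (\<lambda>(t :: real, x :: complex). time_change (1 - t))"
    unfolding time_change_def new_time_def cis_conv_exp case_prod_unfold by (intro continuous_intros) auto
  then have "continuous_on (sphere 0 1 \<times> UNIV) (\<lambda>(u, x :: complex). time_change (1 - Arg2pi u / (2 * pi)))"
    by (rule continuous_on_circle) (simp add: time_change_0)
  then have "continuous_on (sphere 0 1) (\<lambda>u. (\<lambda>(u, x :: complex). time_change (1 - Arg2pi u / (2 * pi))) (u, 0))"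
    by (rule continuous_on_compose2) (auto intro!: continuous_intros)
  then show ?thesis by (simp add: shear_def[abs_def])
qed

lemma shear_turn:
  assumes "0 \<le> u" "u \<le> 1" shows "shear (sgn (turn u)) = time_change u"
proof -
  have s: "sgn (turn u) = cis (- (2 * pi * u))" by (simp add: sgn_div_norm turn_def norm_divide scaleR_conv_of_real)
  show ?thesis
  proof (cases "u = 0")
    case True
    moreover have "Arg2pi 1 = 0" using Arg2pi_of_real[of 1] by simp
    ultimately show ?thesis unfolding s by (simp add: shear_def time_change_0)
  next
    case False
    have "cis (- (2 * pi * u)) = cis (2 * pi * (1 - u))"
      by (simp add: complex_eq_iff algebra_simps cos_diff sin_diff)
    moreover have "Arg2pi (cis (2 * pi * (1 - u))) = 2 * pi * (1 - u)"
      using assms False by (intro Arg2pi_cis) auto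
    ultimately show ?thesis unfolding s by (simp add: shear_def)
  qed
qed

text \<open>The assumptions bound the argument of \<open>z\<close> by \<pi>/4 in absolute value. The
  parameter is then within 1/8 of 0 or 1, where the two times agree modulo 1.\<close>

lemma shear_sector:
  assumes "0 < Re z" "\<bar>Im z\<bar> \<le> Re z" shows "shear (sgn z) = 0"
proof -
  define a where "a = Arg2pi (sgn z)"
  have z: "z \<noteq> 0" using assms by auto
  then have "sgn z = cis a" using Arg2pi_eq[of "sgn z"] by (simp add: a_def cis_conv_exp norm_sgn)
  then have c: "cos a = Re z / cmod z" by (metis Re_sgn cis.simps(1))
  have a: "0 \<le> a" "a < 2 * pi" using Arg2pi_ge_0 Arg2pi_lt_2pi by (auto simp: a_def)
  have "(cmod z)\<^sup>2 \<le> (sqrt 2 * Re z)\<^sup>2"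
    using assms power_mono[OF assms(2), of 2] by (simp add: cmod_power2 power_mult_distrib)
  then have "cmod z \<le> sqrt 2 * Re z" by (rule power2_le_imp_le) (use assms in auto)
  then have "sqrt 2 * cmod z \<le> sqrt 2 * (sqrt 2 * Re z)" by (intro mult_left_mono) auto
  then have "sqrt 2 * cmod z \<le> 2 * Re z" by (simp add: mult.assoc[symmetric])
  then have c45: "cos (pi / 4) \<le> cos a"
    using z by (simp add: c cos_45 field_simps)
  have "a \<le> pi / 4 \<or> 7 * pi / 4 \<le> a"
  proof (rule ccontr)
    assume n: "\<not> (a \<le> pi / 4 \<or> 7 * pi / 4 \<le> a)"
    have "cos a < cos (pi / 4)"
    proof (cases "a \<le> pi")
      case True
      show ?thesis by (rule cos_monotone_0_pi) (use n True in auto)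
    next
      case False
      have "cos (2 * pi - a) < cos (pi / 4)" by (rule cos_monotone_0_pi) (use n False in auto)
      then show ?thesis by (simp add: cos_diff)
    qed
    with c45 show False by simp
  qed
  then have "a / (2 * pi) \<le> 1/8 \<or> 7/8 \<le> a / (2 * pi)" by (auto simp: field_simps)
  moreover have "0 \<le> a / (2 * pi)" "a / (2 * pi) \<le> 1" using a by (auto simp: field_simps)
  ultimately show ?thesis
    unfolding shear_def a_def[symmetric] by (intro time_change_0) auto
qed

text \<open>Before normalisation the point of the arc over \<open>turn u\<close> has the unit vector
  of its old time as second coordinate, and the shear adds the difference to the unit vector of the
  new time. On the shared strands the shear vanishes.\<close>

lemma shear_closure:
  "ambient_isotopic S3 (slice_closure (\<lambda>t. stab_path 1 t ` {0..m})) (slice_closure (\<lambda>t. destab_path 0 t ` {1..m}))"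
proof -
  define f where "f = (\<lambda>(z, w). sgn (z, w + of_real (cmod z) * shear (sgn z)))"
  have f: "f (solid_torus_to_S3 z t) = sgn (z, cis (2 * pi * t) + of_real (cmod z) * shear (sgn z))" for z t
  proof -
    define c where "c = inverse (norm (z, cis (2 * pi * t)))"
    have "(z, cis (2 * pi * t)) \<noteq> 0" by (simp add: zero_prod_def)
    then have c: "c > 0" by (simp add: c_def)
    have "f (solid_torus_to_S3 z t) = f (c *\<^sub>R z, c *\<^sub>R cis (2 * pi * t))"
      by (simp add: solid_torus_to_S3_sgn sgn_div_norm c_def)
    also have "\<dots> = sgn (c *\<^sub>R (z, cis (2 * pi * t) + of_real (cmod z) * shear (sgn z)))"
    proof -
      have "sgn (c *\<^sub>R z) = sgn z" "cmod (c *\<^sub>R z) = c * cmod z" using c by (simp_all add: sgn_scaleR)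
      then show ?thesis unfolding f_def prod.case
        by (simp only:) (simp add: scaleR_conv_of_real algebra_simps)
    qed
    also have "\<dots> = sgn (z, cis (2 * pi * t) + of_real (cmod z) * shear (sgn z))"
      using c by (simp add: sgn_scaleR del: scaleR_Pair)
    finally show ?thesis .
  qed
  have fix_sector: "f (solid_torus_to_S3 z t) = solid_torus_to_S3 z t" if "0 < Re z" "\<bar>Im z\<bar> \<le> Re z" for z t
    unfolding f shear_sector[OF that] by (simp add: solid_torus_to_S3_sgn)
  have fix_other: "f p = p" if "p \<in> other_strands" for p
    using that unfolding other_strands_def
  proof (elim UnE CollectE exE conjE)
    fix t x assume "p = solid_torus_to_S3 (word_path w (2 * t) x - 1/2) t" "x \<in> {1..m}"
    then show ?thesis using word_path_sector[OF w, of x "2 * t"] by (auto intro!: fix_sector)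
  next
    fix t k assume "p = solid_torus_to_S3 (of_nat k - 1/2) t" "k \<in> {2..m}"
    then show ?thesis by (auto intro!: fix_sector)
  qed
  have arc: "f (solid_torus_to_S3 (turn u) (1/2 + 3 * u / 2)) = solid_torus_to_S3 (turn u) (1/2 + new_time u)"
    if "0 \<le> u" "u \<le> 1" for u
  proof -
    have "f (solid_torus_to_S3 (turn u) (1/2 + 3 * u / 2)) =
        sgn (turn u, cis (2 * pi * (1/2 + 3 * u / 2)) + of_real (cmod (turn u)) * shear (sgn (turn u)))"
      by (rule f)
    also have "\<dots> = sgn (turn u, cis (2 * pi * (1/2 + new_time u)))"
      unfolding shear_turn[OF that] by (simp add: time_change_def diff_divide_distrib)
    finally show ?thesis by (simp only: solid_torus_to_S3_sgn)
  qed
  have "ambient_isotopic S3 (slice_closure (\<lambda>t. stab_path 1 t ` {0..m})) (f ` slice_closure (\<lambda>t. stab_path 1 t ` {0..m}))"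
    unfolding f_def by (rule shear_isotopy[OF continuous_on_shear])
  also have "f ` slice_closure (\<lambda>t. stab_path 1 t ` {0..m}) = slice_closure (\<lambda>t. destab_path 0 t ` {1..m})"
  proof -
    have "f ` other_strands = other_strands" using fix_other by (simp cong: image_cong)
    moreover have "f ` {solid_torus_to_S3 (turn u) (1/2 + 3 * u / 2) | u. 0 \<le> u \<and> u \<le> 1} =
        {solid_torus_to_S3 (turn u) (1/2 + new_time u) | u. 0 \<le> u \<and> u \<le> 1}"
    proof (intro equalityI subsetI)
      fix p assume "p \<in> f ` {solid_torus_to_S3 (turn u) (1/2 + 3 * u / 2) | u. 0 \<le> u \<and> u \<le> 1}"
      then obtain u where "p = f (solid_torus_to_S3 (turn u) (1/2 + 3 * u / 2))" "0 \<le> u" "u \<le> 1" by blast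
      then show "p \<in> {solid_torus_to_S3 (turn u) (1/2 + new_time u) | u. 0 \<le> u \<and> u \<le> 1}"
        using arc by blast
    next
      fix p assume "p \<in> {solid_torus_to_S3 (turn u) (1/2 + new_time u) | u. 0 \<le> u \<and> u \<le> 1}"
      then obtain u where u: "p = solid_torus_to_S3 (turn u) (1/2 + new_time u)" "0 \<le> u" "u \<le> 1" by blast
      have "p = f (solid_torus_to_S3 (turn u) (1/2 + 3 * u / 2))" unfolding u(1) arc[OF u(2,3)] ..
      then show "p \<in> f ` {solid_torus_to_S3 (turn u) (1/2 + 3 * u / 2) | u. 0 \<le> u \<and> u \<le> 1}"
        by (rule image_eqI) (use u in blast)
    qed
    ultimately show ?thesis unfolding stab_path_closure destab_path_closure by (simp add: image_Un)
  qed
  finally show ?thesis .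
qed

text \<open>After the shear one strand makes a full loop on the circle of radius 1/2 during the
  second half of the time. The others rest outside its disc, at \<open>k - 1/2\<close> with
  \<open>k \<ge> 2\<close>, so the loop shrinks linearly to its base point 1/2.\<close>

lemma destab_isotopy:
  "ambient_isotopic S3 (slice_closure (\<lambda>t. destab_path 0 t ` {1..m})) (slice_closure (\<lambda>t. destab_path 1 t ` {1..m}))"
proof (rule braid_isotopy[OF _ _ _ word_perm_bij[OF w]])
  show "destab_path r 1 x = destab_path r 0 (word_perm w x)" if "r \<in> {0..1}" "x \<in> {1..m}" for r x
  proof -
    have "new_turn (1/2) = 1" by (simp add: new_turn_def)
    then show ?thesis by (simp add: destab_path_def word_path_ends turn_values field_simps)
  qed
next
  fix x assume "x \<in> {1..m}"
  have 1: "continuous_on ({0..1} \<times> {0..1/2}) (\<lambda>(r :: real, t). word_path w (2 * t) x - 1/2)"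
    by (auto simp: case_prod_unfold intro!: continuous_intros continuous_on_word_path_coord)
  show "continuous_on ({0..1} \<times> {0..1}) (\<lambda>(r, t). destab_path r t x)"
  proof (cases "word_perm w x = 1")
    case True
    have "continuous_on ({0..1} \<times> {0..1}) (\<lambda>(r, t). if t \<le> 1/2 then word_path w (2 * t) x - 1/2
        else of_real (1 - r) * turn (new_turn (t - 1/2)) + of_real r / 2)"
    proof (rule continuous_on_half_cases[OF 1])
      have "new_turn 0 = 0" by (simp add: new_turn_def)
      then show "word_path w (2 * (1/2)) x - 1/2 = of_real (1 - r) * turn (new_turn (1/2 - 1/2)) + of_real r / 2" for r
        by (simp add: word_path_ends True turn_values field_simps)
    qed (auto simp: case_prod_unfold new_turn_def intro!: continuous_intros)
    then show ?thesis using True by (simp add: destab_path_def cong: if_cong)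
  next
    case False
    have "continuous_on ({0..1} \<times> {0..1}) (\<lambda>(r :: real, t). if t \<le> 1/2 then word_path w (2 * t) x - 1/2
        else of_nat (word_perm w x) - 1/2)"
      by (rule continuous_on_half_cases[OF 1])
        (auto simp: case_prod_unfold word_path_ends intro!: continuous_intros)
    then show ?thesis using False by (simp add: destab_path_def cong: if_cong)
  qed
next
  fix r t :: real assume r: "r \<in> {0..1}" and t: "t \<in> {0..1}"
  show "inj_on (destab_path r t) {1..m}"
  proof (cases "t \<le> 1/2")
    case True
    have "inj_on (\<lambda>x. word_path w (2 * t) x - 1/2) {1..m}"
    proof (rule inj_onI)
      fix x y assume "x \<in> {1..m}" "y \<in> {1..m}" "word_path w (2 * t) x - 1/2 = word_path w (2 * t) y - 1/2"
      then show "x = y" using inj_onD[OF inj_word_path[of "2 * t"], of x y] True t by simp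
    qed
    moreover have "destab_path r t x = word_path w (2 * t) x - 1/2" if "x \<in> {1..m}" for x
      using that True by (auto simp: destab_path_def)
    ultimately show ?thesis by (subst inj_on_cong) auto
  next
    case False
    define c where "c = of_real (1 - r) * turn (new_turn (t - 1/2)) + of_real r / 2"
    define h where "h k = (if k = 1 then c else of_nat k - 1/2)" for k :: nat
    have "norm c \<le> norm (of_real (1 - r) * turn (new_turn (t - 1/2))) + norm (of_real r / 2 :: complex)"
      unfolding c_def by (rule norm_triangle_ineq)
    also have "\<dots> = 1/2" using r by (simp add: norm_mult norm_divide field_simps del: of_real_diff)
    finally have c: "norm c \<le> 1/2" .
    have "of_nat k - 1/2 \<noteq> c" if "k \<ge> 2" for k
    proof
      assume "of_nat k - 1/2 = c"
      then have "norm (of_real (real k - 1/2) :: complex) \<le> 1/2" using c by simp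
      then show False using that unfolding norm_of_real by simp
    qed
    then have ck: "of_nat k - 1/2 \<noteq> c" "c \<noteq> of_nat k - 1/2" if "1 \<le> k" "k \<noteq> 1" for k
      using that by (metis One_nat_def Suc_1 Suc_leI le_neq_implies_less)+
    have "inj_on h {1..m}"
      by (rule inj_onI) (use ck in \<open>auto simp: h_def split: if_splits\<close>)
    then have "inj_on (h \<circ> word_perm w) {1..m}"
      using word_perm_bij[OF w] by (auto simp: bij_betw_def intro: comp_inj_on)
    moreover have "destab_path r t x = (h \<circ> word_perm w) x" if "x \<in> {1..m}" for x
      using that False by (auto simp: destab_path_def h_def c_def)
    ultimately show ?thesis by (subst inj_on_cong) auto
  qed
qed simp

lemma destab_closure:
  "ambient_isotopic S3 (slice_closure (\<lambda>t. destab_path 1 t ` {1..m})) (braid_closure m w)"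
proof -
  define p where "p = word_path w +++ (\<lambda>t. of_nat \<circ> word_perm w)"
  have "homotopic_paths (conf {1..m}) (word_path w) p"
    using homotopic_paths_rid_const[OF word_path(1,2)[OF w]] word_path(4)[OF w] by (simp add: p_def)
  then have "ambient_isotopic S3 (slice_closure (\<lambda>t. word_path w t ` {1..m})) (slice_closure (\<lambda>t. p t ` {1..m}))"
    by (rule homotopic_closure[OF _ _ word_perm_bij[OF w]]) (auto simp: word_path_ends)
  also have "ambient_isotopic S3 \<dots> (slice_closure (\<lambda>t. (\<lambda>z. z + (- 1/2)) ` p t ` {1..m}))"
    by (rule slice_closure_translate)
  also have "\<dots> = slice_closure (\<lambda>t. destab_path 1 t ` {1..m})"
  proof (rule slice_closure_cong)
    fix t :: real
    show "(\<lambda>z. z + (- 1/2)) ` p t ` {1..m} = destab_path 1 t ` {1..m}"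
      unfolding image_image by (rule image_cong) (auto simp: p_def joinpaths_def destab_path_def)
  qed
  finally have "ambient_isotopic S3 (slice_closure (\<lambda>t. word_path w t ` {1..m})) (slice_closure (\<lambda>t. destab_path 1 t ` {1..m}))" .
  with word_path_closure[OF w] have "ambient_isotopic S3 (braid_closure m w) (slice_closure (\<lambda>t. destab_path 1 t ` {1..m}))"
    by (rule ambient_isotopic_trans)
  then show ?thesis by (rule ambient_isotopic_sym) (rule braid_closure_subset_S3)
qed

text \<open>The letters of \<open>shift_word 1 w\<close> do not touch position 1, so the last letter
  is the only crossing there. After a conjugation the first left strand of a Lorenz braid has this
  form.\<close>

lemma left_destabilisation:
  "ambient_isotopic S3 (braid_closure (Suc m) (shift_word 1 w @ [Sigma 1])) (braid_closure m w)"
  using stab_closure stab_isotopy shear_closure destab_isotopy destab_closure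
  by (meson ambient_isotopic_trans)

end

section \<open>Braid relations and the Lorenz template\<close>

abbreviation run :: "nat \<Rightarrow> nat \<Rightarrow> braid_word" where
  "run a b \<equiv> map Sigma [a..<b]"

abbreviation repeat :: "nat \<Rightarrow> 'a list \<Rightarrow> 'a list" where
  "repeat k w \<equiv> concat (replicate k w)"

lemma braid_eq_append_left: "braid_eq m y y' \<Longrightarrow> valid m x \<Longrightarrow> braid_eq m (x @ y) (x @ y')"
  using braid_eq_append braid_eq_refl by blast

lemma braid_eq_append_right: "braid_eq m x x' \<Longrightarrow> valid m y \<Longrightarrow> braid_eq m (x @ y) (x' @ y)"
  using braid_eq_append braid_eq_refl by blast

lemma valid_run: "1 \<le> a \<Longrightarrow> b \<le> m \<Longrightarrow> valid m (run a b)"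
  by (auto simp: valid_def)

lemma valid_concat: "(\<And>w. w \<in> set ws \<Longrightarrow> valid m w) \<Longrightarrow> valid m (concat ws)"
  by (induction ws) auto

lemma valid_shift_1: "valid m w \<Longrightarrow> valid (Suc m) (shift_word 1 w)"
  by (auto simp: valid_def)

lemma run_far:
  assumes "1 \<le> a" "b \<le> m" "1 \<le> j" "j < m" "b < j \<or> Suc j < a"
  shows "braid_eq m (run a b @ [Sigma j]) ([Sigma j] @ run a b)"
  using assms
proof (induction b)
  case 0
  then show ?case by (simp add: braid_eq_refl)
next
  case (Suc b)
  show ?case
  proof (cases "a \<le> b")
    case True
    have "braid_eq m (run a b @ [Sigma b, Sigma j]) (run a b @ [Sigma j, Sigma b])"
      using Suc.prems True by (intro braid_eq_append_left braid_eq_far valid_run) auto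
    also have "run a b @ [Sigma j, Sigma b] = (run a b @ [Sigma j]) @ [Sigma b]" by simp
    also have "braid_eq m \<dots> (([Sigma j] @ run a b) @ [Sigma b])"
      using Suc.prems True by (intro braid_eq_append_right Suc.IH) auto
    finally show ?thesis using True by simp
  qed (use Suc.prems in \<open>simp add: braid_eq_refl\<close>)
qed

text \<open>The run takes one strand over all those that it passes, and these move one position to
  the left. A crossing of two of them can therefore be made before the run, one position further to
  the right.\<close>

lemma run_slide_gen:
  assumes "1 \<le> a" "b \<le> m" "a \<le> i" "Suc i < b"
  shows "braid_eq m (run a b @ [Sigma i]) ([Sigma (Suc i)] @ run a b)"
proof -
  have split: "run a b = run a i @ [Sigma i, Sigma (Suc i)] @ run (Suc (Suc i)) b"
  proof -
    have "[a..<b] = [a..<i] @ [i..<b]" using assms upt_add_eq_append[of a i "b - i"] by simp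
    also have "[i..<b] = i # Suc i # [Suc (Suc i)..<b]" using assms by (simp add: upt_conv_Cons)
    finally show ?thesis by simp
  qed
  have v: "valid m (run a i)" "valid m (run (Suc (Suc i)) b)" "valid m [Sigma i, Sigma (Suc i)]" "valid m [Sigma i]"
    using assms by (auto intro!: valid_run)
  have "braid_eq m (run a b @ [Sigma i]) ((run a i @ [Sigma i, Sigma (Suc i)]) @ ([Sigma i] @ run (Suc (Suc i)) b))"
    unfolding split append_assoc
    using v assms by (intro braid_eq_append_left run_far) auto
  also have "braid_eq m ((run a i @ [Sigma i, Sigma (Suc i)]) @ ([Sigma i] @ run (Suc (Suc i)) b))
      (run a i @ [Sigma (Suc i), Sigma i, Sigma (Suc i)] @ run (Suc (Suc i)) b)"
    using braid_eq_append_left[OF braid_eq_append_right[OF braid_eq_braid[of i m] v(2)] v(1)] assms by simp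
  also have "braid_eq m (run a i @ [Sigma (Suc i), Sigma i, Sigma (Suc i)] @ run (Suc (Suc i)) b)
      ([Sigma (Suc i)] @ run a b)"
    using braid_eq_append_right[OF run_far[of a i m "Suc i"], of "[Sigma i, Sigma (Suc i)] @ run (Suc (Suc i)) b"] v assms
    by (simp add: split)
  finally show ?thesis .
qed

lemma run_slide:
  assumes "1 \<le> a" "b \<le> m" "\<forall>g\<in>set T. \<exists>i. g = Sigma i \<and> a \<le> i \<and> Suc i < b"
  shows "braid_eq m (run a b @ T) (shift_word 1 T @ run a b)"
  using assms(3)
proof (induction T)
  case Nil
  then show ?case using assms by (simp add: braid_eq_refl valid_run)
next
  case (Cons g T)
  then obtain i where i: "g = Sigma i" "a \<le> i" "Suc i < b" by auto
  have vT: "valid m T" using Cons.prems assms by (fastforce simp: valid_def)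
  have "braid_eq m ((run a b @ [Sigma i]) @ T) (([Sigma (Suc i)] @ run a b) @ T)"
    using i assms vT by (intro braid_eq_append_right run_slide_gen)
  also have "braid_eq m (([Sigma (Suc i)] @ run a b) @ T) ([Sigma (Suc i)] @ shift_word 1 T @ run a b)"
    using Cons i assms by (simp only: append_assoc) (intro braid_eq_append_left, auto)
  finally show ?case by (simp add: i Suc_eq_plus1)
qed

lemma shift_run: "shift_word k (run a b) = run (a + k) (b + k)"
  by (induction b) auto

lemma half_twist_Suc: "half_twist a (Suc m) = run (a + 1) (a + Suc m) @ half_twist a m"
  by (simp add: half_twist_def)

lemma half_twist_0: "half_twist a 0 = []"
  by (simp add: half_twist_def)

lemma half_twist_shift: "half_twist a m = shift_word a (half_twist 0 m)"
proof (induction m)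
  case (Suc m)
  have "run (a + 1) (a + Suc m) = shift_word a (run (0 + 1) (0 + Suc m))"
    unfolding shift_run by (simp add: add.commute del: upt_Suc)
  then show ?case by (simp only: half_twist_Suc Suc map_append)
qed (simp add: half_twist_0)

lemma half_twist_letters: "g \<in> set (half_twist 0 m) \<Longrightarrow> \<exists>i. g = Sigma i \<and> 1 \<le> i \<and> i < m"
  by (induction m) (auto simp: half_twist_0 half_twist_Suc less_Suc_eq)

lemma valid_half_twist: "valid m (half_twist 0 m)"
  using half_twist_letters by (fastforce simp: valid_def)

lemma shift_shift: "shift_word k (shift_word l w) = shift_word (k + l) w"
proof -
  have "shift_gen k (shift_gen l g) = shift_gen (k + l) g" for g by (cases g) auto
  then show ?thesis by simp
qed

lemma shift_word_0: "shift_word 0 w = w"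
proof -
  have "shift_gen 0 g = g" for g by (cases g) auto
  then show ?thesis by (simp add: map_idI)
qed

section \<open>The full twist as a power of a run\<close>

text \<open>In the induction step the half twist on the last \<open>k\<close> strands is moved
  through the new run, which shifts it down by one. The run is then cut at \<open>q - k\<close>: its
  first piece extends the product of shrinking runs, the second enlarges the half twist to
  \<open>k + 1\<close> strands. For \<open>k = q\<close> both factors are half twists on all
  strands.\<close>

lemma repeat_run:
  assumes "k \<le> q"
  shows "braid_eq q (repeat k (run 1 q))
    (concat (map (run 1) (rev [Suc (q - k)..<Suc q])) @ shift_word (q - k) (half_twist 0 k))"
  using assms
proof (induction k)
  case 0
  then show ?case by (simp add: half_twist_0 braid_eq_refl)
next
  case (Suc k)
  let ?P = "concat (map (run 1) (rev [Suc (q - k)..<Suc q]))"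
  define S where "S = shift_word (q - Suc k) (half_twist 0 k)"
  have S: "shift_word 1 S = shift_word (q - k) (half_twist 0 k)"
  proof -
    have "1 + (q - Suc k) = q - k" using Suc.prems by simp
    then show ?thesis unfolding S_def shift_shift by simp
  qed
  have SL: "\<forall>g\<in>set S. \<exists>i. g = Sigma i \<and> 1 \<le> i \<and> Suc i < q"
  proof
    fix g assume "g \<in> set S"
    then obtain h where "h \<in> set (half_twist 0 k)" "g = shift_gen (q - Suc k) h" by (auto simp: S_def)
    then obtain i where "g = Sigma (i + (q - Suc k))" "1 \<le> i" "i < k" using half_twist_letters by fastforce
    then show "\<exists>i. g = Sigma i \<and> 1 \<le> i \<and> Suc i < q" using Suc.prems by auto
  qed
  have vP: "valid q ?P" by (rule valid_concat) (auto intro!: valid_run)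
  have "braid_eq q (repeat k (run 1 q) @ run 1 q) ((?P @ shift_word 1 S) @ run 1 q)"
    unfolding S using Suc by (intro braid_eq_append_right) (auto intro!: valid_run)
  also have "braid_eq q ((?P @ shift_word 1 S) @ run 1 q) (?P @ run 1 q @ S)"
    unfolding append_assoc using SL vP
    by (intro braid_eq_append_left braid_eq_sym[OF run_slide]) auto
  also have "?P @ run 1 q @ S = (?P @ run 1 (q - k)) @ (run (q - k) q @ S)"
  proof -
    have "[1..<q] = [1..<q - k] @ [q - k..<q]"
      using Suc.prems upt_add_eq_append[of 1 "q - k" k] by simp
    then show ?thesis by simp
  qed
  also have "?P @ run 1 (q - k) = concat (map (run 1) (rev [Suc (q - Suc k)..<Suc q]))"
  proof -
    have "[Suc (q - Suc k)..<Suc q] = (q - k) # [Suc (q - k)..<Suc q]"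
      using Suc.prems by (simp add: upt_conv_Cons Suc_diff_Suc del: upt_Suc)
    then show ?thesis by (simp del: upt_Suc)
  qed
  also have "run (q - k) q @ S = shift_word (q - Suc k) (half_twist 0 (Suc k))"
  proof -
    have "0 + 1 + (q - Suc k) = q - k" "0 + Suc k + (q - Suc k) = q" using Suc.prems by simp_all
    then show ?thesis by (simp only: half_twist_Suc map_append S_def shift_run)
  qed
  also have "repeat k (run 1 q) @ run 1 q = repeat (Suc k) (run 1 q)"
    using replicate_append_same[of k "run 1 q"] by (metis concat_append concat.simps(1,2) append_Nil2 replicate_Suc)
  finally show ?case .
qed

lemma full_twist: "braid_eq q (repeat q (run 1 q)) (half_twist 0 q @ half_twist 0 q)"
proof -
  have "concat (map (run 1) (rev [Suc 0..<Suc q])) = half_twist 0 q"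
    by (simp add: half_twist_def One_nat_def)
  then show ?thesis using repeat_run[of q q] by (simp add: shift_word_0 del: upt_Suc)
qed

lemma valid_repeat: "valid m w \<Longrightarrow> valid m (repeat k w)"
  by (induction k) auto

lemma braid_eq_repeat: "braid_eq m x y \<Longrightarrow> braid_eq m (repeat k x) (repeat k y)"
  by (induction k) (auto intro: braid_eq_append braid_eq_refl)

lemma repeat_mult: "repeat (k * l) w = repeat k (repeat l w)"
  by (induction k) (simp_all add: replicate_add)

lemma gen_index_inv [simp]: "gen_index (gen_inv g) = gen_index g"
  by (cases g) auto

lemma valid_inv: "valid m w \<Longrightarrow> valid m (word_inv w)"
  by (auto simp: valid_def word_inv_def)

lemma word_inv_Cons: "word_inv (g # w) = word_inv w @ [gen_inv g]"
  by (simp add: word_inv_def)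

lemma braid_eq_inv: "valid m w \<Longrightarrow> braid_eq m (w @ word_inv w) []"
proof (induction w)
  case Nil
  then show ?case by (simp add: word_inv_def braid_eq_refl)
next
  case (Cons g w)
  have "braid_eq m ([g] @ (w @ word_inv w) @ [gen_inv g]) ([g] @ [] @ [gen_inv g])"
    using Cons by (intro braid_eq_append_left braid_eq_append_right) auto
  also have "braid_eq m ([g] @ [] @ [gen_inv g]) []"
    using braid_eq_cancel[of g m] Cons.prems by simp
  finally show ?case by (simp add: word_inv_Cons)
qed

lemma braid_eq_repeat_inv:
  assumes "valid m w"
  shows "braid_eq m (repeat k w @ repeat k (word_inv w)) []"
proof (induction k)
  case 0
  then show ?case by (simp add: braid_eq_refl)
next
  case (Suc k)
  have "repeat (Suc k) w = repeat k w @ w"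
    using replicate_append_same[of k w] by (metis concat_append concat.simps(1,2) append_Nil2 replicate_Suc)
  then have "repeat (Suc k) w @ repeat (Suc k) (word_inv w) = repeat k w @ (w @ word_inv w) @ repeat k (word_inv w)"
    by simp
  moreover have "braid_eq m \<dots> (repeat k w @ [] @ repeat k (word_inv w))"
    using assms by (intro braid_eq_append_left braid_eq_append_right braid_eq_inv valid_repeat valid_inv)
  ultimately show ?case using Suc braid_eq_trans by (metis append_Nil)
qed

section \<open>Removing the left strands of a Lorenz braid\<close>

text \<open>The braid of the Lorenz template whose i-th left strand crosses over \<open>ds ! (i - 1)\<close> strands.\<close>

fun overcross_word :: "nat list \<Rightarrow> braid_word" where
  "overcross_word [] = []"
| "overcross_word (d # ds) = shift_word 1 (overcross_word ds) @ run 1 (Suc d)"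

text \<open>The first left strand is moved last, so its run is the final factor. The others form a
  Lorenz braid shifted by one, whose map is \<open>f\<close> with arguments and values
  renumbered.\<close>

lemma lorenz_word_overcross:
  assumes "\<And>i. i < length ds \<Longrightarrow> f (Suc i) = Suc i + ds ! i"
  shows "lorenz_word (length ds) f = overcross_word ds"
  using assms
proof (induction ds arbitrary: f)
  case Nil
  then show ?case by (simp add: lorenz_word_def)
next
  case (Cons d ds)
  define g where "g i = f (Suc i) - 1" for i
  have g: "g (Suc i) = Suc i + ds ! i" if "i < length ds" for i
    using Cons.prems[of "Suc i"] that by (simp add: g_def)
  have "[1..<Suc (Suc (length ds))] = 1 # map Suc [1..<Suc (length ds)]"
    by (simp add: map_Suc_upt upt_conv_Cons One_nat_def del: upt_Suc)
  then have "lorenz_word (length (d # ds)) f =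
      concat (map (\<lambda>i. run (Suc i) (f (Suc i))) (rev [1..<Suc (length ds)])) @ run 1 (f 1)"
    by (simp add: lorenz_word_def rev_map o_def del: upt_Suc)
  also have "map (\<lambda>i. run (Suc i) (f (Suc i))) (rev [1..<Suc (length ds)]) =
      map (\<lambda>i. shift_word 1 (run i (g i))) (rev [1..<Suc (length ds)])"
  proof (rule map_cong)
    fix i assume "i \<in> set (rev [1..<Suc (length ds)])"
    then have "1 \<le> i" "i \<le> length ds" by (auto simp del: upt_Suc)
    then obtain j where "i = Suc j" "j < length ds" by (cases i) auto
    then have "f (Suc i) = g i + 1" using Cons.prems[of "Suc j"] by (simp add: g_def)
    then show "run (Suc i) (f (Suc i)) = shift_word 1 (run i (g i))"
      unfolding shift_run by (simp only: Suc_eq_plus1)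
  qed simp
  also have "concat \<dots> = shift_word 1 (lorenz_word (length ds) g)"
    by (simp add: lorenz_word_def map_concat o_def del: upt_Suc)
  also have "lorenz_word (length ds) g = overcross_word ds" using g by (rule Cons.IH)
  also have "f 1 = Suc d" using Cons.prems[of 0] by (simp add: One_nat_def)
  finally show ?case by simp
qed

lemma valid_overcross: "\<forall>d\<in>set ds. d \<le> q \<Longrightarrow> valid (length ds + q) (overcross_word ds)"
proof (induction ds)
  case (Cons d ds)
  then have "valid (Suc (length ds + q)) (shift_word 1 (overcross_word ds))" by (intro valid_shift_1) auto
  moreover have "valid (Suc (length ds + q)) (run 1 (Suc d))" using Cons.prems by (intro valid_run) auto
  ultimately show ?case by (simp del: upt_Suc)
qed simp

text \<open>
  The first left strand crosses over the accumulated word \<open>T\<close> of the strands removed before, so that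
  it can be destabilised.
\<close>

lemma overcross_destabilisation:
  assumes "sorted ds" "\<forall>d\<in>set ds. 1 \<le> d \<and> d \<le> q" "valid q B" "valid q T" "1 \<le> q"
    and "\<forall>g\<in>set T. \<forall>d\<in>set ds. \<exists>i. g = Sigma i \<and> 1 \<le> i \<and> i < d"
  shows "ambient_isotopic S3
    (braid_closure (length ds + q) (shift_word (length ds) B @ overcross_word ds @ T))
    (braid_closure q (B @ T @ concat (map (run 1) ds)))"
  using assms
proof (induction ds arbitrary: T)
  case Nil
  then show ?case by (simp add: shift_word_0 ambient_isotopic_refl)
next
  case (Cons d ds)
  define m where "m = length ds + q"
  let ?B = "shift_word (length ds) B"
  \<comment> \<open>What remains when the first left strand is removed: its run consists of
    \<open>Sigma 1\<close>, consumed by the destabilisation, and a shifted \<open>run 1 d\<close>,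
    which conjugation brings to the front.\<close>
  let ?W = "run 1 d @ ?B @ overcross_word ds @ T"
  have d: "1 \<le> d" "d \<le> q" using Cons.prems by auto
  have vT: "valid m T" using Cons.prems by (fastforce simp: valid_def m_def)
  have vB: "valid m ?B" using valid_shift[OF Cons.prems(3), of "length ds"] by (simp add: m_def add.commute)
  have vO: "valid m (overcross_word ds)" unfolding m_def using Cons.prems by (intro valid_overcross) auto
  have vW: "valid m ?W" using d vT vB vO by (auto simp: m_def intro!: valid_run)
  have run_d: "run 1 (Suc d) = [Sigma 1] @ shift_word 1 (run 1 d)"
  proof -
    have "[1..<Suc d] = 1 # [1 + 1..<d + 1]" using d by (simp add: upt_conv_Cons Suc_eq_plus1 del: upt_Suc)
    then show ?thesis unfolding shift_run by (simp del: upt_Suc)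
  qed
  \<comment> \<open>The letters of \<open>T\<close> are smaller than \<open>d\<close>, so they only
    involve strands that the first left strand has passed over. Moved before the run, they avoid
    position 1.\<close>
  have "braid_eq (Suc m) (run 1 (Suc d) @ T) (shift_word 1 T @ run 1 (Suc d))"
  proof (rule run_slide)
    show "\<forall>g\<in>set T. \<exists>i. g = Sigma i \<and> 1 \<le> i \<and> Suc i < Suc d" using Cons.prems(6) by auto
  qed (use d in \<open>auto simp: m_def\<close>)
  then have "braid_eq (Suc m) ((shift_word 1 ?B @ shift_word 1 (overcross_word ds)) @ run 1 (Suc d) @ T)
      ((shift_word 1 ?B @ shift_word 1 (overcross_word ds)) @ shift_word 1 T @ run 1 (Suc d))"
    using valid_shift_1[OF vB] valid_shift_1[OF vO] by (intro braid_eq_append_left) (auto simp del: map_map)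
  then have "ambient_isotopic S3
      (braid_closure (Suc m) ((shift_word 1 ?B @ shift_word 1 (overcross_word ds)) @ run 1 (Suc d) @ T))
      (braid_closure (Suc m) ((shift_word 1 ?B @ shift_word 1 (overcross_word ds)) @ shift_word 1 T @ run 1 (Suc d)))"
    by (rule braid_eq_closure)
  also have "(shift_word 1 ?B @ shift_word 1 (overcross_word ds)) @ shift_word 1 T @ run 1 (Suc d) =
      (shift_word 1 ?B @ shift_word 1 (overcross_word ds) @ shift_word 1 T @ [Sigma 1]) @ shift_word 1 (run 1 d)"
    unfolding run_d by simp
  also have "ambient_isotopic S3 (braid_closure (Suc m) \<dots>) (braid_closure (Suc m) (shift_word 1 (run 1 d) @
      (shift_word 1 ?B @ shift_word 1 (overcross_word ds) @ shift_word 1 T @ [Sigma 1])))"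
    by (rule braid_closure_cyclic)
  also have "shift_word 1 (run 1 d) @ (shift_word 1 ?B @ shift_word 1 (overcross_word ds) @ shift_word 1 T @ [Sigma 1]) =
      shift_word 1 ?W @ [Sigma 1]" by simp
  also have "ambient_isotopic S3 (braid_closure (Suc m) (shift_word 1 ?W @ [Sigma 1])) (braid_closure m ?W)"
    using vW Cons.prems(5) by (intro left_destabilisation) (auto simp: m_def)
  also have "ambient_isotopic S3 (braid_closure m ?W) (braid_closure m ((?B @ overcross_word ds @ T) @ run 1 d))"
    by (rule braid_closure_cyclic)
  also have "(?B @ overcross_word ds @ T) @ run 1 d = ?B @ overcross_word ds @ (T @ run 1 d)" by simp
  also have "ambient_isotopic S3 (braid_closure m \<dots>) (braid_closure q (B @ (T @ run 1 d) @ concat (map (run 1) ds)))"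
    unfolding m_def
  proof (rule Cons.IH)
    show "valid q (T @ run 1 d)" using Cons.prems d by (auto intro!: valid_run)
    \<comment> \<open>By sortedness the letters of \<open>run 1 d\<close> are smaller than every
      later entry, so the accumulated word keeps its bound.\<close>
    show "\<forall>g\<in>set (T @ run 1 d). \<forall>e\<in>set ds. \<exists>i. g = Sigma i \<and> 1 \<le> i \<and> i < e"
      using Cons.prems(1,6) by fastforce
  qed (use Cons.prems in auto)
  finally show ?case by (simp add: m_def shift_shift plus_1_eq_Suc del: map_map upt_Suc)
qed

section \<open>Representations of a T-link\<close>

lemma sorted_wrt_less_last: "sorted_wrt (<) xs \<Longrightarrow> x \<in> set xs \<Longrightarrow> x \<le> last xs" for x :: nat
  by (induction xs) (auto dest: order.strict_implies_order)

lemma sorted_blocks: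
  "sorted_wrt (<) (map fst rs) \<Longrightarrow> sorted (concat (map (\<lambda>(r, s). replicate s r) rs))" for rs :: "(nat \<times> nat) list"
proof (induction rs)
  case (Cons a rs)
  have "sorted (replicate s r)" for s and r :: nat by (induction s) auto
  then show ?case using Cons by (fastforce simp: sorted_append split: prod.splits)
qed simp

text \<open>Entry \<open>i\<close> of \<open>ds\<close> counts the right strands crossed by left
  strand \<open>i + 1\<close>. All numbers r lie between 1 and \<open>q\<close>, so
  \<open>ds\<close> is sorted; this gives both the strict monotonicity of \<open>f\<close> and the
  order needed to remove the left strands. The number of inverse full twists is \<open>k\<close>,
  and \<open>M\<close> remains free.\<close>

lemma T_link_representation:
  fixes k M :: nat
  assumes "T_link_parameters rs"
  defines "q \<equiv> fst (last rs)"
  defines "ds \<equiv> replicate M 1 @ concat (map (\<lambda>(r, s). replicate s r) rs) @ replicate (k * q) q"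
  defines "p \<equiv> length ds"
  defines "f \<equiv> (\<lambda>i\<in>{1..p}. i + ds ! (i - 1))"
  shows "(p + q, p, f) \<in> representations 0 (- (2 * int k)) (T_link rs)"
proof -
  let ?E = "concat (map (\<lambda>(r, s). replicate s r) rs)"
  let ?\<Delta> = "half_twist 0 q"
  have rs: "rs \<noteq> []" "sorted_wrt (<) (map fst rs)" "\<forall>(r, s)\<in>set rs. 2 \<le> r \<and> 0 < s"
    using assms(1) by (auto simp: T_link_parameters_def)
  have rq: "2 \<le> r \<and> r \<le> q" if "(r, s) \<in> set rs" for r s
    using rs that sorted_wrt_less_last[OF rs(2), of r] by (force simp: q_def last_map)
  have q: "2 \<le> q" using rq[of q "snd (last rs)"] rs(1) by (simp add: q_def)
  have dsq: "\<forall>d\<in>set ds. 1 \<le> d \<and> d \<le> q" using rq q by (fastforce simp: ds_def)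
  have E: "2 \<le> d \<and> d \<le> q" if "d \<in> set ?E" for d using rq that by fastforce
  have srt: "sorted ds"
  proof -
    have "sorted (replicate s r)" for s and r :: nat by (induction s) auto
    then show ?thesis using sorted_blocks[OF rs(2)] E q by (fastforce simp: ds_def sorted_append)
  qed
  have fv: "f (Suc i) = Suc i + ds ! i" if "i < length ds" for i
    using that by (simp add: f_def p_def)
  have "(p + q, p, f) \<in> lorenz_data"
  proof -
    have "f \<in> {1..p} \<rightarrow>\<^sub>E {1..p + q}"
    proof (rule PiE_I)
      fix i assume "i \<in> {1..p}"
      then show "f i \<in> {1..p + q}" using dsq nth_mem[of "i - 1" ds] by (fastforce simp: f_def p_def)
    qed (auto simp: f_def restrict_def)
    moreover have "strict_mono_on {1..p} f"
    proof (rule strict_mono_onI)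
      fix i j assume "i \<in> {1..p}" "j \<in> {1..p}" "i < j"
      moreover from this have "ds ! (i - 1) \<le> ds ! (j - 1)"
        by (intro sorted_nth_mono[OF srt]) (auto simp: p_def)
      ultimately show "f i < f j" by (simp add: f_def)
    qed
    ultimately show ?thesis using q by (simp add: lorenz_data_def)
  qed
  moreover have "ambient_isotopic S3 (lorenz_like_link 0 (- (2 * int k)) (p + q, p, f)) (T_link rs)"
  proof -
    define B where "B = repeat (2 * k) (word_inv ?\<Delta>)"
    have vD: "valid q ?\<Delta>" by (rule valid_half_twist)
    have vB: "valid q B" unfolding B_def by (intro valid_repeat valid_inv vD)
    have inv_shift: "word_inv (shift_word a w) = shift_word a (word_inv w)" for a w
    proof -
      have "gen_inv (shift_gen a g) = shift_gen a (gen_inv g)" for g by (cases g) auto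
      then show ?thesis by (simp add: word_inv_def rev_map)
    qed
    have pow: "word_pow (half_twist p q) (- (2 * int k)) = shift_word p B"
    \<comment> \<open>\<open>word_pow\<close> treats the exponent 0 as nonnegative, so the inverse
      word appears only for positive \<open>k\<close>.\<close>
    proof (cases "k = 0")
      case False
      have "nat (2 * int k) = 2 * k" by simp
      then show ?thesis using False half_twist_shift[of p q]
        by (simp add: word_pow_def B_def inv_shift map_concat)
    qed (simp add: word_pow_def B_def)
    have lor: "lorenz_word p f = overcross_word ds" unfolding p_def by (rule lorenz_word_overcross) (rule fv)
    have TW: "concat (map (run 1) ?E) = T_link_word rs"
      unfolding T_link_word_def by (induction rs) (auto simp: map_replicate)
    have vTW: "valid q (T_link_word rs)"
      unfolding TW[symmetric] by (rule valid_concat) (use E in \<open>auto intro!: valid_run\<close>)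
    have runs: "concat (map (run 1) ds) = T_link_word rs @ repeat (k * q) (run 1 q)"
    proof -
      have "concat (map (run 1) (replicate M 1)) = []" by (induction M) auto
      then show ?thesis by (simp add: ds_def TW map_replicate)
    qed
    have "braid_eq q (repeat (k * q) (run 1 q)) (repeat k (?\<Delta> @ ?\<Delta>))"
      unfolding repeat_mult by (rule braid_eq_repeat) (rule full_twist)
    also have "repeat k (?\<Delta> @ ?\<Delta>) = repeat (2 * k) ?\<Delta>"
      by (induction k) auto
    finally have "braid_eq q (repeat (k * q) (run 1 q) @ B) (repeat (2 * k) ?\<Delta> @ B)"
      using vB by (rule braid_eq_append_right)
    also have "braid_eq q (repeat (2 * k) ?\<Delta> @ B) []"
      unfolding B_def by (rule braid_eq_repeat_inv[OF vD])
    finally have "braid_eq q ((repeat (k * q) (run 1 q) @ B) @ T_link_word rs) ([] @ T_link_word rs)"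
      using vTW by (rule braid_eq_append_right)
    then have cancel: "braid_eq q (repeat (k * q) (run 1 q) @ B @ T_link_word rs) (T_link_word rs)" by simp
    have "lorenz_like_link 0 (- (2 * int k)) (p + q, p, f) = braid_closure (length ds + q) (shift_word (length ds) B @ overcross_word ds @ [])"
    proof -
      have "word_pow w 0 = []" for w by (simp add: word_pow_def)
      then show ?thesis unfolding p_def[symmetric] by (simp add: lorenz_like_link_def pow lor)
    qed
    also have "ambient_isotopic S3 \<dots> (braid_closure q (B @ [] @ concat (map (run 1) ds)))"
      using srt dsq vB q by (intro overcross_destabilisation) auto
    \<comment> \<open>The last \<open>k * q\<close> left strands leave positive full twists at the
      end of the word; conjugation puts them next to their inverse \<open>B\<close>.\<close>
    also have "B @ [] @ concat (map (run 1) ds) = (B @ T_link_word rs) @ repeat (k * q) (run 1 q)"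
      by (simp add: runs)
    also have "ambient_isotopic S3 (braid_closure q \<dots>) (braid_closure q (repeat (k * q) (run 1 q) @ (B @ T_link_word rs)))"
      by (rule braid_closure_cyclic)
    also have "ambient_isotopic S3 \<dots> (braid_closure q (T_link_word rs))"
      using cancel by (rule braid_eq_closure)
    finally show ?thesis by (simp add: T_link_def q_def)
  qed
  ultimately show ?thesis by (simp add: representations_def)
qed

theorem theorem3p7:
  fixes n :: int and rs :: "(nat \<times> nat) list"
  assumes "n < 0" and "T_link_parameters rs"
  shows "infinite (representations 0 (2 * n) (T_link rs))"
proof -
  define k where "k = nat (- n)"
  have n: "2 * n = - (2 * int k)" using assms(1) by (simp add: k_def)
  define ds where "ds M = replicate M (1 :: nat) @ concat (map (\<lambda>(r, s). replicate s r) rs) @ replicate (k * fst (last rs)) (fst (last rs))" for M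
  define X where "X M = (length (ds M) + fst (last rs), length (ds M), \<lambda>i\<in>{1..length (ds M)}. i + ds M ! (i - 1))" for M
  have "X M \<in> representations 0 (2 * n) (T_link rs)" for M
    using T_link_representation[OF assms(2), of M k] by (simp add: X_def ds_def n)
  then have "range X \<subseteq> representations 0 (2 * n) (T_link rs)" by auto
  \<comment> \<open>The second component of \<open>X M\<close> is the length of \<open>ds M\<close>,
    which exceeds \<open>M\<close> by a constant.\<close>
  moreover have "inj X" by (rule injI) (simp add: X_def ds_def)
  then have "infinite (range X)" by (simp add: finite_image_iff)
  ultimately show ?thesis using finite_subset by blast
qed

end
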